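(* Let $M$ be any compact Riemannian manifold with $\dim M \ge 1$, fix any $m \in \mathbb{N}$, $m \ge 3$, let $S^1=\mathbb{R}/\mathbb{Z}$, and let $h\colon S^1\to S^1$, $h(\varphi) = m\varphi \bmod 1$, be the standard linear expanding map. Let $\mathcal{C}(M)$ be the metric space of all skew products over $h$ with the fiber $M$. Then there exists a nonempty open set in $\mathcal{C}(M)$ such that any skew product from this set has a massive attractor.
   Context: Skew products: $\mathcal{C}(M)$ is the space of all maps $F\colon S^1\times M \to S^1 \times M$ of the form $F(\varphi,x) = (h\varphi, f_\varphi(x))$, $\varphi\in S^1$, $x \in M$, where each $f_\varphi\colon M\to M$ is a $C^1$-diffeomorphism onto its image and $f_\varphi$ is $C^0$ in $\varphi$. The metric on $\mathcal{C}(M)$ is $\operatorname{dist}(F,G) := \sup_\varphi \operatorname{dist}_{C^1}(f_\varphi^{\pm1}, g_\varphi^{\pm 1})$, where $g_\varphi$ are the fiber maps of $G$; that is, it takes into account the $C^1$-distances between corresponding fiber maps and between their inverses. Put $X = S^1\times M$ and let a map $F\colon X\to X$ define a discrete-time dynamical system. Region: the closure of a non-empty connected open set in $X$. Trapping set and maximal attractor: a compact set $D \subset X$ is called trapping if $F(D) \subset \operatorname{int} D$, where $\operatorname{int}$ denotes the interior; then the closed $F$-invariant set $A_{\max} := \bigcap_{n=0}^\infty F^n(D)$ is called a maximal attractor for $F$. A trapping region is a region that is trapping. SRB measure: let $\mathrm{Leb}$ be the Lebesgue measure on $X$. An $F$-invariant measure $\mu$ is called Sinai-Ruelle-Bowen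 (SRB) if there exists a measurable set $E \subset X$, $\mathrm{Leb}(E)>0$, such that for any test function $\psi \in C(X)$ and any $x \in E$, $\lim_{n\to\infty} \frac1n \sum_{i=0}^{n-1} \psi(F^i(x)) = \int_X \psi \, d\mu$. The set $E = E(\mu)$ is called the basin of $\mu$. Massive attractor: let $A_{\max} \neq X$ be a maximal attractor for a certain trapping region $D \supset A_{\max}$. It is called massive if (1) $A_{\max}$ is a region; (2) $A_{\max}$ is the support of an invariant ergodic SRB measure $\mu$ such that $E(\mu) \supset D$.
   Formalization: In the definition of massive attractor, E(μ) ⊃ D is read up to a Lebesgue-null set: almost every point of D lies in the basin. The pointwise inclusion fails for every skew product over h, since orbits in the fiber over the fixed point 0 never leave it. *)

theory Defs
  imports "HOL-Analysis.Analysis" "HOL-Probability.Probability"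
begin

section \<open>The circle and the linear expanding map\<close>

quotient_type circle = real / "\<lambda>x y. x - y \<in> \<int>"
proof (rule equivpI)
  show "reflp (\<lambda>x y :: real. x - y \<in> \<int>)"
    by (simp add: reflp_def)
  show "symp (\<lambda>x y :: real. x - y \<in> \<int>)"
    by (metis (no_types, lifting) Ints_minus minus_diff_eq sympI)
  show "transp (\<lambda>x y :: real. x - y \<in> \<int>)"
    by (rule transpI) (metis Ints_add diff_add_cancel add_diff_eq)
qed

text \<open>The topology is the quotient topology.\<close>

instantiation circle :: topological_space
begin

definition open_circle :: "circle set \<Rightarrow> bool"
  where "open_circle U \<longleftrightarrow> open (abs_circle -` U)"

instance
proof
  show "open (UNIV :: circle set)"
    by (simp add: open_circle_def)
  show "open (S \<inter> T)" if "open S" "open T" for S T :: "circle set"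
    using that by (simp add: open_circle_def open_Int)
  show "open (\<Union>K)" if "\<forall>S\<in>K. open S" for K :: "circle set set"
    using that by (auto simp: open_circle_def vimage_Union intro!: open_UN)
qed

end

lift_definition expanding_map :: "nat \<Rightarrow> circle \<Rightarrow> circle"
  is "\<lambda>m x. of_nat m * x"
  by (metis Ints_mult Ints_of_nat right_diff_distrib)

definition circle_lebesgue :: "circle measure"
  where "circle_lebesgue = distr (restrict_space lborel {0..<1}) borel abs_circle"


section \<open>Compact Riemannian manifolds\<close>

text \<open>\<open>C_on k S f\<close>: \<open>f\<close> is of class \<open>C\<^sup>k\<close> on the open set \<open>S\<close>.\<close>

primrec C_on :: "nat \<Rightarrow> 'a::real_normed_vector set \<Rightarrow> ('a \<Rightarrow> 'b::real_normed_vector) \<Rightarrow> bool"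
  where
    "C_on 0 S f \<longleftrightarrow> continuous_on S f"
  | "C_on (Suc k) S f \<longleftrightarrow>
       (\<forall>x\<in>S. f differentiable (at x)) \<and>
       (\<forall>v. C_on k S (\<lambda>x. frechet_derivative f (at x) v))"

definition smooth_on :: "'a::real_normed_vector set \<Rightarrow> ('a \<Rightarrow> 'b::real_normed_vector) \<Rightarrow> bool"
  where "smooth_on S f \<longleftrightarrow> (\<forall>k. C_on k S f)"

text \<open>
  The points of the manifold are the elements of a type whose topology is that of the
  manifold; being Hausdorff and second countable is expressed by type classes.
  A chart is a pair of its domain and its coordinate map, only the values of which on the domain
  matter. The dimension is \<open>CARD('n)\<close>, which is at least 1 for every type \<open>'n\<close> of class finite.
\<close>

type_synonym ('a, 'n) chart = "'a set \<times> ('a \<Rightarrow> real ^ 'n)"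

definition chart_inv :: "('a, 'n) chart \<Rightarrow> real ^ 'n \<Rightarrow> 'a"
  where "chart_inv c = inv_into (fst c) (snd c)"

definition is_chart :: "('a::topological_space, 'n::finite) chart \<Rightarrow> bool"
  where "is_chart c \<longleftrightarrow> open (fst c) \<and> open (snd c ` fst c) \<and>
           homeomorphism (fst c) (snd c ` fst c) (snd c) (chart_inv c)"

definition smooth_atlas :: "('a::topological_space, 'n::finite) chart set \<Rightarrow> bool"
  where "smooth_atlas A \<longleftrightarrow>
           (\<forall>c\<in>A. is_chart c) \<and> (\<Union>c\<in>A. fst c) = UNIV \<and>
           (\<forall>c\<in>A. \<forall>d\<in>A. smooth_on (snd c ` (fst c \<inter> fst d)) (snd d \<circ> chart_inv c))"

text \<open>
  A Riemannian metric is given by its Gram matrices \<open>g c y\<close> in the charts \<open>c\<close>,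
  at the points \<open>y\<close> of the coordinate domain of \<open>c\<close>, subject to the transformation law of
  covariant 2-tensors.
\<close>

definition riemannian_metric ::
    "('a::topological_space, 'n::finite) chart set \<Rightarrow>
     (('a, 'n) chart \<Rightarrow> real ^ 'n \<Rightarrow> real ^ 'n ^ 'n) \<Rightarrow> bool"
  where "riemannian_metric A g \<longleftrightarrow>
           (\<forall>c\<in>A. smooth_on (snd c ` fst c) (g c) \<and>
              (\<forall>y \<in> snd c ` fst c.
                 transpose (g c y) = g c y \<and> (\<forall>v. v \<noteq> 0 \<longrightarrow> v \<bullet> (g c y *v v) > 0))) \<and>
           (\<forall>c\<in>A. \<forall>d\<in>A. \<forall>x \<in> fst c \<inter> fst d.
              let J = matrix (frechet_derivative (snd d \<circ> chart_inv c) (at (snd c x)))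
              in g c (snd c x) = transpose J ** g d (snd d x) ** J)"

definition compact_riemannian_manifold ::
    "('a::{t2_space, second_countable_topology}, 'n::finite) chart set \<Rightarrow>
     (('a, 'n) chart \<Rightarrow> real ^ 'n \<Rightarrow> real ^ 'n ^ 'n) \<Rightarrow> bool"
  where "compact_riemannian_manifold A g \<longleftrightarrow>
           compact (UNIV :: 'a set) \<and> smooth_atlas A \<and> riemannian_metric A g"

text \<open>
  The Riemannian volume has density \<open>sqrt (det g)\<close> in every chart. It is assembled from a
  finite cover by charts, each contributing the part of its domain not covered by its
  predecessors; by the change of variables formula the result does not depend on the chosen cover.
\<close>

definition riemannian_volume ::
    "('a::topological_space, 'n::finite) chart set \<Rightarrow>
     (('a, 'n) chart \<Rightarrow> real ^ 'n \<Rightarrow> real ^ 'n ^ 'n) \<Rightarrow> 'a measure"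
  where "riemannian_volume A g =
           (let cs = (SOME cs. set cs \<subseteq> A \<and> (\<Union>c\<in>set cs. fst c) = UNIV)
            in measure_of UNIV (sets borel)
                 (\<lambda>B. \<Sum>i<length cs.
                    \<integral>\<^sup>+ y \<in> snd (cs ! i) ` (B \<inter> fst (cs ! i) - (\<Union>j<i. fst (cs ! j))).
                      ennreal (sqrt (det (g (cs ! i) y))) \<partial>lborel))"

definition lebesgue_on_product ::
    "('a::topological_space, 'n::finite) chart set \<Rightarrow>
     (('a, 'n) chart \<Rightarrow> real ^ 'n \<Rightarrow> real ^ 'n ^ 'n) \<Rightarrow> (circle \<times> 'a) measure"
  where "lebesgue_on_product A g = circle_lebesgue \<Otimes>\<^sub>M riemannian_volume A g"


section \<open>The \<open>C\<^sup>1\<close> distance\<close>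

text \<open>\<open>chart_deriv c u x v\<close> is the differential of \<open>u\<close> at \<open>x\<close>, applied to the tangent vector
  with coordinates \<open>v\<close> in the chart \<open>c\<close>.\<close>

definition chart_deriv ::
    "('a, 'n::finite) chart \<Rightarrow> ('a \<Rightarrow> 'b::real_normed_vector) \<Rightarrow> 'a \<Rightarrow> real ^ 'n \<Rightarrow> 'b"
  where "chart_deriv c u x = frechet_derivative (u \<circ> chart_inv c) (at (snd c x))"

text \<open>An injective immersion of a compact manifold is an embedding.\<close>

definition smooth_embedding ::
    "('a::topological_space, 'n::finite) chart set \<Rightarrow> ('a \<Rightarrow> 'b::euclidean_space) \<Rightarrow> bool"
  where "smooth_embedding A e \<longleftrightarrow>
           inj e \<and>
           (\<forall>c\<in>A. smooth_on (snd c ` fst c) (e \<circ> chart_inv c)) \<and>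
           (\<forall>c\<in>A. \<forall>x\<in>fst c. inj (chart_deriv c e x))"

text \<open>
  To compare differentials of \<open>f\<close> and \<open>k\<close> whose values lie in different tangent spaces, the
  manifold is regarded as a submanifold of a Euclidean space by means of an embedding \<open>e\<close>.
  The second supremum ranges over the unit tangent vectors; its terms do not depend on the
  chart \<open>c\<close> in which a tangent vector is represented.
\<close>

definition C1_dist ::
    "('a::topological_space, 'n::finite) chart set \<Rightarrow>
     (('a, 'n) chart \<Rightarrow> real ^ 'n \<Rightarrow> real ^ 'n ^ 'n) \<Rightarrow> ('a \<Rightarrow> 'b::euclidean_space) \<Rightarrow>
     ('a \<Rightarrow> 'a) \<Rightarrow> ('a \<Rightarrow> 'a) \<Rightarrow> ennreal"
  where "C1_dist A g e f k =
           (SUP x. ennreal (norm (e (f x) - e (k x)))) +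
           (SUP (c, x, v) \<in> {(c, x, v). c \<in> A \<and> x \<in> fst c \<and> v \<bullet> (g c (snd c x) *v v) = 1}.
              ennreal (norm (chart_deriv c (e \<circ> f) x v - chart_deriv c (e \<circ> k) x v)))"


section \<open>Skew products\<close>

definition C1_map_on ::
    "('a::topological_space, 'n::finite) chart set \<Rightarrow> 'a set \<Rightarrow> ('a \<Rightarrow> 'a) \<Rightarrow> bool"
  where "C1_map_on A S f \<longleftrightarrow>
           continuous_on S f \<and>
           (\<forall>c\<in>A. \<forall>d\<in>A.
              C_on 1 (snd c ` (fst c \<inter> S \<inter> f -` fst d)) (snd d \<circ> f \<circ> chart_inv c))"

text \<open>The image is automatically open, by invariance of domain; this is stated explicitly because
  \<open>C1_map_on\<close> is meaningful for open sets only.\<close>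

definition C1_diffeo_onto_image ::
    "('a::topological_space, 'n::finite) chart set \<Rightarrow> ('a \<Rightarrow> 'a) \<Rightarrow> bool"
  where "C1_diffeo_onto_image A f \<longleftrightarrow>
           inj f \<and> C1_map_on A UNIV f \<and> open (range f) \<and> C1_map_on A (range f) (inv f)"

text \<open>Continuity of \<open>\<phi> \<mapsto> f \<phi>\<close> in the \<open>C\<^sup>0\<close> topology amounts to joint continuity, since the
  fiber is compact.\<close>

definition skew_products ::
    "('a::topological_space, 'n::finite) chart set \<Rightarrow> nat \<Rightarrow> (circle \<times> 'a \<Rightarrow> circle \<times> 'a) set"
  where "skew_products A m =
           {F. \<exists>f :: circle \<Rightarrow> 'a \<Rightarrow> 'a.
                 F = (\<lambda>(\<phi>, x). (expanding_map m \<phi>, f \<phi> x)) \<and>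
                 (\<forall>\<phi>. C1_diffeo_onto_image A (f \<phi>)) \<and>
                 continuous_on UNIV (\<lambda>(\<phi>, x). f \<phi> x)}"

definition fiber_map :: "(circle \<times> 'a \<Rightarrow> circle \<times> 'a) \<Rightarrow> circle \<Rightarrow> 'a \<Rightarrow> 'a"
  where "fiber_map F \<phi> x = snd (F (\<phi>, x))"

text \<open>The fiber maps of a skew product are bijective: an injective, continuous and open
  self-map of a closed manifold is surjective. So \<open>inv\<close> is their two-sided inverse.\<close>

definition skew_dist ::
    "('a::topological_space, 'n::finite) chart set \<Rightarrow>
     (('a, 'n) chart \<Rightarrow> real ^ 'n \<Rightarrow> real ^ 'n ^ 'n) \<Rightarrow> ('a \<Rightarrow> 'b::euclidean_space) \<Rightarrow>
     (circle \<times> 'a \<Rightarrow> circle \<times> 'a) \<Rightarrow> (circle \<times> 'a \<Rightarrow> circle \<times> 'a) \<Rightarrow> ennreal"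
  where "skew_dist A g e F G =
           (SUP \<phi>. max (C1_dist A g e (fiber_map F \<phi>) (fiber_map G \<phi>))
                      (C1_dist A g e (inv (fiber_map F \<phi>)) (inv (fiber_map G \<phi>))))"

definition open_in_skew_products ::
    "('a::topological_space, 'n::finite) chart set \<Rightarrow>
     (('a, 'n) chart \<Rightarrow> real ^ 'n \<Rightarrow> real ^ 'n ^ 'n) \<Rightarrow> ('a \<Rightarrow> 'b::euclidean_space) \<Rightarrow> nat \<Rightarrow>
     (circle \<times> 'a \<Rightarrow> circle \<times> 'a) set \<Rightarrow> bool"
  where "open_in_skew_products A g e m U \<longleftrightarrow>
           U \<subseteq> skew_products A m \<and>
           (\<forall>F\<in>U. \<exists>\<epsilon>::real. \<epsilon> > 0 \<and>
              (\<forall>G\<in>skew_products A m. skew_dist A g e F G < ennreal \<epsilon> \<longrightarrow> G \<in> U))"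


section \<open>Massive attractors\<close>

definition region :: "'x::topological_space set \<Rightarrow> bool"
  where "region R \<longleftrightarrow> (\<exists>U. open U \<and> connected U \<and> U \<noteq> {} \<and> R = closure U)"

definition trapping :: "('x::topological_space \<Rightarrow> 'x) \<Rightarrow> 'x set \<Rightarrow> bool"
  where "trapping F D \<longleftrightarrow> compact D \<and> F ` D \<subseteq> interior D"

definition maximal_attractor :: "('x \<Rightarrow> 'x) \<Rightarrow> 'x set \<Rightarrow> 'x set"
  where "maximal_attractor F D = (\<Inter>n. (F ^^ n) ` D)"

definition invariant_measure :: "('x::topological_space \<Rightarrow> 'x) \<Rightarrow> 'x measure \<Rightarrow> bool"
  where "invariant_measure F \<mu> \<longleftrightarrow>
           sets \<mu> = sets borel \<and> prob_space \<mu> \<and>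
           F \<in> borel_measurable borel \<and> distr \<mu> borel F = \<mu>"

definition ergodic_measure :: "('x::topological_space \<Rightarrow> 'x) \<Rightarrow> 'x measure \<Rightarrow> bool"
  where "ergodic_measure F \<mu> \<longleftrightarrow>
           invariant_measure F \<mu> \<and>
           (\<forall>B\<in>sets \<mu>. F -` B = B \<longrightarrow> emeasure \<mu> B = 0 \<or> emeasure \<mu> B = 1)"

definition basin :: "('x::topological_space \<Rightarrow> 'x) \<Rightarrow> 'x measure \<Rightarrow> 'x set"
  where "basin F \<mu> =
           {x. \<forall>\<psi> :: 'x \<Rightarrow> real. continuous_on UNIV \<psi> \<longrightarrow>
                 (\<lambda>n. (1 / real n) * (\<Sum>i<n. \<psi> ((F ^^ i) x))) \<longlonglongrightarrow> (\<integral>y. \<psi> y \<partial>\<mu>)}"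

definition SRB_measure ::
    "'x measure \<Rightarrow> ('x::topological_space \<Rightarrow> 'x) \<Rightarrow> 'x measure \<Rightarrow> bool"
  where "SRB_measure Leb F \<mu> \<longleftrightarrow>
           invariant_measure F \<mu> \<and>
           (\<exists>E\<in>sets Leb. emeasure Leb E > 0 \<and> E \<subseteq> basin F \<mu>)"

definition measure_support :: "'x::topological_space measure \<Rightarrow> 'x set"
  where "measure_support \<mu> = {x. \<forall>U. open U \<and> x \<in> U \<longrightarrow> emeasure \<mu> U > 0}"

text \<open>
  The inclusion of \<open>D\<close> in the basin is understood up to a Lebesgue null set. It cannot
  hold pointwise for a skew product over an expanding circle map: the orbits starting in the
  fiber over the fixed point \<open>0\<close> stay in that fiber, which does not carry a measure whose
  support has non-empty interior.
\<close>

definition massive_attractor ::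
    "'x measure \<Rightarrow> ('x::topological_space \<Rightarrow> 'x) \<Rightarrow> 'x set \<Rightarrow> bool"
  where "massive_attractor Leb F \<Lambda> \<longleftrightarrow>
           \<Lambda> \<noteq> UNIV \<and>
           (\<exists>D. region D \<and> trapping F D \<and> \<Lambda> = maximal_attractor F D \<and>
              region \<Lambda> \<and>
              (\<exists>\<mu>. ergodic_measure F \<mu> \<and> SRB_measure Leb F \<mu> \<and> measure_support \<mu> = \<Lambda> \<and>
                 (AE x in Leb. x \<in> D \<longrightarrow> x \<in> basin F \<mu>)))"

end

theory Submission
  imports Defs
begin

text \<open>
  Fix a ball in a coordinate chart of \<open>M\<close> and consider a skew product \<open>F\<close> whose
  fibre maps all send this ball into its interior and contract it. Then the tube \<open>D\<close> of all these balls over the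
  circle is trapping. Since nearby points of a fibre are forgotten at an exponential rate, the
  dynamics in \<open>D\<close> is governed by the base: almost every orbit of the expanding map is
  equidistributed (\<open>AE_char_equidistributed\<close>), and over such a base point the time averages along
  every orbit in \<open>D\<close> converge to the integral with respect to one measure \<open>\<mu>\<close> (\<open>par_in_basin\<close>). The
  measure \<open>\<mu>\<close> is the law of the point obtained by following a random backward orbit of the base
  infinitely far into the past and pushing the fibre ball forward along it (\<open>srb\<close>). It is invariant,
  ergodic because almost all points are generic (\<open>ergodic_srb\<close>), and its support is the maximal
  attractor (\<open>support_srb\<close>).

  What remains is to make the attractor a region. Suppose that a thinner tube \<open>V\<close> is covered by its
  own image under an iterate \<open>F\<^sup>N\<close>. Then the images \<open>F\<^sup>k\<^sup>N V\<close> increase, lie in the attractor, are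
  connected, and are open by invariance of domain (\<open>open_funpow_image\<close>). They come close to every
  point of the attractor, again because the fibre balls are contracted; so the attractor is the
  closure of their union (\<open>attractor_eq_closure\<close>).

  A contraction by the factor \<open>1 - \<epsilon>\<close> can have this covering property because the base map has
  several inverse branches. Let the fibre map over \<open>\<phi>\<close> contract towards a point \<open>\<tau> \<phi>\<close>. Looking backwards
  in time, a point of the small ball of radius \<open>\<rho>\<close> moves outwards by about \<open>\<epsilon> \<rho>\<close> in each step, but
  one visit to a base point where \<open>\<tau>\<close> is roughly aligned with the point moves it inwards by an
  amount proportional to \<open>\<epsilon>\<close>, which is more if \<open>\<rho>\<close> is small (\<open>backward_orbit_returns\<close>). A backward
  orbit of the base that visits such a place after \<open>N\<close> steps and sees \<open>\<tau> = 0\<close> before can be found for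
  every direction (\<open>steering_function\<close>); this is where three branches are needed: the first digit 2 in base \<open>m\<close>
  marks the places where \<open>\<tau>\<close> may be nonzero, and the digits 0 and 1 encode the direction.

  All these conditions are stable. In the coordinates of \<open>adapted_chart\<close>, which are affine functions
  of the embedding, the distance between skew products controls the fibre maps, their derivatives
  and their inverses (\<open>C1_dist_controls_coord\<close>), so every skew product in a small ball around the
  model has a massive attractor (\<open>robust_massive_attractor\<close>).
\<close>

section \<open>The circle\<close>

lemma abs_circle_eq_iff: "abs_circle s = abs_circle t \<longleftrightarrow> s - t \<in> \<int>"
  by (rule circle.abs_eq_iff)

lemma circle_cases: obtains t where "0 \<le> t" "t < 1" "\<phi> = abs_circle t"
proof -
  have "\<phi> = abs_circle (rep_circle \<phi>)"
    using Quotient_abs_rep[OF Quotient_circle] by metis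
  also have "\<dots> = abs_circle (frac (rep_circle \<phi>))"
    by (simp add: abs_circle_eq_iff frac_def)
  finally show thesis using that[of "frac (rep_circle \<phi>)"] by (simp add: frac_lt_1)
qed

lemma continuous_abs_circle: "continuous_on S abs_circle"
  by (rule continuous_on_subset[of UNIV])
    (auto simp: continuous_on_open_vimage open_circle_def)

text \<open>
  The circle carries the quotient topology, so continuity can be tested on the line.
\<close>
lemma continuous_on_circleI:
  assumes "continuous_on UNIV (\<lambda>t. f (abs_circle t))"
  shows "continuous_on UNIV (f :: circle \<Rightarrow> 'x::topological_space)"
  using assms by (auto simp: continuous_on_open_vimage open_circle_def vimage_def)

lemma open_map_abs_circle:
  assumes "open U"
  shows "open (abs_circle ` U)"
proof -
  have "abs_circle -` abs_circle ` U = (\<Union>k::int. (\<lambda>t. of_int k + t) ` U)"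
  proof (intro set_eqI iffI)
    fix t assume "t \<in> abs_circle -` abs_circle ` U"
    then obtain s where s: "s \<in> U" "t - s \<in> \<int>" by (auto simp: abs_circle_eq_iff)
    then obtain k where "t - s = of_int k" by (auto elim: Ints_cases)
    then have "t = of_int k + s" by simp
    with s(1) show "t \<in> (\<Union>k::int. (\<lambda>t. of_int k + t) ` U)" by blast
  next
    fix t assume "t \<in> (\<Union>k::int. (\<lambda>t. of_int k + t) ` U)"
    then obtain k s where "s \<in> U" "t = of_int k + s" by blast
    then show "t \<in> abs_circle -` abs_circle ` U" by (auto simp: abs_circle_eq_iff image_iff intro!: bexI[of _ s])
  qed
  then show ?thesis using assms by (auto simp: open_circle_def intro!: open_translation)
qed

lift_definition circle_char :: "int \<Rightarrow> circle \<Rightarrow> complex"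
  is "\<lambda>k t. cis (2 * pi * of_int k * t)"
proof -
  fix k and s t :: real assume "s - t \<in> \<int>"
  then obtain j where "s = of_int j + t" by (metis Ints_cases diff_add_cancel)
  then have "2 * pi * of_int k * s = 2 * pi * of_int (k * j) + 2 * pi * of_int k * t"
    by (simp add: algebra_simps)
  then show "cis (2 * pi * of_int k * s) = cis (2 * pi * of_int k * t)"
    by (metis cis_mult cis_multiple_2pi Ints_of_int mult_1)
qed

lemma continuous_circle_char: "continuous_on S (circle_char k)"
  by (rule continuous_on_subset[OF continuous_on_circleI])
    (auto simp: circle_char.abs_eq intro!: continuous_intros)

lemma circle_char_0 [simp]: "circle_char 0 \<phi> = 1"
  by transfer simp

lemma norm_circle_char [simp]: "norm (circle_char k \<phi>) = 1"
  by transfer simp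

lemma circle_char_mult: "circle_char j \<phi> * circle_char k \<phi> = circle_char (j + k) \<phi>"
  by transfer (simp add: cis_mult algebra_simps)

lemma cnj_circle_char: "cnj (circle_char k \<phi>) = circle_char (- k) \<phi>"
  by transfer (simp add: cis_cnj)

lemma inj_circle_char_1: "inj (circle_char 1)"
proof (rule injI)
  fix \<phi> \<psi> :: circle
  obtain s where s: "\<phi> = abs_circle s" by (rule circle_cases)
  obtain t where t: "\<psi> = abs_circle t" by (rule circle_cases)
  assume "circle_char 1 \<phi> = circle_char 1 \<psi>"
  then have "cis (2 * pi * s) = cis (2 * pi * t)" by (simp add: s t circle_char.abs_eq)
  then have "cis (2 * pi * (s - t)) = 1"
    by (metis cis_divide cis_neq_zero divide_self_if right_diff_distrib)
  then have "cos (2 * pi * (s - t)) = 1" by (metis cis.simps(1) one_complex.simps(1))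
  then obtain k where "2 * pi * (s - t) = of_int k * 2 * pi" 
    using cos_one_2pi_int by auto
  then have "s - t = of_int k" by simp
  then show "\<phi> = \<psi>" by (simp add: s t abs_circle_eq_iff)
qed

text \<open>
  The first character embeds the circle into the complex plane, which separates its points.
\<close>
instance circle :: t2_space
proof
  fix \<phi> \<psi> :: circle assume "\<phi> \<noteq> \<psi>"
  then have "circle_char 1 \<phi> \<noteq> circle_char 1 \<psi>" using inj_circle_char_1 by (metis injD)
  then obtain U V where UV: "open U" "open V" "circle_char 1 \<phi> \<in> U" "circle_char 1 \<psi> \<in> V" "U \<inter> V = {}"
    by (metis hausdorff)
  have "open (circle_char 1 -` U)" "open (circle_char 1 -` V)"
    using continuous_circle_char[of UNIV 1] UV by (auto simp: continuous_on_open_vimage)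
  then show "\<exists>U V. open U \<and> open V \<and> \<phi> \<in> U \<and> \<psi> \<in> V \<and> U \<inter> V = {}"
    using UV by (intro exI[of _ "circle_char 1 -` U"] exI[of _ "circle_char 1 -` V"]) auto
qed

lemma UNIV_circle_eq: "(UNIV :: circle set) = abs_circle ` {0..1}"
proof -
  have "\<phi> \<in> abs_circle ` {0..1}" for \<phi>
    by (rule circle_cases[of \<phi>]) auto
  then show ?thesis by blast
qed

lemma compact_UNIV_circle: "compact (UNIV :: circle set)"
  unfolding UNIV_circle_eq by (intro compact_continuous_image continuous_abs_circle) simp

lemma connected_UNIV_circle: "connected (UNIV :: circle set)"
  unfolding UNIV_circle_eq by (intro connected_continuous_image continuous_abs_circle) simp

lemma expanding_map_abs_circle [simp]: "expanding_map m (abs_circle t) = abs_circle (of_nat m * t)"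
  by (rule expanding_map.abs_eq)

lemma continuous_expanding_map: "continuous_on S (expanding_map m)"
proof (rule continuous_on_subset[OF continuous_on_circleI])
  have "continuous_on UNIV (abs_circle \<circ> (\<lambda>t. of_nat m * t))"
    by (intro continuous_on_compose continuous_abs_circle continuous_intros)
  then show "continuous_on UNIV (\<lambda>t. expanding_map m (abs_circle t))" by (simp add: o_def)
qed auto

lemma continuous_on_abs_circle [continuous_intros]:
  "continuous_on S f \<Longrightarrow> continuous_on S (\<lambda>x. abs_circle (f x))"
  by (rule continuous_on_compose2[OF continuous_abs_circle[of UNIV]]) auto

lemma continuous_on_expanding_map [continuous_intros]:
  "continuous_on S f \<Longrightarrow> continuous_on S (\<lambda>x. expanding_map m (f x))"
  by (rule continuous_on_compose2[OF continuous_expanding_map[of UNIV]]) auto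

lemma continuous_on_circle_char [continuous_intros]:
  "continuous_on S f \<Longrightarrow> continuous_on S (\<lambda>x. circle_char k (f x))"
  by (rule continuous_on_compose2[OF continuous_circle_char[of UNIV]]) auto

lemma funpow_expanding_map_abs_circle:
  "(expanding_map m ^^ k) (abs_circle t) = abs_circle (of_nat m ^ k * t)"
  by (induction k) (simp_all add: mult.assoc)

lemma circle_char_expanding_map:
  "circle_char k (expanding_map m \<phi>) = circle_char (k * int m) \<phi>"
  by transfer (simp add: algebra_simps)

lemma circle_char_funpow_expanding_map:
  "circle_char k ((expanding_map m ^^ i) \<phi>) = circle_char (k * int m ^ i) \<phi>"
  by (induction i arbitrary: k) (simp_all add: circle_char_expanding_map mult_ac)

lemma measurable_abs_circle [measurable]: "abs_circle \<in> borel_measurable borel"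
  by (rule borel_measurable_continuous_onI[OF continuous_abs_circle])

lemma sets_circle_lebesgue [measurable_cong, simp]: "sets circle_lebesgue = sets borel"
  by (simp add: circle_lebesgue_def)

lemma space_circle_lebesgue [simp]: "space circle_lebesgue = UNIV"
  by (simp add: circle_lebesgue_def)

lemma measurable_abs_circle_restrict: "abs_circle \<in> measurable (restrict_space lborel {0..<1}) borel"
  by (intro measurable_restrict_space1) simp

lemma prob_space_unit_interval: "prob_space (restrict_space lborel {0..<1::real})"
  by (rule prob_spaceI) (simp add: emeasure_restrict_space space_restrict_space)

lemma prob_space_circle_lebesgue: "prob_space circle_lebesgue"
  unfolding circle_lebesgue_def
  by (rule prob_space.prob_space_distr[OF prob_space_unit_interval measurable_abs_circle_restrict])

lemma integral_circle_lebesgue: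
  fixes f :: "circle \<Rightarrow> 'b::{banach, second_countable_topology}"
  assumes "f \<in> borel_measurable borel"
  shows "(\<integral>\<phi>. f \<phi> \<partial>circle_lebesgue) = (\<integral>t. f (abs_circle t) \<partial>restrict_space lborel {0..<1})"
  using assms measurable_abs_circle_restrict
  by (simp add: circle_lebesgue_def integral_distr)

lemma measurable_circle_char [measurable]: "circle_char k \<in> borel_measurable borel"
  by (rule borel_measurable_continuous_onI[OF continuous_circle_char])

lemma integral_circle_char:
  assumes "k \<noteq> 0"
  shows "(\<integral>\<phi>. circle_char k \<phi> \<partial>circle_lebesgue) = 0"
proof -
  define c where "c = 2 * pi * of_int k"
  have c: "c \<noteq> 0" using assms by (simp add: c_def)
  have "((\<lambda>t. cis (c * t)) has_integral (cis (c * 1) / (\<i> * of_real c) - cis (c * 0) / (\<i> * of_real c))) {0..1}"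
  proof (rule fundamental_theorem_of_calculus)
    fix t assume "t \<in> {0..1::real}"
    have "((\<lambda>t. exp (t *\<^sub>R (\<i> * of_real c)) / (\<i> * of_real c)) has_vector_derivative
        exp (t *\<^sub>R (\<i> * of_real c)) * (\<i> * of_real c) / (\<i> * of_real c)) (at t within {0..1})"
      by (intro has_vector_derivative_divide exp_scaleR_has_vector_derivative_right)
    then show "((\<lambda>t. cis (c * t) / (\<i> * of_real c)) has_vector_derivative cis (c * t)) (at t within {0..1})"
      using c by (simp add: cis_conv_exp scaleR_conv_of_real mult_ac)
  qed simp
  moreover have "cis c = 1"
    unfolding c_def using cis_multiple_2pi[of "of_int k"] by simp
  ultimately have hk: "((\<lambda>t. cis (c * t)) has_integral 0) {0..1}" by simp
  have [measurable]: "(\<lambda>t. cis (c * t)) \<in> borel_measurable borel"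
    by (intro borel_measurable_continuous_onI continuous_intros)
  have int: "set_integrable lborel {0..1} (\<lambda>t. cis (c * t))"
    unfolding set_integrable_def
    by (rule borel_integrable_compact) (auto intro!: continuous_intros)
  have "(LINT t:{0..1}|lborel. cis (c * t)) = 0"
    using set_borel_integral_eq_integral(2)[OF int] hk by (simp add: integral_unique)
  moreover have "(LINT t:{0..<1}|lborel. cis (c * t)) = (LINT t:{0..1}|lborel. cis (c * t))"
  proof (rule set_integral_cong_set)
    show "AE x in lborel. (x \<in> {0..1}) = (x \<in> {0..<1::real})"
      using AE_lborel_singleton[of "1::real"] by eventually_elim auto
  qed (auto simp: set_borel_measurable_def)
  ultimately show ?thesis
    by (simp add: integral_circle_lebesgue circle_char.abs_eq c_def[symmetric]
        integral_restrict_space set_lebesgue_integral_def)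
qed

lemma emeasure_circle_lebesgue_pos:
  assumes "open J" "J \<noteq> {}"
  shows "emeasure circle_lebesgue J > 0"
proof -
  obtain \<phi> where "\<phi> \<in> J" using assms by blast
  then obtain t where t: "0 \<le> t" "t < 1" "abs_circle t \<in> J" by (metis circle_cases)
  have "open (abs_circle -` J)" using assms(1) by (simp add: open_circle_def)
  then obtain \<eta> where \<eta>: "\<eta> > 0" "ball t \<eta> \<subseteq> abs_circle -` J" using t(3) unfolding open_contains_ball by blast
  define r where "r = min 1 (t + \<eta>)"
  have r: "t < r" using \<eta>(1) t(2) by (simp add: r_def)
  have "{t..<r} \<subseteq> abs_circle -` J \<inter> {0..<1}"
  proof
    fix s assume "s \<in> {t..<r}"
    then have "dist t s < \<eta>" "0 \<le> s" "s < 1" using t by (auto simp: r_def dist_real_def)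
    then show "s \<in> abs_circle -` J \<inter> {0..<1}" using \<eta>(2) by (auto simp: subset_iff)
  qed
  then have "emeasure lborel {t..<r} \<le> emeasure lborel (abs_circle -` J \<inter> {0..<1})"
    using \<open>open (abs_circle -` J)\<close> by (intro emeasure_mono) auto
  moreover have "emeasure circle_lebesgue J = emeasure lborel (abs_circle -` J \<inter> {0..<1})"
    using assms(1) measurable_abs_circle_restrict
    by (simp add: circle_lebesgue_def emeasure_distr emeasure_restrict_space space_restrict_space)
  moreover have "emeasure lborel {t..<r} > 0" using r by simp
  ultimately show ?thesis by (metis order_less_le_trans)
qed

section \<open>Equidistribution of almost every orbit of the expanding map\<close>

text \<open>
  Time averages see neither finitely many initial terms nor errors that are small uniformly in
  time. This is how averages along orbits of a contracting skew product are reduced to averages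
  along orbits of the base map.
\<close>
lemma average_tendsto_approx:
  fixes a :: "nat \<Rightarrow> real"
  assumes approx: "\<And>\<epsilon>. \<epsilon> > 0 \<Longrightarrow> \<exists>k b J. (\<forall>i. \<bar>a (i + k) - b i\<bar> \<le> \<epsilon>) \<and>
      (\<lambda>n. (1 / real n) * (\<Sum>i<n. b i)) \<longlonglongrightarrow> J \<and> \<bar>J - I\<bar> \<le> \<epsilon>"
  shows "(\<lambda>n. (1 / real n) * (\<Sum>i<n. a i)) \<longlonglongrightarrow> I"
proof (rule LIMSEQ_I)
  fix r :: real assume "r > 0"
  then obtain k b J where ab: "\<And>i. \<bar>a (i + k) - b i\<bar> \<le> r / 4"
    and b: "(\<lambda>n. (1 / real n) * (\<Sum>i<n. b i)) \<longlonglongrightarrow> J" and J: "\<bar>J - I\<bar> \<le> r / 4"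
    using approx[of "r / 4"] by auto
  define c where "c j = (\<Sum>i<k. a i) / real (j + k) + (real j / real (j + k)) * ((1 / real j) * (\<Sum>i<j. b i))" for j
  have "(\<lambda>j. (\<Sum>i<k. a i) / real (j + k)) \<longlonglongrightarrow> 0"
    by (rule LIMSEQ_ignore_initial_segment[of "\<lambda>j. (\<Sum>i<k. a i) / real j" 0 k]) (rule lim_const_over_n)
  moreover have "(\<lambda>j. real j / real (j + k)) \<longlonglongrightarrow> 1"
    by real_asymp
  ultimately have "c \<longlonglongrightarrow> 0 + 1 * J"
    unfolding c_def by (intro tendsto_add tendsto_mult b)
  then obtain j0 where j0: "\<And>j. j \<ge> j0 \<Longrightarrow> \<bar>c j - J\<bar> < r / 4"
    using LIMSEQ_D[of c J "r / 4"] \<open>r > 0\<close> by (auto simp: real_norm_def)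
  have "norm ((1 / real n) * (\<Sum>i<n. a i) - I) < r" if n: "n \<ge> Suc (j0 + k)" for n
  proof -
    define j where "j = n - k"
    have jn: "n = j + k" "j \<ge> j0" "j > 0" using n by (auto simp: j_def)
    have "(\<Sum>i<n. a i) = (\<Sum>i<k. a i) + (\<Sum>i<j. a (i + k))"
      unfolding jn(1) by (induction j) (simp_all add: add_ac)
    moreover have "c j = ((\<Sum>i<k. a i) + (\<Sum>i<j. b i)) / real n"
      using jn by (simp add: c_def add_divide_distrib)
    ultimately have "(1 / real n) * (\<Sum>i<n. a i) - c j = (\<Sum>i<j. a (i + k) - b i) / real n"
      by (simp add: sum_subtractf diff_divide_distrib add_divide_distrib)
    moreover have "\<bar>\<Sum>i<j. a (i + k) - b i\<bar> \<le> (\<Sum>i<j. r / 4)"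
      by (rule order_trans[OF sum_abs]) (intro sum_mono ab)
    ultimately have "\<bar>(1 / real n) * (\<Sum>i<n. a i) - c j\<bar> \<le> (real j * (r / 4)) / real n"
      using divide_right_mono[of "\<bar>\<Sum>i<j. a (i + k) - b i\<bar>" "real j * (r / 4)" "real n"] by (simp del: times_divide_eq_right)
    also have "\<dots> \<le> r / 4" using jn \<open>r > 0\<close> by (simp add: field_simps)
    finally show ?thesis using j0[OF jn(2)] J \<open>r > 0\<close> unfolding real_norm_def by linarith
  qed
  then show "\<exists>no. \<forall>n\<ge>no. norm ((1 / real n) * (\<Sum>i<n. a i) - I) < r" by blast
qed

text \<open>
  The hypothesis of Weyl's criterion. It involves only countably many test functions, so it can
  be checked almost everywhere one character at a time.
\<close>
definition char_equidistributed :: "nat \<Rightarrow> circle \<Rightarrow> bool" where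
  "char_equidistributed m \<phi> \<longleftrightarrow> (\<forall>k. k \<noteq> 0 \<longrightarrow>
     (\<lambda>n. (\<Sum>i<n. circle_char k ((expanding_map m ^^ i) \<phi>)) / of_nat n) \<longlonglongrightarrow> 0)"

text \<open>
  Trigonometric polynomials are built inductively so that closure under products and the
  convergence of averages can be proved by rule induction.
\<close>
inductive trig_poly :: "(circle \<Rightarrow> complex) \<Rightarrow> bool" where
  char: "trig_poly (\<lambda>\<phi>. c * circle_char k \<phi>)"
| add: "trig_poly s \<Longrightarrow> trig_poly t \<Longrightarrow> trig_poly (\<lambda>\<phi>. s \<phi> + t \<phi>)"

lemma continuous_trig_poly: "trig_poly t \<Longrightarrow> continuous_on S t"
  by (induction rule: trig_poly.induct) (auto intro!: continuous_intros continuous_circle_char)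

lemma trig_poly_cmult: "trig_poly t \<Longrightarrow> trig_poly (\<lambda>\<phi>. c * t \<phi>)"
proof (induction rule: trig_poly.induct)
  case (char d k)
  then show ?case using trig_poly.char[of "c * d" k] by (simp add: mult.assoc)
next
  case (add s t)
  then show ?case using trig_poly.add by (simp add: distrib_left)
qed

lemma trig_poly_cnj: "trig_poly t \<Longrightarrow> trig_poly (\<lambda>\<phi>. cnj (t \<phi>))"
proof (induction rule: trig_poly.induct)
  case (char d k)
  then show ?case using trig_poly.char[of "cnj d" "- k"] by (simp add: cnj_circle_char)
next
  case (add s t)
  then show ?case using trig_poly.add by simp
qed

lemma trig_poly_mult: "trig_poly s \<Longrightarrow> trig_poly t \<Longrightarrow> trig_poly (\<lambda>\<phi>. s \<phi> * t \<phi>)"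
proof (induction arbitrary: t rule: trig_poly.induct)
  case (char d k)
  from char show ?case
  proof (induction rule: trig_poly.induct)
    case (char c j)
    have "trig_poly (\<lambda>\<phi>. (d * c) * circle_char (k + j) \<phi>)" by (rule trig_poly.char)
    then show ?case by (simp add: circle_char_mult[symmetric] mult_ac)
  next
    case (add u v)
    then show ?case using trig_poly.add by (simp add: distrib_left)
  qed
next
  case (add u v)
  then show ?case using trig_poly.add by (simp add: distrib_right)
qed

lemma trig_poly_average:
  assumes "trig_poly t" "char_equidistributed m \<phi>"
  shows "(\<lambda>n. (\<Sum>i<n. t ((expanding_map m ^^ i) \<phi>)) / of_nat n) \<longlonglongrightarrow> (\<integral>\<theta>. t \<theta> \<partial>circle_lebesgue)
    \<and> integrable circle_lebesgue t"
  using assms(1)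
proof (induction rule: trig_poly.induct)
  case (char c k)
  interpret prob_space circle_lebesgue by (rule prob_space_circle_lebesgue)
  have int: "integrable circle_lebesgue (circle_char k)"
    by (rule integrable_const_bound[of _ 1]) auto
  have *: "(\<lambda>n. c * ((\<Sum>i<n. circle_char k ((expanding_map m ^^ i) \<phi>)) / of_nat n))
     \<longlonglongrightarrow> c * (\<integral>\<theta>. circle_char k \<theta> \<partial>circle_lebesgue)"
  proof (intro tendsto_mult tendsto_const)
    show "(\<lambda>n. (\<Sum>i<n. circle_char k ((expanding_map m ^^ i) \<phi>)) / of_nat n)
      \<longlonglongrightarrow> (\<integral>\<theta>. circle_char k \<theta> \<partial>circle_lebesgue)"
    proof (cases "k = 0")
      case True
      have "\<forall>\<^sub>F n in sequentially. (1 :: complex) = of_nat n / of_nat n"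
        using eventually_gt_at_top[of 0] by eventually_elim simp
      then have "(\<lambda>n. of_nat n / of_nat n :: complex) \<longlonglongrightarrow> 1"
        by (rule Lim_transform_eventually[OF tendsto_const])
      then show ?thesis using True prob_space by simp
    next
      case False
      then show ?thesis using assms(2) by (simp add: integral_circle_char char_equidistributed_def)
    qed
  qed
  then show ?case using int by (simp add: sum_distrib_left)
next
  case (add s t)
  then show ?case by (auto simp: sum.distrib add_divide_distrib intro!: tendsto_add)
qed

lemma integrable_continuous_compact:
  fixes f :: "'x::topological_space \<Rightarrow> real"
  assumes "compact (UNIV :: 'x set)" "continuous_on UNIV f" "finite_measure M" "sets M = sets borel"
  shows "integrable M f"
proof -
  have "compact (range f)" by (rule compact_continuous_image[OF assms(2,1)])
  then obtain B where B: "\<And>x. \<bar>f x\<bar> \<le> B"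
    by (metis compact_imp_bounded bounded_iff rangeI real_norm_def)
  have "f \<in> borel_measurable M"
    using borel_measurable_continuous_onI[OF assms(2)] assms(4) by (simp cong: measurable_cong_sets)
  then show ?thesis
    by (intro finite_measure.integrable_const_bound[OF assms(3), of _ B]) (use B in auto)
qed

text \<open>
  Weyl's criterion: the real parts of trigonometric polynomials form a point-separating algebra
  of continuous functions on the compact circle, hence they are uniformly dense by the
  Stone--Weierstrass theorem.
\<close>
lemma average_tendsto_of_char_equidistributed:
  fixes G :: "circle \<Rightarrow> real"
  assumes "char_equidistributed m \<phi>" and G: "continuous_on UNIV G"
  shows "(\<lambda>n. (1 / real n) * (\<Sum>i<n. G ((expanding_map m ^^ i) \<phi>))) \<longlonglongrightarrow> (\<integral>\<theta>. G \<theta> \<partial>circle_lebesgue)"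
proof (rule average_tendsto_approx)
  interpret prob_space circle_lebesgue by (rule prob_space_circle_lebesgue)
  fix \<epsilon> :: real assume \<epsilon>: "\<epsilon> > 0"
  have "\<exists>g. (\<exists>t. trig_poly t \<and> g = (\<lambda>\<theta>. Re (t \<theta>))) \<and> (\<forall>\<theta>\<in>UNIV. \<bar>G \<theta> - g \<theta>\<bar> < \<epsilon>)"
  proof (rule Stone_Weierstrass_HOL[OF compact_UNIV_circle _ _ _ _ _ G \<epsilon>], goal_cases)
    case (1 c)
    then show ?case using trig_poly.char[of "of_real c" 0] by (intro exI[of _ "\<lambda>\<theta>. of_real c * circle_char 0 \<theta>"]) simp
  next
    case (2 f)
    then show ?case by (auto intro!: continuous_intros continuous_trig_poly)
  next
    case (3 f g)
    then obtain s t where "trig_poly s" "trig_poly t" "f = (\<lambda>\<theta>. Re (s \<theta>))" "g = (\<lambda>\<theta>. Re (t \<theta>))" by blast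
    then show ?case by (intro exI[of _ "\<lambda>\<theta>. s \<theta> + t \<theta>"]) (auto intro: trig_poly.add)
  next
    case (4 f g)
    then obtain s t where st: "trig_poly s" "trig_poly t" "f = (\<lambda>\<theta>. Re (s \<theta>))" "g = (\<lambda>\<theta>. Re (t \<theta>))" by blast
    have "trig_poly (\<lambda>\<theta>. (1 / 2) * (s \<theta> * t \<theta> + s \<theta> * cnj (t \<theta>)))"
      using st by (intro trig_poly_cmult trig_poly.add trig_poly_mult trig_poly_cnj)
    then show ?case unfolding st
      by (intro exI[of _ "\<lambda>\<theta>. (1 / 2) * (s \<theta> * t \<theta> + s \<theta> * cnj (t \<theta>))"]) (auto simp: fun_eq_iff)
  next
    case (5 \<theta> \<eta>)
    then have "circle_char 1 \<theta> \<noteq> circle_char 1 \<eta>" using inj_circle_char_1 by (auto dest: injD)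
    then consider "Re (circle_char 1 \<theta>) \<noteq> Re (circle_char 1 \<eta>)" | "Im (circle_char 1 \<theta>) \<noteq> Im (circle_char 1 \<eta>)"
      by (auto simp: complex_eq_iff)
    then show ?case
    proof cases
      case 1
      then show ?thesis using trig_poly.char[of 1 1] by (intro exI[of _ "\<lambda>\<theta>. Re (1 * circle_char 1 \<theta>)"]) auto
    next
      case 2
      then show ?thesis using trig_poly.char[of "-\<i>" 1] by (intro exI[of _ "\<lambda>\<theta>. Re (-\<i> * circle_char 1 \<theta>)"]) auto
    qed
  qed
  then obtain t where t: "trig_poly t" and Gt: "\<And>\<theta>. \<bar>G \<theta> - Re (t \<theta>)\<bar> < \<epsilon>" by blast
  note av = trig_poly_average[OF t assms(1)]
  have int: "integrable circle_lebesgue G" "integrable circle_lebesgue (\<lambda>\<theta>. Re (t \<theta>))"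
    using av by (auto intro!: integrable_continuous_compact compact_UNIV_circle G finite_measure_axioms)
  have "(\<lambda>n. Re ((\<Sum>i<n. t ((expanding_map m ^^ i) \<phi>)) / of_nat n)) \<longlonglongrightarrow> Re (\<integral>\<theta>. t \<theta> \<partial>circle_lebesgue)"
    by (intro tendsto_Re conjunct1[OF av])
  then have "(\<lambda>n. (1 / real n) * (\<Sum>i<n. Re (t ((expanding_map m ^^ i) \<phi>)))) \<longlonglongrightarrow> (\<integral>\<theta>. Re (t \<theta>) \<partial>circle_lebesgue)"
    using av by (simp add: Re_sum)
  moreover have "\<bar>(\<integral>\<theta>. Re (t \<theta>) \<partial>circle_lebesgue) - (\<integral>\<theta>. G \<theta> \<partial>circle_lebesgue)\<bar> \<le> \<epsilon>"
  proof -
    have "\<bar>\<integral>\<theta>. Re (t \<theta>) - G \<theta> \<partial>circle_lebesgue\<bar> \<le> (\<integral>\<theta>. \<epsilon> \<partial>circle_lebesgue)"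
      by (rule order_trans[OF integral_abs_bound], rule integral_mono)
        (use int Gt in \<open>auto intro!: less_imp_le simp: abs_minus_commute\<close>)
    then show ?thesis using int prob_space by simp
  qed
  ultimately show "\<exists>k b J. (\<forall>i. \<bar>G ((expanding_map m ^^ (i + k)) \<phi>) - b i\<bar> \<le> \<epsilon>) \<and>
      (\<lambda>n. (1 / real n) * (\<Sum>i<n. b i)) \<longlonglongrightarrow> J \<and> \<bar>J - (\<integral>\<theta>. G \<theta> \<partial>circle_lebesgue)\<bar> \<le> \<epsilon>"
    using Gt by (intro exI[of _ 0] exI[of _ "\<lambda>i. Re (t ((expanding_map m ^^ i) \<phi>))"] exI) (auto intro: less_imp_le)
qed

text \<open>
  Between \<open>q\<^sup>2\<close> and \<open>(q + 1)\<^sup>2\<close> the sums change by at most \<open>2 q\<close>, which is negligible compared with \<open>q\<^sup>2\<close>.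
\<close>
lemma partial_sums_o_of_squares:
  fixes S :: "nat \<Rightarrow> 'b::real_normed_vector"
  assumes step: "\<And>n. norm (S (Suc n) - S n) \<le> 1"
    and sq: "(\<lambda>q. norm (S (q\<^sup>2)) / real (q\<^sup>2)) \<longlonglongrightarrow> 0"
  shows "(\<lambda>n. norm (S n) / real n) \<longlonglongrightarrow> 0"
proof (rule LIMSEQ_I)
  fix r :: real assume r: "r > 0"
  obtain Q1 where Q1: "\<And>q. q \<ge> Q1 \<Longrightarrow> norm (S (q\<^sup>2)) / real (q\<^sup>2) < r / 2"
    using LIMSEQ_D[OF sq, of "r / 2"] r by auto
  obtain Q2 :: nat where Q2: "real Q2 > 4 / r" using reals_Archimedean2 by blast
  have lip: "norm (S (n + j)) \<le> norm (S n) + real j" for n j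
  proof (induction j)
    case (Suc j)
    then show ?case using step[of "n + j"] norm_triangle_sub[of "S (Suc (n + j))" "S (n + j)"] by simp
  qed simp
  define Q where "Q = max 1 (max Q1 Q2)"
  have "norm (norm (S n) / real n - 0) < r" if n: "n \<ge> Q\<^sup>2" for n
  proof -
    define q where "q = nat \<lfloor>sqrt (real n)\<rfloor>"
    have q: "real q \<le> sqrt (real n)" "sqrt (real n) < real q + 1"
      unfolding q_def by (simp, linarith)
    have "real Q \<le> sqrt (real n)" using n by (simp add: real_le_rsqrt flip: of_nat_power)
    then have Qq: "Q \<le> q" using q by linarith
    then have q1: "q \<ge> 1" "q \<ge> Q1" "q \<ge> Q2" by (auto simp: Q_def)
    have "(real q)\<^sup>2 \<le> real n" using q(1) by (metis of_nat_0_le_iff real_sqrt_le_iff real_sqrt_pow2 power_mono real_sqrt_unique)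
    then have qn: "q\<^sup>2 \<le> n" by (metis of_nat_le_iff of_nat_power)
    have "real n < (real q + 1)\<^sup>2"
      using q(2) by (metis of_nat_0_le_iff real_sqrt_pow2 power_strict_mono real_sqrt_ge_zero zero_less_numeral)
    then have "real n - real (q\<^sup>2) \<le> 2 * real q + 1" by (simp add: power2_eq_square algebra_simps)
    then have "real (n - q\<^sup>2) \<le> 2 * real q + 1" using qn by (simp add: of_nat_diff)
    then have nq: "n - q\<^sup>2 \<le> 2 * q"
    proof -
      have "real n < real ((q + 1)\<^sup>2)" using \<open>real n < (real q + 1)\<^sup>2\<close> by (simp add: add.commute)
      then have "n < (q + 1)\<^sup>2" by (simp only: of_nat_less_iff)
      then show ?thesis by (simp add: power2_eq_square)
    qed
    have qpos: "real (q\<^sup>2) > 0" using q1 by simp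
    have "norm (S n) \<le> norm (S (q\<^sup>2)) + real (n - q\<^sup>2)" using lip[of "q\<^sup>2" "n - q\<^sup>2"] qn by simp
    also have "\<dots> \<le> norm (S (q\<^sup>2)) + 2 * real q" using nq by linarith
    finally have "norm (S n) / real n \<le> (norm (S (q\<^sup>2)) + 2 * real q) / real (q\<^sup>2)"
      using qn qpos by (intro frac_le) (auto simp: of_nat_le_iff simp del: of_nat_power)
    also have "\<dots> = norm (S (q\<^sup>2)) / real (q\<^sup>2) + 2 / real q"
      using q1 by (simp add: add_divide_distrib power2_eq_square)
    also have "\<dots> < r / 2 + r / 2"
    proof (intro add_strict_mono Q1 q1)
      have "4 / r < real q" using Q2 q1 by linarith
      then show "2 / real q < r / 2" using r q1 by (simp add: field_simps)
    qed
    finally show ?thesis by simp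
  qed
  then show "\<exists>no. \<forall>n\<ge>no. norm (norm (S n) / real n - 0) < r" by blast
qed

text \<open>
  Along an orbit the character of frequency \<open>k\<close> becomes the characters of the pairwise different
  frequencies \<open>k m\<^sup>i\<close>, and these are orthonormal.
\<close>
lemma integral_norm_square_char_sum:
  assumes "m \<ge> 2" "k \<noteq> 0"
  shows "(\<integral>\<phi>. (norm (\<Sum>i<n. circle_char k ((expanding_map m ^^ i) \<phi>)))\<^sup>2 \<partial>circle_lebesgue) = real n"
proof -
  interpret prob_space circle_lebesgue by (rule prob_space_circle_lebesgue)
  let ?S = "\<lambda>\<phi>. \<Sum>i<n. circle_char k ((expanding_map m ^^ i) \<phi>)"
  have int: "integrable circle_lebesgue (circle_char j)" for j
    by (rule integrable_const_bound[of _ 1]) auto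
  have Ichar: "(\<integral>\<phi>. circle_char (k * int m ^ i - k * int m ^ j) \<phi> \<partial>circle_lebesgue) = (if i = j then 1 else 0)" for i j
  proof (cases "i = j")
    case True
    then show ?thesis using prob_space by simp
  next
    case False
    then have "int m ^ i \<noteq> int m ^ j" using assms(1) by (simp add: power_inject_exp')
    then have "k * int m ^ i - k * int m ^ j \<noteq> 0" using assms(2) by simp
    then show ?thesis using integral_circle_char False by simp
  qed
  have sq: "complex_of_real ((norm (?S \<phi>))\<^sup>2) = (\<Sum>i<n. \<Sum>j<n. circle_char (k * int m ^ i - k * int m ^ j) \<phi>)" for \<phi>
  proof -
    have "complex_of_real ((norm (?S \<phi>))\<^sup>2) = ?S \<phi> * cnj (?S \<phi>)" by (rule complex_norm_square)
    also have "\<dots> = (\<Sum>i<n. \<Sum>j<n. circle_char (k * int m ^ i - k * int m ^ j) \<phi>)"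
      by (simp add: circle_char_funpow_expanding_map cnj_circle_char sum_product circle_char_mult)
    finally show ?thesis .
  qed
  have "complex_of_real (\<integral>\<phi>. (norm (?S \<phi>))\<^sup>2 \<partial>circle_lebesgue)
      = (\<integral>\<phi>. complex_of_real ((norm (?S \<phi>))\<^sup>2) \<partial>circle_lebesgue)"
    by (rule integral_complex_of_real[symmetric])
  also have "\<dots> = (\<Sum>i<n. \<Sum>j<n. if i = j then 1 else 0)"
    unfolding sq using int by (simp add: Ichar del: sum.delta sum.delta')
  also have "\<dots> = complex_of_real (real n)" by simp
  finally show ?thesis by (simp only: of_real_eq_iff)
qed

text \<open>
  The averages over \<open>n = q\<^sup>2\<close> terms have square integral \<open>1 / q\<^sup>2\<close>, which is summable, so they tend to
  0 almost everywhere; no ergodic theorem is involved.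
\<close>
lemma AE_char_sum_tendsto:
  assumes "m \<ge> 2" "k \<noteq> 0"
  shows "AE \<phi> in circle_lebesgue.
    (\<lambda>n. (\<Sum>i<n. circle_char k ((expanding_map m ^^ i) \<phi>)) / of_nat n) \<longlonglongrightarrow> 0"
proof -
  interpret prob_space circle_lebesgue by (rule prob_space_circle_lebesgue)
  let ?S = "\<lambda>n \<phi>. \<Sum>i<n. circle_char k ((expanding_map m ^^ i) \<phi>)"
  let ?u = "\<lambda>q \<phi>. (norm (?S ((Suc q)\<^sup>2) \<phi>) / real ((Suc q)\<^sup>2))\<^sup>2"
  have Sm [measurable]: "?S n \<in> borel_measurable circle_lebesgue" for n
    unfolding circle_char_funpow_expanding_map by measurable
  have u: "(\<integral>\<^sup>+\<phi>. ennreal (?u q \<phi>) \<partial>circle_lebesgue) = ennreal (1 / real ((Suc q)\<^sup>2))" for q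
  proof -
    have bound: "norm (?S n \<phi>) \<le> real n" for n \<phi>
      by (rule order_trans[OF norm_sum]) simp
    have int: "integrable circle_lebesgue (\<lambda>\<phi>. (norm (?S n \<phi>))\<^sup>2)" for n
      by (rule integrable_const_bound[of _ "(real n)\<^sup>2"]) (auto intro!: power_mono bound)
    then have "(\<integral>\<^sup>+\<phi>. ennreal (?u q \<phi>) \<partial>circle_lebesgue) = ennreal (\<integral>\<phi>. ?u q \<phi> \<partial>circle_lebesgue)"
      by (intro nn_integral_eq_integral) (auto simp: power_divide simp del: of_nat_power)
    also have "(\<integral>\<phi>. ?u q \<phi> \<partial>circle_lebesgue) = real ((Suc q)\<^sup>2) / (real ((Suc q)\<^sup>2))\<^sup>2"
      by (simp add: power_divide integral_norm_square_char_sum[OF assms] del: of_nat_power)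
    also have "\<dots> = 1 / real ((Suc q)\<^sup>2)" by (simp add: power2_eq_square)
    finally show ?thesis .
  qed
  have "summable (\<lambda>q. inverse ((real q)\<^sup>2))"
    by (rule inverse_power_summable) simp
  then have "summable (\<lambda>q. inverse ((real (Suc q))\<^sup>2))"
    by (subst summable_Suc_iff)
  then have summ: "summable (\<lambda>q. 1 / real ((Suc q)\<^sup>2))"
    by (simp only: inverse_eq_divide of_nat_power)
  have "(\<integral>\<^sup>+\<phi>. (\<Sum>q. ennreal (?u q \<phi>)) \<partial>circle_lebesgue) = (\<Sum>q. ennreal (1 / real ((Suc q)\<^sup>2)))"
    by (subst nn_integral_suminf) (simp_all only: u, measurable)
  also have "\<dots> \<noteq> \<infinity>"
    unfolding infinity_ennreal_def by (rule ennreal_suminf_neq_top[OF summ]) simp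
  finally have "(\<integral>\<^sup>+\<phi>. (\<Sum>q. ennreal (?u q \<phi>)) \<partial>circle_lebesgue) \<noteq> \<infinity>" .
  then have "AE \<phi> in circle_lebesgue. (\<Sum>q. ennreal (?u q \<phi>)) \<noteq> \<infinity>"
    by (intro nn_integral_noteq_infinite) auto
  then show ?thesis
  proof eventually_elim
    case (elim \<phi>)
    then have "summable (\<lambda>q. ?u q \<phi>)" by (intro summable_suminf_not_top) auto
    then have "(\<lambda>q. ?u q \<phi>) \<longlonglongrightarrow> 0" by (rule summable_LIMSEQ_zero)
    then have "(\<lambda>q. sqrt (?u q \<phi>)) \<longlonglongrightarrow> sqrt 0" by (rule tendsto_real_sqrt)
    then have "(\<lambda>q. norm (?S ((Suc q)\<^sup>2) \<phi>) / real ((Suc q)\<^sup>2)) \<longlonglongrightarrow> 0"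
      by (simp add: real_sqrt_abs del: of_nat_power of_nat_Suc)
    then have "(\<lambda>q. norm (?S (q\<^sup>2) \<phi>) / real (q\<^sup>2)) \<longlonglongrightarrow> 0"
      by (rule LIMSEQ_imp_Suc)
    then have "(\<lambda>n. norm (?S n \<phi>) / real n) \<longlonglongrightarrow> 0"
      by (rule partial_sums_o_of_squares[rotated]) simp
    then have "(\<lambda>n. norm (?S n \<phi> / of_nat n)) \<longlonglongrightarrow> 0" by (simp add: norm_divide)
    then show ?case by (rule tendsto_norm_zero_cancel)
  qed
qed

lemma AE_char_equidistributed:
  assumes "m \<ge> 2"
  shows "AE \<phi> in circle_lebesgue. char_equidistributed m \<phi>"
  unfolding char_equidistributed_def
  by (subst AE_all_countable) (use AE_char_sum_tendsto[OF assms] in auto)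

section \<open>Measures determined by continuous functions\<close>

text \<open>
  The functions are \<open>max 0 (1 - k d)\<close>, where \<open>d\<close> is the distance of \<open>E x\<close> from the image of \<open>C\<close>. This image
  is compact, so \<open>d\<close> vanishes on \<open>C\<close> only.
\<close>
lemma closed_indicator_limit:
  fixes E :: "'x::topological_space \<Rightarrow> 'm::metric_space"
  assumes X: "compact (UNIV :: 'x set)" and E: "continuous_on UNIV E" "inj E" and C: "closed C"
  obtains \<psi> :: "nat \<Rightarrow> 'x \<Rightarrow> real" where "\<And>k. continuous_on UNIV (\<psi> k)"
    "\<And>k x. \<bar>\<psi> k x\<bar> \<le> 1" "\<And>x. (\<lambda>k. \<psi> k x) \<longlonglongrightarrow> indicator C x"
proof (cases "C = {}")
  case True
  show ?thesis by (rule that[of "\<lambda>_ _. 0"]) (use True in auto)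
next
  case False
  have "compact C" using C X by (metis compact_Int_closed inf_top.left_neutral)
  then have "compact (E ` C)" using E(1) by (metis compact_continuous_image continuous_on_subset subset_UNIV)
  then have cl: "closed (E ` C)" by (rule compact_imp_closed)
  show ?thesis
  proof (rule that[of "\<lambda>k x. max 0 (1 - real k * infdist (E x) (E ` C))"])
    fix x
    show "(\<lambda>k. max 0 (1 - real k * infdist (E x) (E ` C))) \<longlonglongrightarrow> indicator C x"
    proof (cases "x \<in> C")
      case True
      then show ?thesis by simp
    next
      case x: False
      then have "E x \<notin> E ` C" using E(2) by (auto dest: injD)
      then have d: "infdist (E x) (E ` C) > 0"
        using infdist_pos_not_in_closed[OF cl] False by simp
      obtain k0 :: nat where "real k0 > 1 / infdist (E x) (E ` C)" using reals_Archimedean2 by blast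
      then have "real k0 * infdist (E x) (E ` C) > 1" using d by (simp add: field_simps)
      then have "1 - real k * infdist (E x) (E ` C) \<le> 0" if "k \<ge> k0" for k
      proof -
        have "real k0 * infdist (E x) (E ` C) \<le> real k * infdist (E x) (E ` C)"
          using that d by (intro mult_right_mono) auto
        then show ?thesis using \<open>real k0 * infdist (E x) (E ` C) > 1\<close> by linarith
      qed
      then have nonpos: "\<And>k. k \<ge> k0 \<Longrightarrow> 1 - real k * infdist (E x) (E ` C) \<le> 0" .
      have "\<forall>\<^sub>F k in sequentially. 0 = max 0 (1 - real k * infdist (E x) (E ` C))"
        using eventually_ge_at_top[of k0] by eventually_elim (rule max_absorb1[symmetric], rule nonpos)
      then show ?thesis using x by (simp add: Lim_transform_eventually[OF tendsto_const])
    qed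
  qed (use E in \<open>auto intro!: continuous_intros simp: infdist_nonneg\<close>)
qed

text \<open>
  The closed sets are an intersection-stable generator of the Borel sets, and their measures are
  limits of integrals of continuous functions.
\<close>
lemma finite_measure_eqI_continuous:
  fixes E :: "'x::topological_space \<Rightarrow> 'm::metric_space"
  assumes X: "compact (UNIV :: 'x set)" and E: "continuous_on UNIV E" "inj E"
    and M: "finite_measure M" "sets M = sets borel" and N: "finite_measure N" "sets N = sets borel"
    and eq: "\<And>\<psi> :: 'x \<Rightarrow> real. continuous_on UNIV \<psi> \<Longrightarrow> (\<integral>x. \<psi> x \<partial>M) = (\<integral>x. \<psi> x \<partial>N)"
  shows "M = N"
proof (rule measure_eqI_generator_eq[of "Collect closed" UNIV M N "\<lambda>_. UNIV"])
  have borel: "sets (borel :: 'x measure) = sigma_sets UNIV (Collect closed)"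
    unfolding borel_eq_closed by (rule sets_measure_of) simp
  show "sets M = sigma_sets UNIV (Collect closed)" "sets N = sigma_sets UNIV (Collect closed)"
    using M N borel by auto
  show "Int_stable (Collect closed :: 'x set set)" by (auto simp: Int_stable_def)
  interpret M: finite_measure M by fact
  interpret N: finite_measure N by fact
  show "emeasure M UNIV \<noteq> \<infinity>" by simp
  show "emeasure M C = emeasure N C" if "C \<in> Collect closed" for C :: "'x set"
  proof -
    have C: "closed C" using that by simp
    obtain \<psi> :: "nat \<Rightarrow> 'x \<Rightarrow> real" where \<psi>: "\<And>k. continuous_on UNIV (\<psi> k)"
      "\<And>k x. \<bar>\<psi> k x\<bar> \<le> 1" "\<And>x. (\<lambda>k. \<psi> k x) \<longlonglongrightarrow> indicator C x"
      by (rule closed_indicator_limit[OF X E C]) (rule that)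
    have lim: "(\<lambda>k. \<integral>x. \<psi> k x \<partial>L) \<longlonglongrightarrow> measure L C" if L: "finite_measure L" "sets L = sets borel" for L
    proof -
      interpret L: finite_measure L by fact
      have [measurable]: "\<psi> k \<in> borel_measurable L" for k
        using borel_measurable_continuous_onI[OF \<psi>(1)[of k]]
        unfolding measurable_cong_sets[OF L(2) refl] .
      have [measurable]: "C \<in> sets L" using C L(2) by simp
      have "(\<lambda>k. \<integral>x. \<psi> k x \<partial>L) \<longlonglongrightarrow> (\<integral>x. indicator C x \<partial>L)"
        by (rule integral_dominated_convergence[where w = "\<lambda>_. 1"]) (use \<psi> in auto)
      then show ?thesis using L.emeasure_finite by (simp add: sets.sets_into_space Int_absorb1)
    qed
    have "measure M C = measure N C"
      using lim[OF M] lim[OF N] eq[OF \<psi>(1)] LIMSEQ_unique by simp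
    then show ?thesis by (simp add: M.emeasure_eq_measure N.emeasure_eq_measure)
  qed
qed auto

section \<open>The baker's map\<close>
abbreviation unit_interval :: "real measure" where
  "unit_interval \<equiv> restrict_space lborel {0..<1}"

abbreviation unit_square :: "(real \<times> real) measure" where
  "unit_square \<equiv> unit_interval \<Otimes>\<^sub>M unit_interval"

text \<open>
  The inverse of the generalised baker's map: the digit that multiplication by \<open>m\<close> shifts out of
  the first coordinate is read off from the second one. Iterating it produces a random backward
  orbit of the expanding circle map.
\<close>

definition baker_inverse :: "nat \<Rightarrow> real \<times> real \<Rightarrow> real \<times> real" where
  "baker_inverse m = (\<lambda>(s, u). ((s + of_int \<lfloor>real m * u\<rfloor>) / real m, frac (real m * u)))"

lemma space_unit_interval: "space unit_interval = {0..<1}"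
  by (simp add: space_restrict_space)

lemma baker_inverse_in_square:
  assumes "m > 0" "p \<in> {0..<1} \<times> {0..<1}"
  shows "baker_inverse m p \<in> {0..<1} \<times> {0..<1}"
proof -
  obtain s u where p: "p = (s, u)" "0 \<le> s" "s < 1" "0 \<le> u" "u < 1" using assms(2) by auto
  have "\<lfloor>real m * u\<rfloor> < int m" using p assms(1) by (simp add: floor_less_iff)
  then have "s + of_int \<lfloor>real m * u\<rfloor> < real m" using p by linarith
  moreover have "0 \<le> s + of_int \<lfloor>real m * u\<rfloor>" using p by simp
  ultimately show ?thesis using assms(1) p(1) by (simp add: baker_inverse_def frac_lt_1)
qed

lemma measurable_baker_inverse [measurable]:
  assumes "m > 0"
  shows "baker_inverse m \<in> measurable unit_square unit_square"
proof -
  have [measurable]: "fst \<in> borel_measurable unit_square"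
    using measurable_fst[of unit_interval unit_interval] by (simp add: measurable_restrict_space2_iff)
  have [measurable]: "snd \<in> borel_measurable unit_square"
    using measurable_snd[of unit_interval unit_interval] by (simp add: measurable_restrict_space2_iff)
  have in_square: "baker_inverse m p \<in> {0..<1} \<times> {0..<1}" if "p \<in> space unit_square" for p
    using baker_inverse_in_square[OF assms] that by (simp only: space_pair_measure space_unit_interval)
  have "(\<lambda>p. ((fst p + of_int \<lfloor>real m * snd p\<rfloor>) / real m, frac (real m * snd p))) \<in> measurable unit_square unit_square"
  proof (rule measurable_Pair; rule measurable_restrict_space2)
    show "(\<lambda>p. (fst p + of_int \<lfloor>real m * snd p\<rfloor>) / real m) \<in> space unit_square \<rightarrow> {0..<1}"
      "(\<lambda>p. frac (real m * snd p)) \<in> space unit_square \<rightarrow> {0..<1}"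
      using in_square by (auto simp: baker_inverse_def split_beta' mem_Times_iff)
    show "(\<lambda>p. (fst p + of_int \<lfloor>real m * snd p\<rfloor>) / real m) \<in> measurable unit_square lborel"
      "(\<lambda>p. frac (real m * snd p)) \<in> measurable unit_square lborel"
      unfolding frac_def by measurable
  qed
  then show ?thesis by (simp add: baker_inverse_def split_beta')
qed

lemma emeasure_unit_interval: "A \<subseteq> {0..<1} \<Longrightarrow> emeasure unit_interval A = emeasure lborel A"
  by (simp add: emeasure_restrict_space)

text \<open>
  On the strip where the digit read off is \<open>j\<close> the map contracts the first coordinate by \<open>m\<close> onto
  \<open>[j/m, (j+1)/m)\<close> and stretches the second one by \<open>m\<close> onto the whole interval, so area is preserved.
\<close>
lemma baker_inverse_preserves:
  assumes m: "m > 0"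
  shows "distr unit_square unit_square (baker_inverse m) = unit_square"
proof (rule pair_measure_eqI[symmetric])
  interpret P: prob_space unit_interval by (rule prob_space_unit_interval)
  show "sigma_finite_measure unit_interval" "sigma_finite_measure unit_interval"
    by (rule P.sigma_finite_measure_axioms)+
  fix A B assume "A \<in> sets unit_interval" "B \<in> sets unit_interval"
  then have A: "A \<subseteq> {0..<1}" and A' [measurable]: "A \<in> sets borel"
    and B: "B \<subseteq> {0..<1}" and B' [measurable]: "B \<in> sets borel"
    by (auto simp: sets_restrict_space_iff)
  define I where "I j = {real j / real m..<(real j + 1) / real m}" for j
  define AA where "AA j = {s \<in> {0..<1}. (s + real j) / real m \<in> A}" for j
  define BB where "BB j = {u \<in> I j. real m * u - real j \<in> B}" for j
  have I_floor: "u \<in> I j \<longleftrightarrow> \<lfloor>real m * u\<rfloor> = int j" for u j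
    using m by (auto simp: I_def floor_eq_iff field_simps)
  have I_sub: "I j \<subseteq> {0..<1}" if "j < m" for j
  proof -
    have "(real j + 1) / real m \<le> 1" using that m by simp
    moreover have "0 \<le> real j / real m" by simp
    ultimately have "0 \<le> u \<and> u < 1" if "u \<in> I j" for u
      using that unfolding I_def atLeastLessThan_iff by linarith
    then show ?thesis by auto
  qed
  have I_disj: "I i \<inter> I j = {}" if "i \<noteq> j" for i j
    using that I_floor by fastforce
  have I_Un: "{0..<1} = (\<Union>j<m. I j)"
  proof
    show "(\<Union>j<m. I j) \<subseteq> {0..<1}" using I_sub by blast
    show "{0..<1} \<subseteq> (\<Union>j<m. I j)"
    proof
      fix u :: real assume u: "u \<in> {0..<1}"
      define j where "j = nat \<lfloor>real m * u\<rfloor>"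
      have "int j = \<lfloor>real m * u\<rfloor>" using u by (simp add: j_def)
      moreover have "\<lfloor>real m * u\<rfloor> < int m" using u m by (simp add: floor_less_iff)
      ultimately show "u \<in> (\<Union>j<m. I j)" using I_floor[of u j] by auto
    qed
  qed
  have [measurable]: "AA j \<in> sets borel" "BB j \<in> sets borel" "I j \<in> sets borel" for j
    by (simp_all add: AA_def BB_def I_def)
  have AA: "emeasure lborel (A \<inter> I j) * ennreal (real m) = emeasure lborel (AA j)" for j
  proof -
    have "emeasure lborel (A \<inter> I j) = (\<integral>\<^sup>+x. indicator (A \<inter> I j) x \<partial>lborel)" by simp
    also have "\<dots> = ennreal \<bar>1 / real m\<bar> * (\<integral>\<^sup>+s. indicator (A \<inter> I j) (real j / real m + (1 / real m) * s) \<partial>lborel)"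
      using m by (intro nn_integral_real_affine) auto
    also have "(\<lambda>s. indicator (A \<inter> I j) (real j / real m + (1 / real m) * s) :: ennreal) = indicator (AA j)"
      using m by (auto simp: fun_eq_iff indicator_def AA_def I_def field_simps)
    finally show ?thesis using m
      by (simp add: mult.commute[of _ "ennreal (real m)"] mult.assoc[symmetric] ennreal_mult[symmetric])
  qed
  have BB: "emeasure lborel B = ennreal (real m) * emeasure lborel (BB j)" for j
  proof -
    have "emeasure lborel B = (\<integral>\<^sup>+x. indicator B x \<partial>lborel)" by simp
    also have "\<dots> = ennreal \<bar>real m\<bar> * (\<integral>\<^sup>+u. indicator B (- real j + real m * u) \<partial>lborel)"
      using m by (intro nn_integral_real_affine) auto
    also have "(\<lambda>u. indicator B (- real j + real m * u) :: ennreal) = indicator (BB j)"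
      using m B by (auto simp: fun_eq_iff indicator_def BB_def I_def field_simps)
    finally show ?thesis by simp
  qed
  have AB: "AA j \<in> sets unit_interval" "BB j \<in> sets unit_interval" if "j < m" for j
  proof -
    have "AA j \<subseteq> {0..<1}" "BB j \<subseteq> {0..<1}" using I_sub[OF that] by (auto simp: AA_def BB_def)
    then show "AA j \<in> sets unit_interval" "BB j \<in> sets unit_interval"
      by (simp_all add: sets_restrict_space_iff)
  qed
  have pre: "baker_inverse m -` (A \<times> B) \<inter> space unit_square = (\<Union>j<m. AA j \<times> BB j)"
  proof (intro set_eqI iffI)
    fix p assume p: "p \<in> baker_inverse m -` (A \<times> B) \<inter> space unit_square"
    obtain s u where su: "p = (s, u)" by (cases p)
    from p su have s: "s \<in> {0..<1}" and u: "u \<in> {0..<1}"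
      by (simp_all add: space_pair_measure space_unit_interval)
    then obtain j where j: "j < m" "u \<in> I j" using I_Un by blast
    then have "\<lfloor>real m * u\<rfloor> = int j" using I_floor by simp
    then have "s \<in> AA j" "u \<in> BB j" using p su s j(2)
      by (auto simp: baker_inverse_def AA_def BB_def frac_def)
    then show "p \<in> (\<Union>j<m. AA j \<times> BB j)" using j su by blast
  next
    fix p assume "p \<in> (\<Union>j<m. AA j \<times> BB j)"
    then obtain j s u where su: "p = (s, u)" "j < m" "s \<in> AA j" "u \<in> BB j" by blast
    then have "\<lfloor>real m * u\<rfloor> = int j" "u \<in> {0..<1}" using I_floor I_sub[of j] by (auto simp: BB_def)
    then show "p \<in> baker_inverse m -` (A \<times> B) \<inter> space unit_square"
      using su by (auto simp: baker_inverse_def AA_def BB_def frac_def space_pair_measure space_unit_interval)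
  qed
  have AB': "emeasure unit_square (AA j \<times> BB j) = emeasure lborel (A \<inter> I j) * emeasure lborel B" if "j < m" for j
  proof -
    have "emeasure unit_square (AA j \<times> BB j) = emeasure lborel (AA j) * emeasure lborel (BB j)"
      using AB[OF that] by (subst P.emeasure_pair_measure_Times)
        (auto simp: sets_restrict_space_iff emeasure_unit_interval)
    then show ?thesis by (simp add: BB[of j] AA[symmetric] mult.assoc)
  qed
  have "emeasure (distr unit_square unit_square (baker_inverse m)) (A \<times> B) = emeasure unit_square (\<Union>j<m. AA j \<times> BB j)"
    using \<open>A \<in> sets unit_interval\<close> \<open>B \<in> sets unit_interval\<close> m
    by (subst emeasure_distr) (auto simp: pre)
  also have "\<dots> = (\<Sum>j<m. emeasure unit_square (AA j \<times> BB j))"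
    using AB I_disj by (intro sum_emeasure[symmetric]) (fastforce simp: disjoint_family_on_def BB_def)+
  also have "\<dots> = (\<Sum>j<m. emeasure lborel (A \<inter> I j)) * emeasure lborel B"
    by (simp add: AB' sum_distrib_right)
  also have "(\<Sum>j<m. emeasure lborel (A \<inter> I j)) = emeasure lborel (\<Union>j<m. A \<inter> I j)"
    using I_disj by (intro sum_emeasure) (auto simp: disjoint_family_on_def)
  also have "(\<Union>j<m. A \<inter> I j) = A" using I_Un A by blast
  finally show "emeasure unit_interval A * emeasure unit_interval B
    = emeasure (distr unit_square unit_square (baker_inverse m)) (A \<times> B)"
    using A B by (simp add: emeasure_unit_interval)
qed simp

section \<open>Skew products that contract a ball in the fibres\<close>

text \<open>
  The map \<open>param\<close> identifies the closed Euclidean ball of radius 2 with a ball in the fibre, and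
  \<open>coord\<close> recovers the coordinates. Every fibre map sends the closed ball into the open one and
  contracts it by the factor \<open>lam\<close>. The map \<open>emb\<close> makes the fibre metrizable.
\<close>
locale fibre_contraction =
  fixes m :: nat
    and F :: "circle \<times> 'a::t2_space \<Rightarrow> circle \<times> 'a"
    and emb :: "'a \<Rightarrow> 'b::metric_space"
    and coord :: "'a \<Rightarrow> 'v::euclidean_space"
    and param :: "'v \<Rightarrow> 'a"
    and lam :: real
  assumes m: "m \<ge> 2"
    and compact_fibre: "compact (UNIV :: 'a set)"
    and emb: "continuous_on UNIV emb" "inj emb"
    and F_base: "\<And>p. fst (F p) = expanding_map m (fst p)"
    and continuous_F: "continuous_on UNIV F"
    and F_inj: "\<And>\<phi> x y. F (\<phi>, x) = F (\<phi>, y) \<Longrightarrow> x = y"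
    and continuous_coord: "continuous_on UNIV coord"
    and continuous_param: "continuous_on (cball 0 2) param"
    and coord_param: "\<And>y. y \<in> cball 0 2 \<Longrightarrow> coord (param y) = y"
    and open_param_ball: "open (param ` ball 0 2)"
    and F_into: "\<And>\<phi> y. y \<in> cball 0 2 \<Longrightarrow> snd (F (\<phi>, param y)) \<in> param ` ball 0 2"
    and lam: "0 \<le> lam" "lam < 1"
    and F_contracts: "\<And>\<phi> y z. y \<in> cball 0 2 \<Longrightarrow> z \<in> cball 0 2 \<Longrightarrow>
      dist (coord (snd (F (\<phi>, param y)))) (coord (snd (F (\<phi>, param z)))) \<le> lam * dist y z"
begin

text \<open>
  The skew product in the coordinates of the ball.
\<close>
definition G :: "circle \<times> 'v \<Rightarrow> circle \<times> 'v" where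
  "G p = (expanding_map m (fst p), coord (snd (F (fst p, param (snd p)))))"

definition par :: "circle \<times> 'v \<Rightarrow> circle \<times> 'a" where
  "par p = (fst p, param (snd p))"

abbreviation Q :: "(circle \<times> 'v) set" where "Q \<equiv> UNIV \<times> cball 0 2"

lemma m_pos: "m > 0" using m by simp

lemma G_ball: "p \<in> Q \<Longrightarrow> snd (G p) \<in> ball 0 2"
  using F_into[of "snd p" "fst p"] coord_param by (force simp: G_def)

lemma G_in: "p \<in> Q \<Longrightarrow> G p \<in> Q"
  using G_ball[of p] by (cases "G p") auto

lemma F_par: "p \<in> Q \<Longrightarrow> F (par p) = par (G p)"
proof -
  assume p: "p \<in> Q"
  then have "snd p \<in> cball 0 2" by auto
  from F_into[OF this, of "fst p"] obtain z where z: "z \<in> ball 0 2" "snd (F (fst p, param (snd p))) = param z" by blast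
  then have "coord (param z) = z" by (intro coord_param) auto
  then show ?thesis using z by (simp add: par_def G_def F_base prod_eq_iff)
qed

lemma funpow_G_in: "p \<in> Q \<Longrightarrow> (G ^^ n) p \<in> Q"
proof (induction n)
  case (Suc n)
  then show ?case using G_in by simp
qed simp

lemma funpow_F_par: "p \<in> Q \<Longrightarrow> (F ^^ n) (par p) = par ((G ^^ n) p)"
  by (induction n) (simp_all add: F_par funpow_G_in del: mem_Times_iff)

lemma fst_funpow_G: "fst ((G ^^ n) p) = (expanding_map m ^^ n) (fst p)"
  by (induction n) (simp_all add: G_def)

lemma continuous_on_coord [continuous_intros]:
  "continuous_on S f \<Longrightarrow> continuous_on S (\<lambda>x. coord (f x))"
  by (rule continuous_on_compose2[OF continuous_coord]) auto

lemma continuous_on_F [continuous_intros]: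
  "continuous_on S f \<Longrightarrow> continuous_on S (\<lambda>x. F (f x))"
  by (rule continuous_on_compose2[OF continuous_F]) auto

lemma continuous_on_par [continuous_intros]:
  assumes "continuous_on S f" "continuous_on S g" "g ` S \<subseteq> cball 0 2"
  shows "continuous_on S (\<lambda>x. par (f x, g x))"
  unfolding par_def fst_conv snd_conv
  by (intro continuous_on_Pair assms(1) continuous_on_compose2[OF continuous_param assms(2,3)])

lemma continuous_par: "continuous_on Q par"
  using continuous_on_par[of Q fst snd] by (simp add: continuous_on_fst continuous_on_snd continuous_on_id image_subset_iff)

lemma continuous_G: "continuous_on Q G"
proof -
  have "continuous_on Q (\<lambda>p. coord (snd (F (par p))))"
    by (intro continuous_on_coord continuous_on_snd continuous_on_F continuous_par)
  moreover have "continuous_on Q (\<lambda>p. expanding_map m (fst p))"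
    by (intro continuous_intros)
  ultimately have "continuous_on Q (\<lambda>p. (expanding_map m (fst p), coord (snd (F (par p)))))"
    by (rule continuous_on_Pair[rotated])
  then show ?thesis unfolding par_def G_def[abs_def] .
qed

lemma continuous_funpow_G: "continuous_on Q (G ^^ n)"
proof (induction n)
  case (Suc n)
  have "(G ^^ n) ` Q \<subseteq> Q" using funpow_G_in by blast
  then show ?case using continuous_on_compose[OF Suc continuous_on_subset[OF continuous_G]] by (simp only: funpow.simps)
qed (simp add: continuous_on_id)

lemma G_contracts:
  assumes "(\<phi>, y) \<in> Q" "(\<phi>, z) \<in> Q"
  shows "dist (snd ((G ^^ n) (\<phi>, y))) (snd ((G ^^ n) (\<phi>, z))) \<le> lam ^ n * dist y z"
proof (induction n)
  case (Suc n)
  have Q1: "(G ^^ n) (\<phi>, y) \<in> Q" "(G ^^ n) (\<phi>, z) \<in> Q" using assms funpow_G_in by blast+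
  have "dist (snd ((G ^^ Suc n) (\<phi>, y))) (snd ((G ^^ Suc n) (\<phi>, z)))
    \<le> lam * dist (snd ((G ^^ n) (\<phi>, y))) (snd ((G ^^ n) (\<phi>, z)))"
    using Q1 F_contracts[of "snd ((G ^^ n) (\<phi>, y))" "snd ((G ^^ n) (\<phi>, z))" "(expanding_map m ^^ n) \<phi>"]
    by (simp add: G_def fst_funpow_G mem_Times_iff)
  also have "\<dots> \<le> lam * (lam ^ n * dist y z)" using Suc lam by (intro mult_left_mono)
  finally show ?case by (simp add: mult.assoc)
qed simp

lemma G_close:
  assumes "(\<phi>, y) \<in> Q" "(\<phi>, z) \<in> Q"
  shows "dist (snd ((G ^^ n) (\<phi>, y))) (snd ((G ^^ n) (\<phi>, z))) \<le> 4 * lam ^ n"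
proof -
  have "dist y z \<le> dist y 0 + dist z 0" by (rule dist_triangle2)
  then have "dist y z \<le> 4" using assms by (auto simp: dist_commute)
  then have "lam ^ n * dist y z \<le> lam ^ n * 4" using lam by (intro mult_left_mono) auto
  then show ?thesis using G_contracts[OF assms, of n] by simp
qed

lemma lam_power_small:
  assumes "\<epsilon> > 0" obtains k where "\<And>n. n \<ge> k \<Longrightarrow> 4 * lam ^ n < \<epsilon>"
proof -
  have "(\<lambda>n. 4 * lam ^ n) \<longlonglongrightarrow> 4 * 0" using lam by (intro tendsto_intros LIMSEQ_realpow_zero) auto
  then obtain k where "\<And>n. n \<ge> k \<Longrightarrow> norm (4 * lam ^ n - 4 * 0) < \<epsilon>" using LIMSEQ_D assms by blast
  then show ?thesis using lam by (intro that[of k]) (auto simp: abs_mult)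
qed

text \<open>
  The circle is covered by a compact interval of the line, where uniform continuity makes sense.
\<close>
lemma uniform_along_fibres:
  fixes \<psi> :: "circle \<times> 'a \<Rightarrow> real"
  assumes \<psi>: "continuous_on UNIV \<psi>" and "\<epsilon> > 0"
  obtains \<delta> where "\<delta> > 0"
    "\<And>\<phi> y z. y \<in> cball 0 2 \<Longrightarrow> z \<in> cball 0 2 \<Longrightarrow> dist y z < \<delta> \<Longrightarrow> \<bar>\<psi> (par (\<phi>, y)) - \<psi> (par (\<phi>, z))\<bar> < \<epsilon>"
proof -
  have "continuous_on ({0..1} \<times> cball 0 2) (\<lambda>p. \<psi> (par (abs_circle (fst p), snd p)))"
    by (rule continuous_on_compose2[OF \<psi>]) (auto intro!: continuous_intros)
  then have "uniformly_continuous_on ({0..1} \<times> cball 0 2) (\<lambda>p. \<psi> (par (abs_circle (fst p), snd p)))"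
    by (intro compact_uniformly_continuous compact_Times) auto
  then obtain \<delta> where \<delta>: "\<delta> > 0" "\<And>p q. p \<in> {0..1} \<times> cball 0 2 \<Longrightarrow> q \<in> {0..1} \<times> cball 0 2 \<Longrightarrow> dist q p < \<delta> \<Longrightarrow>
      dist (\<psi> (par (abs_circle (fst q), snd q))) (\<psi> (par (abs_circle (fst p), snd p))) < \<epsilon>"
    using \<open>\<epsilon> > 0\<close> unfolding uniformly_continuous_on_def by metis
  show ?thesis
  proof (rule that[OF \<delta>(1)])
    fix \<phi> and y z :: 'v assume yz: "y \<in> cball 0 2" "z \<in> cball 0 2" "dist y z < \<delta>"
    obtain t where "0 \<le> t" "t < 1" "\<phi> = abs_circle t" by (rule circle_cases)
    then show "\<bar>\<psi> (par (\<phi>, y)) - \<psi> (par (\<phi>, z))\<bar> < \<epsilon>"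
      using \<delta>(2)[of "(t, z)" "(t, y)"] yz by (simp add: dist_Pair_Pair dist_real_def)
  qed
qed

subsection \<open>The invariant measure\<close>

text \<open>
  A point of the unit square encodes a point of the circle together with one of its backward
  orbits \<open>past 0, past 1, \<dots>\<close>. Pushing the centre of the fibre ball forward from time \<open>-k\<close> to time 0 along
  this orbit converges as \<open>k\<close> grows, since the fibres contract. The law of the limit point under
  Lebesgue measure is the SRB measure; in effect the unit square with the baker's map is the
  natural extension of the expanding map.
\<close>
definition past :: "nat \<Rightarrow> real \<times> real \<Rightarrow> circle" where
  "past k q = abs_circle (fst ((baker_inverse m ^^ k) q))"

definition approx_fibre :: "nat \<Rightarrow> real \<times> real \<Rightarrow> 'v" where
  "approx_fibre k q = snd ((G ^^ k) (past k q, 0))"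

definition limit_fibre :: "real \<times> real \<Rightarrow> 'v" where
  "limit_fibre q = lim (\<lambda>k. approx_fibre k q)"

definition limit_point :: "real \<times> real \<Rightarrow> circle \<times> 'a" where
  "limit_point q = par (abs_circle (fst q), limit_fibre q)"

definition srb :: "(circle \<times> 'a) measure" where
  "srb = distr unit_square borel limit_point"

lemma expanding_map_past_Suc: "expanding_map m (past (Suc k) q) = past k q"
  using m_pos by (simp add: past_def baker_inverse_def split_beta' abs_circle_eq_iff)

lemma expanding_map_past: "(expanding_map m ^^ j) (past (j + k) q) = past k q"
proof (induction j)
  case (Suc j)
  then show ?case by (simp add: expanding_map_past_Suc funpow_swap1)
qed simp

lemma approx_fibre_in: "approx_fibre k q \<in> cball 0 2"
  using funpow_G_in[of "(past k q, 0)" k] by (auto simp: approx_fibre_def mem_Times_iff)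

text \<open>
  Starting \<open>j\<close> steps earlier only changes the point of the fibre ball over \<open>past k\<close> from which the last
  \<open>k\<close> steps are made.
\<close>
lemma approx_fibre_close: "dist (approx_fibre (k + j) q) (approx_fibre k q) \<le> 4 * lam ^ k"
proof -
  let ?p = "(G ^^ j) (past (j + k) q, 0)"
  have "?p \<in> Q" by (rule funpow_G_in) simp
  moreover have "fst ?p = past k q" by (simp add: fst_funpow_G expanding_map_past)
  ultimately have "dist (snd ((G ^^ k) (past k q, snd ?p))) (snd ((G ^^ k) (past k q, 0))) \<le> 4 * lam ^ k"
    by (intro G_close) (auto simp: mem_Times_iff)
  moreover have "(past k q, snd ?p) = ?p" using \<open>fst ?p = past k q\<close> by (simp add: prod_eq_iff)
  ultimately have "dist (snd ((G ^^ k) ?p)) (approx_fibre k q) \<le> 4 * lam ^ k"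
    by (simp only: approx_fibre_def)
  moreover have "(G ^^ k) ?p = (G ^^ (k + j)) (past (k + j) q, 0)"
    by (simp only: funpow_add o_apply add.commute[of j k])
  ultimately show ?thesis by (simp only: approx_fibre_def)
qed

lemma approx_fibre_LIMSEQ: "(\<lambda>k. approx_fibre k q) \<longlonglongrightarrow> limit_fibre q"
proof -
  have "Cauchy (\<lambda>k. approx_fibre k q)"
  proof (rule metric_CauchyI)
    fix \<epsilon> :: real assume "\<epsilon> > 0"
    then obtain k where k: "\<And>n. n \<ge> k \<Longrightarrow> 4 * lam ^ n < \<epsilon> / 2" using lam_power_small[of "\<epsilon> / 2"] by auto
    have "dist (approx_fibre n q) (approx_fibre k q) < \<epsilon> / 2" if "n \<ge> k" for n
      using approx_fibre_close[of k "n - k" q] k[of k] that by simp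
    then show "\<exists>M. \<forall>i\<ge>M. \<forall>j\<ge>M. dist (approx_fibre i q) (approx_fibre j q) < \<epsilon>"
      by (meson dist_triangle_half_l)
  qed
  then show ?thesis unfolding limit_fibre_def by (simp add: Cauchy_convergent_iff convergent_LIMSEQ_iff)
qed

lemma limit_fibre_in: "limit_fibre q \<in> cball 0 2"
  by (rule Lim_in_closed_set[OF _ _ _ approx_fibre_LIMSEQ]) (use approx_fibre_in in auto)

lemma measurable_on_Q:
  assumes "continuous_on Q f" "s \<in> borel_measurable N" "y \<in> borel_measurable N" "\<And>q. q \<in> space N \<Longrightarrow> y q \<in> cball 0 2"
  shows "(\<lambda>q. f (abs_circle (s q), y q)) \<in> borel_measurable N"
proof -
  have "continuous_on (UNIV \<times> cball 0 2) (\<lambda>p. f (abs_circle (fst p), snd p))"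
    by (rule continuous_on_compose2[OF assms(1)]) (auto intro!: continuous_intros)
  then have f: "(\<lambda>p. f (abs_circle (fst p), snd p)) \<in> borel_measurable (restrict_space borel (UNIV \<times> cball 0 2))"
    by (rule borel_measurable_continuous_on_restrict)
  have "(\<lambda>q. (s q, y q)) \<in> measurable N (restrict_space borel (UNIV \<times> cball 0 2))"
    using assms by (intro measurable_restrict_space2 borel_measurable_Pair) auto
  from measurable_compose[OF this f] show ?thesis by simp
qed

lemma measurable_fst_square: "fst \<in> borel_measurable unit_square"
  using measurable_fst[of unit_interval unit_interval] by (simp add: measurable_restrict_space2_iff)

lemma measurable_funpow_baker: "baker_inverse m ^^ k \<in> measurable unit_square unit_square"
proof (induction k)
  case (Suc k)
  then show ?case using measurable_comp[OF Suc measurable_baker_inverse[OF m_pos]] by (simp only: funpow.simps)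
qed (simp add: id_def)

lemma distr_funpow_baker: "distr unit_square unit_square (baker_inverse m ^^ k) = unit_square"
proof (induction k)
  case 0
  show ?case unfolding funpow.simps id_def by (rule distr_id)
next
  case (Suc k)
  have "distr (distr unit_square unit_square (baker_inverse m ^^ k)) unit_square (baker_inverse m)
    = distr unit_square unit_square (baker_inverse m \<circ> baker_inverse m ^^ k)"
    by (rule distr_distr[OF measurable_baker_inverse[OF m_pos] measurable_funpow_baker])
  then show ?case unfolding Suc baker_inverse_preserves[OF m_pos] funpow.simps by (rule sym)
qed

lemma measurable_approx_fibre: "approx_fibre k \<in> borel_measurable unit_square"
  unfolding approx_fibre_def past_def
  by (rule measurable_on_Q[where f = "\<lambda>p. snd ((G ^^ k) p)"])
    (auto intro!: continuous_on_snd continuous_funpow_G measurable_compose[OF measurable_funpow_baker measurable_fst_square])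

lemma measurable_limit_fibre: "limit_fibre \<in> borel_measurable unit_square"
  by (rule borel_measurable_LIMSEQ_metric[OF measurable_approx_fibre approx_fibre_LIMSEQ])

lemma measurable_limit_point: "limit_point \<in> measurable unit_square borel"
  unfolding limit_point_def
  by (rule measurable_on_Q[OF continuous_par measurable_fst_square measurable_limit_fibre limit_fibre_in])

lemma prob_space_unit_square: "prob_space unit_square"
proof -
  interpret P: prob_space unit_interval by (rule prob_space_unit_interval)
  interpret PP: pair_prob_space unit_interval unit_interval ..
  show ?thesis by (rule PP.prob_space_axioms)
qed

lemma prob_space_srb: "prob_space srb"
  unfolding srb_def by (rule prob_space.prob_space_distr[OF prob_space_unit_square measurable_limit_point])

lemma sets_srb [simp]: "sets srb = sets borel" by (simp add: srb_def)

lemma space_srb [simp]: "space srb = UNIV" by (simp add: srb_def)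

lemma distr_fst_square: "distr unit_square unit_interval fst = unit_interval"
proof -
  interpret P: prob_space unit_interval by (rule prob_space_unit_interval)
  show ?thesis by (rule P.distr_pair_fst)
qed

text \<open>
  Lebesgue measure on the square is invariant under the inverse baker's map, hence every point of
  the random backward orbit is uniformly distributed on the circle.
\<close>
lemma distr_past: "distr unit_square borel (past k) = circle_lebesgue"
proof -
  have "distr unit_square borel (past k) = distr (distr (distr unit_square unit_square (baker_inverse m ^^ k)) unit_interval fst) borel abs_circle"
  proof -
    have "distr unit_square borel (past k) = distr unit_square borel (abs_circle \<circ> (fst \<circ> (baker_inverse m ^^ k)))"
      by (simp add: past_def[abs_def] o_def)
    also have "\<dots> = distr (distr unit_square unit_interval (fst \<circ> (baker_inverse m ^^ k))) borel abs_circle"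
      by (rule distr_distr[symmetric, OF measurable_abs_circle_restrict measurable_comp[OF measurable_funpow_baker measurable_fst]])
    also have "distr unit_square unit_interval (fst \<circ> (baker_inverse m ^^ k))
      = distr (distr unit_square unit_square (baker_inverse m ^^ k)) unit_interval fst"
      by (rule distr_distr[symmetric, OF measurable_fst measurable_funpow_baker])
    finally show ?thesis .
  qed
  then show ?thesis by (simp only: distr_funpow_baker distr_fst_square circle_lebesgue_def)
qed

lemma measurable_past: "past k \<in> measurable unit_square borel"
  unfolding past_def
  by (intro measurable_compose[OF measurable_compose[OF measurable_funpow_baker measurable_fst_square]] measurable_abs_circle)

lemma measurable_of_continuous:
  fixes \<psi> :: "circle \<times> 'a \<Rightarrow> real"
  shows "continuous_on UNIV \<psi> \<Longrightarrow> \<psi> \<in> borel_measurable borel"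
  by (rule borel_measurable_continuous_onI)

lemma compact_X: "compact (UNIV :: (circle \<times> 'a) set)"
  using compact_Times[OF compact_UNIV_circle compact_fibre] by simp

lemma bounded_of_continuous:
  fixes \<psi> :: "circle \<times> 'a \<Rightarrow> real"
  assumes "continuous_on UNIV \<psi>"
  obtains b where "\<And>x. \<bar>\<psi> x\<bar> \<le> b"
proof -
  have "compact (range \<psi>)" by (rule compact_continuous_image[OF assms compact_X])
  then show ?thesis using that by (metis compact_imp_bounded bounded_iff rangeI real_norm_def)
qed

lemma continuous_iterate_origin: "continuous_on UNIV (\<lambda>\<phi>. par ((G ^^ k) (\<phi>, 0)))"
proof -
  have "continuous_on UNIV (\<lambda>\<phi>. (G ^^ k) (\<phi>, 0))"
    by (rule continuous_on_compose2[OF continuous_funpow_G]) (auto intro!: continuous_intros)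
  moreover have "(\<lambda>\<phi>. (G ^^ k) (\<phi>, 0)) ` UNIV \<subseteq> Q"
    using funpow_G_in[of "(_, 0)" k] by (simp add: image_subset_iff)
  ultimately show ?thesis using continuous_on_compose2[OF continuous_par] by blast
qed

text \<open>
  The SRB measure is the weak limit of the images under \<open>F\<^sup>k\<close> of Lebesgue measure on the curve of
  centres. Invariance and the identification of time averages both follow from this formula.
\<close>
lemma integral_srb_LIMSEQ:
  fixes \<psi> :: "circle \<times> 'a \<Rightarrow> real"
  assumes \<psi>: "continuous_on UNIV \<psi>"
  shows "(\<lambda>k. \<integral>\<phi>. \<psi> (par ((G ^^ k) (\<phi>, 0))) \<partial>circle_lebesgue) \<longlonglongrightarrow> (\<integral>x. \<psi> x \<partial>srb)"
proof -
  interpret U: prob_space unit_square by (rule prob_space_unit_square)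
  obtain b where b: "\<And>x. \<bar>\<psi> x\<bar> \<le> b" by (rule bounded_of_continuous[OF \<psi>]) blast
  define u :: "nat \<Rightarrow> real \<times> real \<Rightarrow> real" where "u k q = \<psi> (par ((G ^^ k) (past k q, 0)))" for k q
  have cont: "continuous_on UNIV (\<lambda>\<phi>. \<psi> (par ((G ^^ k) (\<phi>, 0))))" for k
    by (rule continuous_on_compose2[OF \<psi> continuous_iterate_origin]) simp
  have meas: "(\<lambda>\<phi>. \<psi> (par ((G ^^ k) (\<phi>, 0)))) \<in> borel_measurable borel" for k
    by (rule borel_measurable_continuous_onI[OF cont])
  have um: "u k \<in> borel_measurable unit_square" for k
    unfolding u_def by (rule measurable_compose[OF measurable_past meas])
  have u_eq: "u k q = \<psi> (par (abs_circle (fst q), approx_fibre k q))" for k q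
  proof -
    have "fst ((G ^^ k) (past k q, 0)) = past 0 q"
      using expanding_map_past[of k 0 q] by (simp add: fst_funpow_G)
    then have "(G ^^ k) (past k q, 0) = (abs_circle (fst q), approx_fibre k q)"
      by (simp add: approx_fibre_def past_def prod_eq_iff)
    then show ?thesis by (simp add: u_def)
  qed
  have "(\<lambda>k. \<integral>q. u k q \<partial>unit_square) \<longlonglongrightarrow> (\<integral>q. \<psi> (limit_point q) \<partial>unit_square)"
  proof (rule integral_dominated_convergence[where w = "\<lambda>_. b"])
    show "(\<lambda>q. \<psi> (limit_point q)) \<in> borel_measurable unit_square"
      by (rule measurable_compose[OF measurable_limit_point measurable_of_continuous[OF \<psi>]])
    show "AE q in unit_square. (\<lambda>k. u k q) \<longlonglongrightarrow> \<psi> (limit_point q)"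
    proof (rule AE_I2)
      fix q :: "real \<times> real"
      have "continuous_on (cball 0 2) (\<lambda>y. \<psi> (par (abs_circle (fst q), y)))"
        by (rule continuous_on_compose2[OF \<psi>]) (auto intro!: continuous_intros)
      then show "(\<lambda>k. u k q) \<longlonglongrightarrow> \<psi> (limit_point q)"
        unfolding u_eq limit_point_def
        by (rule continuous_on_tendsto_compose[OF _ approx_fibre_LIMSEQ limit_fibre_in])
          (use approx_fibre_in in auto)
    qed
    show "AE q in unit_square. norm (u k q) \<le> b" for k
      by (rule AE_I2) (simp add: u_def b)
  qed (auto intro: um)
  moreover have "(\<integral>q. u k q \<partial>unit_square) = (\<integral>\<phi>. \<psi> (par ((G ^^ k) (\<phi>, 0))) \<partial>circle_lebesgue)" for k
    unfolding u_def distr_past[of k, symmetric] by (rule integral_distr[OF measurable_past meas, symmetric])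
  moreover have "(\<integral>q. \<psi> (limit_point q) \<partial>unit_square) = (\<integral>x. \<psi> x \<partial>srb)"
    unfolding srb_def
    by (rule integral_distr[OF measurable_limit_point measurable_of_continuous[OF \<psi>], symmetric])
  ultimately show ?thesis by simp
qed

lemma measurable_F: "F \<in> borel_measurable borel"
  by (rule borel_measurable_continuous_onI[OF continuous_F])

lemma separating_map:
  "continuous_on UNIV (\<lambda>p :: circle \<times> 'a. (circle_char 1 (fst p), emb (snd p)))"
  "inj (\<lambda>p :: circle \<times> 'a. (circle_char 1 (fst p), emb (snd p)))"
proof -
  show "continuous_on UNIV (\<lambda>p :: circle \<times> 'a. (circle_char 1 (fst p), emb (snd p)))"
    by (intro continuous_on_Pair continuous_intros continuous_on_compose2[OF emb(1)]) auto
  show "inj (\<lambda>p :: circle \<times> 'a. (circle_char 1 (fst p), emb (snd p)))"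
    using emb(2) inj_circle_char_1 by (auto simp: inj_def prod_eq_iff)
qed

text \<open>
  Replacing \<open>\<psi>\<close> by \<open>\<psi> \<circ> F\<close> in the weak limit shifts the sequence of integrals by one.
\<close>
lemma invariant_srb: "distr srb borel F = srb"
proof (rule finite_measure_eqI_continuous[OF compact_X separating_map])
  interpret S: prob_space srb by (rule prob_space_srb)
  have Fm: "F \<in> measurable srb borel" using measurable_F by (simp add: measurable_cong_sets[OF sets_srb refl])
  show "finite_measure (distr srb borel F)"
    using S.prob_space_distr[OF Fm] by (rule prob_space.finite_measure)
  show "finite_measure srb" by unfold_locales
  fix \<psi> :: "circle \<times> 'a \<Rightarrow> real" assume \<psi>: "continuous_on UNIV \<psi>"
  have \<psi>F: "continuous_on UNIV (\<lambda>x. \<psi> (F x))" by (rule continuous_on_compose2[OF \<psi> continuous_F]) simp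
  have "F (par ((G ^^ k) (\<phi>, 0))) = par ((G ^^ Suc k) (\<phi>, 0))" for k \<phi>
    using F_par[OF funpow_G_in[of "(\<phi>, 0)" k]] by simp
  then have "(\<lambda>k. \<integral>\<phi>. \<psi> (par ((G ^^ Suc k) (\<phi>, 0))) \<partial>circle_lebesgue) \<longlonglongrightarrow> (\<integral>x. \<psi> (F x) \<partial>srb)"
    using integral_srb_LIMSEQ[OF \<psi>F] by simp
  moreover have "(\<lambda>k. \<integral>\<phi>. \<psi> (par ((G ^^ Suc k) (\<phi>, 0))) \<partial>circle_lebesgue) \<longlonglongrightarrow> (\<integral>x. \<psi> x \<partial>srb)"
    by (rule LIMSEQ_Suc[OF integral_srb_LIMSEQ[OF \<psi>]])
  ultimately have "(\<integral>x. \<psi> (F x) \<partial>srb) = (\<integral>x. \<psi> x \<partial>srb)" by (rule LIMSEQ_unique)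
  then show "(\<integral>x. \<psi> x \<partial>distr srb borel F) = (\<integral>x. \<psi> x \<partial>srb)"
    by (simp add: integral_distr[OF Fm measurable_of_continuous[OF \<psi>]])
qed auto

lemma invariant_measure_srb: "invariant_measure F srb"
  by (simp add: invariant_measure_def prob_space_srb measurable_F invariant_srb)

subsection \<open>Time averages\<close>

text \<open>
  After \<open>k\<close> steps the position in the fibre is known up to \<open>4 lam\<^sup>k\<close> from the base point alone. So the
  value of a test function at time \<open>i + k\<close> is uniformly close to a continuous function of the base
  point at time \<open>i\<close>, and the averages of the latter converge by equidistribution.
\<close>
lemma par_in_basin:
  assumes \<phi>: "char_equidistributed m \<phi>" and y: "y \<in> cball 0 2"
  shows "par (\<phi>, y) \<in> basin F srb"
  unfolding basin_def
proof (intro CollectI allI impI average_tendsto_approx)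
  fix \<psi> :: "circle \<times> 'a \<Rightarrow> real" and \<epsilon> :: real assume \<psi>: "continuous_on UNIV \<psi>" and \<epsilon>: "\<epsilon> > 0"
  obtain \<delta> where \<delta>: "\<delta> > 0"
    "\<And>\<phi> y z. y \<in> cball 0 2 \<Longrightarrow> z \<in> cball 0 2 \<Longrightarrow> dist y z < \<delta> \<Longrightarrow> \<bar>\<psi> (par (\<phi>, y)) - \<psi> (par (\<phi>, z))\<bar> < \<epsilon>"
    by (rule uniform_along_fibres[OF \<psi> \<epsilon>]) blast
  obtain k1 where k1: "\<And>n. n \<ge> k1 \<Longrightarrow> 4 * lam ^ n < \<delta>" by (rule lam_power_small[OF \<delta>(1)]) blast
  define I where "I k = (\<integral>\<phi>. \<psi> (par ((G ^^ k) (\<phi>, 0))) \<partial>circle_lebesgue)" for k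
  obtain k2 where k2: "\<And>n. n \<ge> k2 \<Longrightarrow> norm (I n - (\<integral>x. \<psi> x \<partial>srb)) < \<epsilon>"
    using LIMSEQ_D[OF integral_srb_LIMSEQ[OF \<psi>] \<epsilon>] unfolding I_def by blast
  define k where "k = max k1 k2"
  define b where "b i = \<psi> (par ((G ^^ k) ((expanding_map m ^^ i) \<phi>, 0)))" for i
  have "\<bar>\<psi> ((F ^^ (i + k)) (par (\<phi>, y))) - b i\<bar> \<le> \<epsilon>" for i
  proof -
    have Q0: "(\<phi>, y) \<in> Q" using y by simp
    define z where "z = snd ((G ^^ i) (\<phi>, y))"
    have z: "(G ^^ i) (\<phi>, y) = ((expanding_map m ^^ i) \<phi>, z)"
      by (simp add: z_def prod_eq_iff fst_funpow_G)
    then have zQ: "((expanding_map m ^^ i) \<phi>, z) \<in> Q" using funpow_G_in[OF Q0, of i] by simp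
    let ?\<theta> = "(expanding_map m ^^ i) \<phi>"
    have "(F ^^ (i + k)) (par (\<phi>, y)) = par ((G ^^ k) (?\<theta>, z))"
      unfolding funpow_F_par[OF Q0] by (simp add: add.commute[of i k] funpow_add z)
    moreover have "par ((G ^^ k) (?\<theta>, z)) = par ((expanding_map m ^^ k) ?\<theta>, snd ((G ^^ k) (?\<theta>, z)))"
      "par ((G ^^ k) (?\<theta>, 0)) = par ((expanding_map m ^^ k) ?\<theta>, snd ((G ^^ k) (?\<theta>, 0)))"
      by (simp_all add: par_def fst_funpow_G)
    moreover have "dist (snd ((G ^^ k) (?\<theta>, z))) (snd ((G ^^ k) (?\<theta>, 0))) < \<delta>"
      using G_close[OF zQ, of 0 k] k1[of k] by (simp add: k_def)
    ultimately show ?thesis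
      using \<delta>(2)[of "snd ((G ^^ k) (?\<theta>, z))" "snd ((G ^^ k) (?\<theta>, 0))" "(expanding_map m ^^ k) ?\<theta>"]
        funpow_G_in[OF zQ, of k] funpow_G_in[of "(?\<theta>, 0)" k]
      by (simp add: b_def mem_Times_iff less_imp_le)
  qed
  moreover have "(\<lambda>n. (1 / real n) * (\<Sum>i<n. b i)) \<longlonglongrightarrow> I k"
    unfolding b_def I_def
    by (rule average_tendsto_of_char_equidistributed[OF \<phi>])
      (rule continuous_on_compose2[OF \<psi> continuous_iterate_origin], simp)
  moreover have "\<bar>I k - (\<integral>x. \<psi> x \<partial>srb)\<bar> \<le> \<epsilon>" using k2[of k] by (simp add: k_def)
  ultimately show "\<exists>k b J. (\<forall>i. \<bar>\<psi> ((F ^^ (i + k)) (par (\<phi>, y))) - b i\<bar> \<le> \<epsilon>) \<and>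
      (\<lambda>n. (1 / real n) * (\<Sum>i<n. b i)) \<longlonglongrightarrow> J \<and> \<bar>J - (\<integral>x. \<psi> x \<partial>srb)\<bar> \<le> \<epsilon>"
    by blast
qed

end

context fibre_contraction
begin

subsection \<open>Ergodicity\<close>
lemma measurable_funpow_F: "F ^^ n \<in> borel_measurable borel"
proof (induction n)
  case (Suc n)
  then show ?case using measurable_comp[OF Suc measurable_F] by (simp only: funpow.simps)
qed (simp add: id_def)

lemma measurable_srb_cong: "measurable srb N = measurable borel N"
  by (rule measurable_cong_sets) simp_all

lemma invariant_funpow: "distr srb borel (F ^^ n) = srb"
proof (induction n)
  case 0
  have "distr srb borel id = distr srb srb id" by (rule distr_cong) auto
  then show ?case by (simp add: id_def distr_id)
next
  case (Suc n)
  have "distr (distr srb borel (F ^^ n)) borel F = distr srb borel (F \<circ> F ^^ n)"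
    by (rule distr_distr) (simp_all add: measurable_srb_cong measurable_F measurable_funpow_F)
  then show ?case by (simp only: Suc invariant_srb funpow.simps)
qed

lemma emeasure_srb_funpow:
  assumes "W \<in> sets borel"
  shows "emeasure srb ((F ^^ n) -` W) = emeasure srb W"
proof -
  have "emeasure (distr srb borel (F ^^ n)) W = emeasure srb ((F ^^ n) -` W \<inter> space srb)"
    using assms by (intro emeasure_distr) (simp_all add: measurable_srb_cong measurable_funpow_F)
  then show ?thesis by (simp add: invariant_funpow)
qed

lemma integral_srb:
  fixes g :: "circle \<times> 'a \<Rightarrow> real"
  shows "g \<in> borel_measurable borel \<Longrightarrow> (\<integral>x. g x \<partial>srb) = (\<integral>q. g (limit_point q) \<partial>unit_square)"
  unfolding srb_def by (rule integral_distr[OF measurable_limit_point])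

lemma past_0: "past 0 q = abs_circle (fst q)"
  by (simp add: past_def)

lemma AE_limit_point_basin: "AE q in unit_square. limit_point q \<in> basin F srb"
proof -
  have "AE \<phi> in distr unit_square borel (past 0). char_equidistributed m \<phi>"
    unfolding distr_past by (rule AE_char_equidistributed[OF m])
  then have "AE q in unit_square. char_equidistributed m (past 0 q)"
    by (rule AE_distrD[OF measurable_past])
  then show ?thesis
    unfolding limit_point_def past_0[symmetric]
    by eventually_elim (rule par_in_basin[OF _ limit_fibre_in])
qed

text \<open>
  Almost every point is generic. If \<open>B\<close> is invariant, then the integral of a continuous \<open>\<psi>\<close> over \<open>B\<close> does
  not change when \<open>\<psi>\<close> is replaced by its time averages, and these tend to the constant \<open>\<integral>\<psi>\<close>. Hence \<open>B\<close>
  is independent of all continuous functions, therefore of all Borel sets and of itself.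
\<close>
lemma ergodic_srb: "ergodic_measure F srb"
  unfolding ergodic_measure_def
proof (intro conjI ballI impI invariant_measure_srb)
  interpret S: prob_space srb by (rule prob_space_srb)
  interpret U: prob_space unit_square by (rule prob_space_unit_square)
  fix B assume "B \<in> sets srb" and inv: "F -` B = B"
  then have B: "B \<in> sets borel" by simp
  define p where "p = measure srb B"
  have inv': "(F ^^ i) x \<in> B \<longleftrightarrow> x \<in> B" for i x
    using inv by (induction i) auto
  have correlation: "(\<integral>x. indicator B x * \<psi> x \<partial>srb) = p * (\<integral>x. \<psi> x \<partial>srb)"
    if \<psi>: "continuous_on UNIV \<psi>" for \<psi> :: "circle \<times> 'a \<Rightarrow> real"
  proof -
    obtain b where b: "\<And>x. \<bar>\<psi> x\<bar> \<le> b" by (rule bounded_of_continuous[OF \<psi>]) blast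
    have \<psi>m: "\<psi> \<in> borel_measurable borel" by (rule measurable_of_continuous[OF \<psi>])
    have fm: "(\<lambda>x. indicator B x * \<psi> ((F ^^ i) x)) \<in> borel_measurable borel" for i
      using B \<psi>m measurable_funpow_F[of i] by (intro borel_measurable_times measurable_compose[OF _ \<psi>m]) auto
    have gm: "(\<lambda>x. indicator B x * \<psi> x) \<in> borel_measurable borel"
      using fm[of 0] by simp
    have int: "integrable srb (\<lambda>x. indicator B x * \<psi> ((F ^^ i) x))" for i
    proof (rule S.integrable_const_bound[of _ b])
      show "AE x in srb. norm (indicator B x * \<psi> ((F ^^ i) x)) \<le> b"
        using b order_trans[OF abs_ge_zero b] by (auto simp: indicator_def intro!: AE_I2)
    qed (simp add: measurable_srb_cong fm)
    have same: "(\<integral>x. indicator B x * \<psi> ((F ^^ i) x) \<partial>srb) = (\<integral>x. indicator B x * \<psi> x \<partial>srb)" for i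
    proof -
      have "(\<integral>x. indicator B x * \<psi> x \<partial>distr srb borel (F ^^ i)) = (\<integral>x. indicator B ((F ^^ i) x) * \<psi> ((F ^^ i) x) \<partial>srb)"
        by (rule integral_distr) (simp_all add: measurable_srb_cong measurable_funpow_F gm)
      also have "(\<lambda>x. indicator B ((F ^^ i) x) * \<psi> ((F ^^ i) x)) = (\<lambda>x. indicator B x * \<psi> ((F ^^ i) x))"
        by (simp add: indicator_def inv' fun_eq_iff)
      finally show ?thesis by (simp only: invariant_funpow)
    qed
    define a where "a n x = (1 / real n) * (\<Sum>i<n. \<psi> ((F ^^ i) x))" for n x
    have am: "a n \<in> borel_measurable borel" for n
      unfolding a_def[abs_def]
      by (intro borel_measurable_times borel_measurable_sum borel_measurable_const measurable_compose[OF measurable_funpow_F \<psi>m])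
    have ab: "\<bar>a n x\<bar> \<le> b" for n x
    proof (cases "n = 0")
      case False
      have "\<bar>\<Sum>i<n. \<psi> ((F ^^ i) x)\<bar> \<le> (\<Sum>i<n. b)"
        by (rule order_trans[OF sum_abs]) (intro sum_mono b)
      then show ?thesis using False by (simp add: a_def abs_mult field_simps)
    qed (use order_trans[OF abs_ge_zero b] in \<open>simp add: a_def\<close>)
    have av: "(\<integral>x. indicator B x * a n x \<partial>srb) = (\<integral>x. indicator B x * \<psi> x \<partial>srb)" if "n > 0" for n
    proof -
      have "(\<lambda>x. indicator B x * a n x) = (\<lambda>x. (1 / real n) * (\<Sum>i<n. indicator B x * \<psi> ((F ^^ i) x)))"
      proof
        fix x
        show "indicator B x * a n x = (1 / real n) * (\<Sum>i<n. indicator B x * \<psi> ((F ^^ i) x))"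
          by (cases "x \<in> B") (simp_all add: a_def)
      qed
      then have "(\<integral>x. indicator B x * a n x \<partial>srb) = (1 / real n) * (\<Sum>i<n. (\<integral>x. indicator B x * \<psi> ((F ^^ i) x) \<partial>srb))"
        by (simp only: integral_mult_right_zero Bochner_Integration.integral_sum[OF int])
      then show ?thesis using that by (simp add: same)
    qed
    have iam: "(\<lambda>x. indicator B x * a n x) \<in> borel_measurable borel" for n
      using B by (intro borel_measurable_times am) auto
    have lim: "(\<lambda>n. \<integral>q. indicator B (limit_point q) * a n (limit_point q) \<partial>unit_square)
      \<longlonglongrightarrow> (\<integral>q. indicator B (limit_point q) * (\<integral>x. \<psi> x \<partial>srb) \<partial>unit_square)"
    proof (rule integral_dominated_convergence[where w = "\<lambda>_. b"])
      show "(\<lambda>q. indicator B (limit_point q) * a n (limit_point q)) \<in> borel_measurable unit_square" for n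
        by (rule measurable_compose[OF measurable_limit_point iam])
      show "(\<lambda>q. indicator B (limit_point q) * (\<integral>x. \<psi> x \<partial>srb)) \<in> borel_measurable unit_square"
        using B by (intro borel_measurable_times borel_measurable_const measurable_compose[OF measurable_limit_point]) auto
      show "AE q in unit_square. (\<lambda>n. indicator B (limit_point q) * a n (limit_point q))
        \<longlonglongrightarrow> indicator B (limit_point q) * (\<integral>x. \<psi> x \<partial>srb)"
        using AE_limit_point_basin
      proof eventually_elim
        case (elim q)
        then show ?case using \<psi> by (intro tendsto_mult tendsto_const) (auto simp: basin_def a_def)
      qed
      show "AE q in unit_square. norm (indicator B (limit_point q) * a n (limit_point q)) \<le> b" for n
        using ab order_trans[OF abs_ge_zero b] by (auto simp: indicator_def intro!: AE_I2)
    qed auto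
    have "(\<lambda>n. \<integral>x. indicator B x * a n x \<partial>srb) \<longlonglongrightarrow> (\<integral>x. indicator B x * (\<integral>x. \<psi> x \<partial>srb) \<partial>srb)"
    proof -
      have "(\<lambda>x. indicator B x * (\<integral>x. \<psi> x \<partial>srb)) \<in> borel_measurable borel"
        using B by (intro borel_measurable_times borel_measurable_const) auto
      then show ?thesis using lim by (simp only: integral_srb[OF iam] integral_srb[of "\<lambda>x. indicator B x * (\<integral>x. \<psi> x \<partial>srb)"])
    qed
    then have "(\<lambda>n. \<integral>x. indicator B x * a n x \<partial>srb) \<longlonglongrightarrow> p * (\<integral>x. \<psi> x \<partial>srb)"
      using B by (simp add: p_def)
    moreover have "(\<lambda>n. \<integral>x. indicator B x * a n x \<partial>srb) \<longlonglongrightarrow> (\<integral>x. indicator B x * \<psi> x \<partial>srb)"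
      by (rule Lim_transform_eventually[OF tendsto_const], rule eventually_mono[OF eventually_gt_at_top[of 0]]) (simp add: av)
    ultimately show ?thesis by (rule LIMSEQ_unique[rotated])
  qed
  have "density srb (\<lambda>x. ennreal (indicator B x)) = density srb (\<lambda>_. ennreal p)"
  proof (rule finite_measure_eqI_continuous[OF compact_X separating_map])
    show "finite_measure (density srb (\<lambda>x. ennreal (indicator B x)))"
      using B by (intro finite_measureI) (simp add: emeasure_density measurable_srb_cong ennreal_indicator)
    show "finite_measure (density srb (\<lambda>_. ennreal p))"
      by (intro finite_measureI) (simp add: emeasure_density ennreal_mult_eq_top_iff)
    fix \<psi> :: "circle \<times> 'a \<Rightarrow> real" assume \<psi>: "continuous_on UNIV \<psi>"
    have \<psi>m: "\<psi> \<in> borel_measurable srb" by (simp add: measurable_srb_cong measurable_of_continuous[OF \<psi>])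
    have "(\<integral>x. \<psi> x \<partial>density srb (\<lambda>x. ennreal (indicator B x))) = (\<integral>x. indicator B x * \<psi> x \<partial>srb)"
      using B by (intro integral_real_density \<psi>m) (auto simp: measurable_srb_cong)
    moreover have "(\<integral>x. \<psi> x \<partial>density srb (\<lambda>_. ennreal p)) = (\<integral>x. p * \<psi> x \<partial>srb)"
      by (intro integral_real_density \<psi>m) (auto simp: p_def)
    ultimately show "(\<integral>x. \<psi> x \<partial>density srb (\<lambda>x. ennreal (indicator B x))) = (\<integral>x. \<psi> x \<partial>density srb (\<lambda>_. ennreal p))"
      using correlation[OF \<psi>] by simp
  qed simp_all
  then have "emeasure (density srb (\<lambda>x. ennreal (indicator B x))) B = emeasure (density srb (\<lambda>_. ennreal p)) B"
    by simp
  moreover have "emeasure (density srb (\<lambda>x. ennreal (indicator B x))) B = ennreal p"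
    using B by (simp add: emeasure_density measurable_srb_cong ennreal_indicator p_def S.emeasure_eq_measure
        flip: indicator_inter_arith)
  moreover have "emeasure (density srb (\<lambda>_. ennreal p)) B = ennreal p * ennreal p"
    using B by (simp add: emeasure_density nn_integral_cmult_indicator p_def S.emeasure_eq_measure)
  ultimately have "ennreal p = ennreal (p * p)" by (simp add: ennreal_mult p_def)
  then have "p = p * p" by (simp add: p_def)
  then have "p = 0 \<or> p = 1" by simp
  then show "emeasure srb B = 0 \<or> emeasure srb B = 1" by (auto simp: p_def S.emeasure_eq_measure)
qed

subsection \<open>The maximal attractor\<close>

abbreviation D :: "(circle \<times> 'a) set" where "D \<equiv> UNIV \<times> param ` cball 0 2"

abbreviation attractor :: "(circle \<times> 'a) set" where "attractor \<equiv> maximal_attractor F D"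

lemma par_image: "par ` (UNIV \<times> S) = UNIV \<times> param ` S"
  by (auto simp: par_def image_iff)

lemma inj_on_par: "inj_on par Q"
proof (rule inj_onI)
  fix p q assume pq: "p \<in> Q" "q \<in> Q" "par p = par q"
  have "coord (param (snd p)) = snd p" "coord (param (snd q)) = snd q"
    using pq(1,2) by (intro coord_param; auto)+
  moreover have "fst p = fst q" "param (snd p) = param (snd q)" using pq(3) by (simp_all add: par_def)
  ultimately show "p = q" by (metis prod_eqI)
qed

lemma funpow_image_D: "(F ^^ n) ` D = par ` (G ^^ n) ` Q"
  unfolding par_image[symmetric] image_image using funpow_F_par by (intro image_cong) auto

lemma compact_D: "compact D"
  by (intro compact_Times compact_UNIV_circle compact_continuous_image continuous_param) simp

lemma continuous_funpow_F: "continuous_on S (F ^^ n)"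
proof (induction n)
  case (Suc n)
  then show ?case using continuous_on_F[OF Suc] by (simp add: o_def)
qed (simp add: continuous_on_id)

lemma compact_funpow_image_D: "compact ((F ^^ n) ` D)"
  by (intro compact_continuous_image continuous_funpow_F compact_D)

lemma closed_attractor: "closed attractor"
  unfolding maximal_attractor_def using compact_funpow_image_D by (intro closed_INT ballI compact_imp_closed)

lemma F_image_D: "F ` D \<subseteq> UNIV \<times> param ` ball 0 2"
proof
  fix p assume "p \<in> F ` D"
  then obtain \<phi> y where "p = F (\<phi>, param y)" "y \<in> cball 0 2" by blast
  then show "p \<in> UNIV \<times> param ` ball 0 2" using F_into[of y \<phi>] by (simp add: mem_Times_iff del: mem_cball_0)
qed

lemma F_image_D_subset: "F ` D \<subseteq> D"
proof -
  have "param ` ball 0 2 \<subseteq> param ` cball 0 2" by (intro image_mono) auto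
  then show ?thesis using F_image_D by fastforce
qed

lemma funpow_image_D_antimono:
  assumes "n \<le> k" shows "(F ^^ k) ` D \<subseteq> (F ^^ n) ` D"
proof -
  have "(F ^^ (n + j)) ` D \<subseteq> (F ^^ n) ` D" for j
  proof (induction j)
    case (Suc j)
    have "(F ^^ (n + Suc j)) ` D = (F ^^ (n + j)) ` F ` D" by (simp only: image_comp add_Suc_right funpow_Suc_right)
    also have "\<dots> \<subseteq> (F ^^ (n + j)) ` D" using F_image_D_subset by (rule image_mono)
    finally show ?case using Suc by blast
  qed simp
  then show ?thesis using assms by (metis le_Suc_ex)
qed

lemma trapping_D: "trapping F D"
  unfolding trapping_def
proof (intro conjI compact_D)
  have "open (UNIV \<times> param ` ball 0 2 :: (circle \<times> 'a) set)"
    by (intro open_Times open_UNIV open_param_ball)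
  moreover have "UNIV \<times> param ` ball 0 2 \<subseteq> D" by (intro Sigma_mono image_mono subset_refl) auto
  ultimately have "UNIV \<times> param ` ball 0 2 \<subseteq> interior D" by (intro interior_maximal)
  with F_image_D show "F ` D \<subseteq> interior D" by (rule subset_trans)
qed

lemma attractor_neq_UNIV: "attractor \<noteq> UNIV"
proof
  assume univ: "attractor = UNIV"
  obtain b :: 'v where b: "b \<in> Basis" using nonempty_Basis by blast
  have "(abs_circle 0, param (2 *\<^sub>R b)) \<in> (F ^^ 1) ` D"
    using univ unfolding maximal_attractor_def by blast
  then obtain z where z: "z \<in> ball 0 2" "param (2 *\<^sub>R b) = param z" using F_image_D by fastforce
  have "coord (param (2 *\<^sub>R b)) = 2 *\<^sub>R b" by (rule coord_param) (simp add: b)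
  moreover have "coord (param z) = z" using z(1) by (intro coord_param) auto
  ultimately have "z = 2 *\<^sub>R b" using z(2) by metis
  then have "norm z = 2" using b by simp
  then show False using z(1) by simp
qed

text \<open>
  A point \<open>p\<close> of the attractor is the image under \<open>F\<^sup>n\<close> of a point over some \<open>\<theta>\<close>. The whole fibre ball over
  \<open>\<theta>\<close>, and then over the base points near \<open>\<theta>\<close>, is mapped close to \<open>p\<close> if \<open>n\<close> is large. This serves to
  identify the support of the measure and to show that the images of a tube are dense in the
  attractor.
\<close>
lemma iterates_enter_neighbourhood:
  assumes "p \<in> attractor" "open W" "p \<in> W"
  obtains k where "\<And>n. n \<ge> k \<Longrightarrow> \<exists>J. open J \<and> J \<noteq> {} \<and> (\<forall>\<theta>\<in>J. \<forall>z\<in>cball 0 2. (F ^^ n) (par (\<theta>, z)) \<in> W)"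
proof -
  have "p \<in> (F ^^ 0) ` D" using assms(1) unfolding maximal_attractor_def by blast
  then have "p \<in> par ` Q" by (simp add: par_image)
  then obtain \<phi> y where y: "(\<phi>, y) \<in> Q" "p = par (\<phi>, y)" by auto
  obtain A where A: "open A" "A \<inter> Q = par -` W \<inter> Q"
    using continuous_par assms(2) unfolding continuous_on_open_invariant by blast
  then have "(\<phi>, y) \<in> A" using y assms(3) by blast
  with A(1) obtain J' V where JV: "open J'" "open V" "(\<phi>, y) \<in> J' \<times> V" "J' \<times> V \<subseteq> A"
    by (rule open_prod_elim)
  then obtain \<epsilon> where \<epsilon>: "\<epsilon> > 0" "ball y \<epsilon> \<subseteq> V" by (auto simp: open_contains_ball)
  obtain k where k: "\<And>n. n \<ge> k \<Longrightarrow> 4 * lam ^ n < \<epsilon> / 2" using lam_power_small[of "\<epsilon> / 2"] \<epsilon>(1) by auto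
  show ?thesis
  proof (rule that[of k])
    fix n assume n: "n \<ge> k"
    define J where "J = (\<lambda>\<theta>. (G ^^ n) (\<theta>, 0)) -` (J' \<times> ball y (\<epsilon> / 2))"
    have "continuous_on UNIV (\<lambda>\<theta>. (G ^^ n) (\<theta>, 0))"
      by (rule continuous_on_compose2[OF continuous_funpow_G]) (auto intro!: continuous_intros)
    then have "open J" unfolding J_def by (intro open_vimage open_Times JV(1)) auto
    moreover have "J \<noteq> {}"
    proof -
      have "p \<in> (F ^^ n) ` D" using assms(1) unfolding maximal_attractor_def by blast
      then obtain \<theta> z where z: "(\<theta>, z) \<in> Q" "p = par ((G ^^ n) (\<theta>, z))" unfolding funpow_image_D by auto
      have "par ((G ^^ n) (\<theta>, z)) = par (\<phi>, y)" using y(2) z(2) by (rule trans[OF sym, rotated])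
      then have eq: "(G ^^ n) (\<theta>, z) = (\<phi>, y)"
        by (rule inj_onD[OF inj_on_par _ funpow_G_in[OF z(1)] y(1)])
      have "dist (snd ((G ^^ n) (\<theta>, z))) (snd ((G ^^ n) (\<theta>, 0))) \<le> 4 * lam ^ n"
        using z(1) by (intro G_close) auto
      moreover have "fst ((G ^^ n) (\<theta>, 0)) = \<phi>" using eq by (metis fst_funpow_G fst_conv)
      ultimately have "\<theta> \<in> J" using eq k[OF n] JV(3) by (simp add: J_def mem_Times_iff)
      then show ?thesis by blast
    qed
    moreover have "(F ^^ n) (par (\<theta>, z)) \<in> W" if "\<theta> \<in> J" "z \<in> cball 0 2" for \<theta> z
    proof -
      have zQ: "(\<theta>, z) \<in> Q" using that by simp
      have "dist (snd ((G ^^ n) (\<theta>, z))) (snd ((G ^^ n) (\<theta>, 0))) < \<epsilon> / 2"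
        using G_close[OF zQ, of 0 n] k[OF n] by simp
      moreover have "dist y (snd ((G ^^ n) (\<theta>, 0))) < \<epsilon> / 2" using that(1) by (simp add: J_def mem_Times_iff)
      ultimately have "dist y (snd ((G ^^ n) (\<theta>, z))) < \<epsilon>" by (metis dist_triangle_half_l dist_commute)
      then have "snd ((G ^^ n) (\<theta>, z)) \<in> V" using \<epsilon>(2) by auto
      moreover have "fst ((G ^^ n) (\<theta>, z)) \<in> J'" using that(1) by (simp add: J_def mem_Times_iff fst_funpow_G)
      ultimately have "(G ^^ n) (\<theta>, z) \<in> A" using JV(4) by (metis mem_Times_iff subsetD)
      then have "(G ^^ n) (\<theta>, z) \<in> par -` W \<inter> Q"
        unfolding A(2)[symmetric] using funpow_G_in[OF zQ] by (rule IntI)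
      then show ?thesis unfolding funpow_F_par[OF zQ] by blast
    qed
    ultimately show "\<exists>J. open J \<and> J \<noteq> {} \<and> (\<forall>\<theta>\<in>J. \<forall>z\<in>cball 0 2. (F ^^ n) (par (\<theta>, z)) \<in> W)" by blast
  qed
qed

lemma emeasure_srb:
  assumes "W \<in> sets borel"
  shows "emeasure srb W = emeasure unit_square (limit_point -` W \<inter> space unit_square)"
  unfolding srb_def using assms by (intro emeasure_distr measurable_limit_point)

text \<open>
  The measure of a neighbourhood \<open>W\<close> of a point of the attractor equals that of its preimage under
  \<open>F\<^sup>n\<close>, which contains the fibre balls over an open set of base points.
\<close>
lemma support_srb: "measure_support srb = attractor"
proof (intro set_eqI iffI)
  fix p assume p: "p \<in> attractor"
  show "p \<in> measure_support srb"
    unfolding measure_support_def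
  proof (intro CollectI allI impI)
    fix W assume W: "open W \<and> p \<in> W"
    then obtain n J where J: "open J" "J \<noteq> {}" "\<And>\<theta> z. \<theta> \<in> J \<Longrightarrow> z \<in> cball 0 2 \<Longrightarrow> (F ^^ n) (par (\<theta>, z)) \<in> W"
      using iterates_enter_neighbourhood[OF p] by (metis order_refl)
    have Wn: "(F ^^ n) -` W \<in> sets borel" using measurable_sets[OF measurable_funpow_F, of W n] W by simp
    have "emeasure circle_lebesgue J = emeasure unit_square (past 0 -` J \<inter> space unit_square)"
      unfolding distr_past[of 0, symmetric] using J(1) by (intro emeasure_distr measurable_past) auto
    also have "\<dots> \<le> emeasure unit_square (limit_point -` ((F ^^ n) -` W) \<inter> space unit_square)"
      using J(3) limit_fibre_in measurable_sets[OF measurable_limit_point Wn]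
      by (intro emeasure_mono) (auto simp: past_0 limit_point_def simp del: mem_cball_0)
    also have "\<dots> = emeasure srb W" using W by (simp add: emeasure_srb[OF Wn, symmetric] emeasure_srb_funpow)
    finally show "emeasure srb W > 0" using emeasure_circle_lebesgue_pos[OF J(1,2)] by (metis order_less_le_trans)
  qed
next
  fix p assume p: "p \<in> measure_support srb"
  show "p \<in> attractor"
  proof (rule ccontr)
    assume "p \<notin> attractor"
    then obtain n where n: "p \<notin> (F ^^ n) ` D" unfolding maximal_attractor_def by blast
    define W where "W = - (F ^^ n) ` D"
    have W: "open W" unfolding W_def by (intro open_Compl compact_imp_closed compact_funpow_image_D)
    have Wn: "(F ^^ n) -` W \<in> sets borel" using measurable_sets[OF measurable_funpow_F, of W n] W by simp
    have "limit_point q \<in> D" for q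
      unfolding par_image[symmetric] limit_point_def by (intro imageI SigmaI UNIV_I limit_fibre_in)
    then have "limit_point -` ((F ^^ n) -` W) \<inter> space unit_square = {}" unfolding W_def by blast
    then have "emeasure srb W = 0"
      using emeasure_srb_funpow[of W n] emeasure_srb[OF Wn] W by simp
    moreover have "emeasure srb W > 0" using p W n unfolding measure_support_def W_def by blast
    ultimately show False by simp
  qed
qed

lemma open_param_image:
  assumes "open O'" "O' \<subseteq> ball 0 2"
  shows "open (param ` O')"
proof -
  have "param ` O' = param ` ball 0 2 \<inter> coord -` O'"
  proof (intro set_eqI iffI)
    fix x assume "x \<in> param ` O'"
    then obtain y where y: "x = param y" "y \<in> O'" by blast
    then have "y \<in> ball 0 2" using assms(2) by blast
    then show "x \<in> param ` ball 0 2 \<inter> coord -` O'" using y coord_param[of y] by simp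
  next
    fix x assume "x \<in> param ` ball 0 2 \<inter> coord -` O'"
    then obtain y where y: "x = param y" "y \<in> ball 0 2" "coord x \<in> O'" by blast
    then have "coord x = y" using coord_param[of y] by simp
    then show "x \<in> param ` O'" using y by blast
  qed
  moreover have "open (coord -` O')" using continuous_coord assms(1) by (simp add: continuous_on_open_vimage)
  ultimately show ?thesis using open_param_ball by auto
qed

text \<open>
  In the coordinates, lifted to the universal cover of the base, \<open>F\<close> becomes an injective
  continuous map between Euclidean domains of equal dimension, so invariance of domain shows that
  the forward images of open tubes are open.
\<close>

lemma open_funpow_image:
  assumes "open O'" "O' \<subseteq> ball 0 2"
  shows "open ((F ^^ n) ` (UNIV \<times> param ` O'))"
proof -
  define L where "L = (\<lambda>p :: real \<times> 'v. (real m * fst p, snd (G (abs_circle (fst p), snd p))))"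
  let ?R = "UNIV \<times> ball 0 2 :: (real \<times> 'v) set"
  let ?c = "\<lambda>p :: real \<times> 'v. (abs_circle (fst p), snd p)"
  have cL: "?c (L p) = G (?c p)" for p by (simp add: L_def G_def)
  have L_in: "L p \<in> ?R" if "p \<in> ?R" for p
    using G_ball[of "?c p"] that by (auto simp: L_def mem_Times_iff)
  have contL: "continuous_on ?R L"
  proof -
    have "continuous_on ?R (\<lambda>p. G (?c p))"
      by (rule continuous_on_compose2[OF continuous_G]) (auto intro!: continuous_intros)
    then show ?thesis unfolding L_def by (intro continuous_intros)
  qed
  have injL: "inj_on L ?R"
  proof (rule inj_onI)
    fix p q assume pq: "p \<in> ?R" "q \<in> ?R" "L p = L q"
    then have f: "fst p = fst q" using m by (simp add: L_def)
    have "?c p \<in> Q" "?c q \<in> Q" using pq by auto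
    have "G (?c p) = G (?c q)" using pq(3) by (simp flip: cL)
    then have "F (par (?c p)) = F (par (?c q))" using F_par \<open>?c p \<in> Q\<close> \<open>?c q \<in> Q\<close> by metis
    then have "param (snd p) = param (snd q)" using f F_inj by (simp add: par_def)
    moreover have "snd p \<in> cball 0 2" "snd q \<in> cball 0 2" using pq by (auto simp: mem_Times_iff)
    ultimately have "snd p = snd q" using coord_param by metis
    then show "p = q" using f by (simp add: prod_eq_iff)
  qed
  have openL: "open ((L ^^ n) ` (UNIV \<times> O')) \<and> (L ^^ n) ` (UNIV \<times> O') \<subseteq> ?R"
  proof (induction n)
    case 0
    then show ?case using assms by (auto intro!: open_Times)
  next
    case (Suc n)
    then have "open (L ` ((L ^^ n) ` (UNIV \<times> O')))"
      by (intro invariance_of_domain[where f = L] continuous_on_subset[OF contL] inj_on_subset[OF injL]) blast+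
    moreover have "L ` ((L ^^ n) ` (UNIV \<times> O')) \<subseteq> ?R" using Suc L_in by blast
    ultimately show ?case by (simp add: image_comp)
  qed
  have c_iter: "?c ((L ^^ n) p) = (G ^^ n) (?c p)" for p by (induction n) (simp_all only: funpow.simps o_apply cL id_apply)
  have eq: "(F ^^ n) ` (UNIV \<times> param ` O') = (\<lambda>p. par (?c p)) ` (L ^^ n) ` (UNIV \<times> O')"
  proof -
    have "UNIV \<times> param ` O' = (\<lambda>p. par (?c p)) ` (UNIV \<times> O')"
    proof -
      have "surj abs_circle" by (metis circle_cases surjI surj_def)
      then have "?c ` (UNIV \<times> O') = UNIV \<times> O'" by (force simp: image_iff surj_def)
      then show ?thesis by (metis par_image image_image)
    qed
    then have "(F ^^ n) ` (UNIV \<times> param ` O') = (\<lambda>p. (F ^^ n) (par (?c p))) ` (UNIV \<times> O')" by (simp only: image_image)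
    also have "\<dots> = (\<lambda>p. par (?c ((L ^^ n) p))) ` (UNIV \<times> O')"
    proof (rule image_cong[OF refl])
      fix p :: "real \<times> 'v" assume "p \<in> UNIV \<times> O'"
      then have "?c p \<in> Q" using assms(2) by auto
      then show "(F ^^ n) (par (?c p)) = par (?c ((L ^^ n) p))" by (simp only: funpow_F_par c_iter)
    qed
    finally show ?thesis by (simp only: image_image)
  qed
  have open_par: "open ((\<lambda>p. par (?c p)) ` O2)" if O2: "open O2" "O2 \<subseteq> ?R" for O2
    unfolding open_prod_def
  proof
    fix x assume "x \<in> (\<lambda>p. par (?c p)) ` O2"
    then obtain t y where ty: "(t, y) \<in> O2" "x = par (abs_circle t, y)" by auto
    obtain A B where AB: "open A" "open B" "(t, y) \<in> A \<times> B" "A \<times> B \<subseteq> O2" using O2(1) ty(1) by (rule open_prod_elim)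
    have "open (abs_circle ` A)" using AB by (intro open_map_abs_circle)
    moreover have "open (param ` (B \<inter> ball 0 2))" using AB by (intro open_param_image) auto
    moreover have "x \<in> abs_circle ` A \<times> param ` (B \<inter> ball 0 2)" using ty AB O2(2) by (auto simp: par_def)
    moreover have "abs_circle ` A \<times> param ` (B \<inter> ball 0 2) \<subseteq> (\<lambda>p. par (?c p)) ` O2"
    proof
      fix w assume "w \<in> abs_circle ` A \<times> param ` (B \<inter> ball 0 2)"
      then obtain s z where "w = par (?c (s, z))" "s \<in> A" "z \<in> B" by (auto simp: par_def)
      then show "w \<in> (\<lambda>p. par (?c p)) ` O2" using AB(4) by blast
    qed
    ultimately show "\<exists>A B. open A \<and> open B \<and> x \<in> A \<times> B \<and> A \<times> B \<subseteq> (\<lambda>p. par (?c p)) ` O2" by blast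
  qed
  show ?thesis unfolding eq using openL by (intro open_par) auto
qed

end

text \<open>
  In addition the tube \<open>V\<close> over the smaller ball of radius \<open>\<rho>\<close> is covered by its own image under some
  iterate. Its forward images then increase, consist of points of the attractor, and are open and
  connected.
\<close>
locale covering_fibre_contraction = fibre_contraction m F emb coord param lam
  for m and F :: "circle \<times> 'a::t2_space \<Rightarrow> circle \<times> 'a" and emb :: "'a \<Rightarrow> 'b::metric_space"
    and coord and param :: "'v::euclidean_space \<Rightarrow> 'a" and lam +
  fixes N :: nat and \<rho> :: real
  assumes N: "N \<ge> 1" and \<rho>: "0 < \<rho>" "\<rho> \<le> 2"
    and covering: "UNIV \<times> param ` ball 0 \<rho> \<subseteq> (F ^^ N) ` (UNIV \<times> param ` ball 0 \<rho>)"
begin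

abbreviation V :: "(circle \<times> 'a) set" where "V \<equiv> UNIV \<times> param ` ball 0 \<rho>"

lemma ball_\<rho>: "ball 0 \<rho> \<subseteq> ball (0 :: 'v) 2" "ball 0 \<rho> \<subseteq> cball (0 :: 'v) 2"
  using \<rho>(2) by auto

lemma V_subset_D: "V \<subseteq> D"
  using ball_\<rho> by (intro Sigma_mono image_mono subset_refl)

lemma covering_iterates: "V \<subseteq> (F ^^ (k * N)) ` V"
proof (induction k)
  case (Suc k)
  have "V \<subseteq> (F ^^ N) ` V" by (rule covering)
  also have "\<dots> \<subseteq> (F ^^ N) ` (F ^^ (k * N)) ` V" using Suc by (rule image_mono)
  also have "\<dots> = (F ^^ (Suc k * N)) ` V" by (simp add: image_comp funpow_add)
  finally show ?case .
qed simp

lemma covering_mono: "j \<le> k \<Longrightarrow> (F ^^ (j * N)) ` V \<subseteq> (F ^^ (k * N)) ` V"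
proof -
  assume "j \<le> k"
  then obtain i where k: "k = j + i" by (metis le_Suc_ex)
  have "(F ^^ (j * N)) ` V \<subseteq> (F ^^ (j * N)) ` (F ^^ (i * N)) ` V"
    by (intro image_mono covering_iterates)
  also have "\<dots> = (F ^^ (k * N)) ` V" by (simp add: k image_comp funpow_add add_mult_distrib)
  finally show ?thesis .
qed

lemma iterates_V_subset_attractor: "(F ^^ (j * N)) ` V \<subseteq> attractor"
proof -
  have "(F ^^ (j * N)) ` V \<subseteq> (F ^^ n) ` D" for n
  proof -
    have "(F ^^ (j * N)) ` V \<subseteq> (F ^^ ((j + n) * N)) ` V" by (rule covering_mono) simp
    also have "\<dots> \<subseteq> (F ^^ ((j + n) * N)) ` D" using V_subset_D by (rule image_mono)
    also have "\<dots> \<subseteq> (F ^^ n) ` D" using N by (intro funpow_image_D_antimono) (simp add: add_mult_distrib trans_le_add2)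
    finally show ?thesis .
  qed
  then show ?thesis unfolding maximal_attractor_def by blast
qed

text \<open>
  The tube meets every fibre ball, so its images come close to every point of the attractor.
\<close>
lemma attractor_eq_closure: "attractor = closure (\<Union>j. (F ^^ (j * N)) ` V)"
proof
  show "closure (\<Union>j. (F ^^ (j * N)) ` V) \<subseteq> attractor"
    using iterates_V_subset_attractor by (intro closure_minimal closed_attractor) blast
  show "attractor \<subseteq> closure (\<Union>j. (F ^^ (j * N)) ` V)"
  proof
    fix p assume p: "p \<in> attractor"
    show "p \<in> closure (\<Union>j. (F ^^ (j * N)) ` V)"
      unfolding closure_iff_nhds_not_empty
    proof (intro allI impI)
      fix A W assume W: "W \<subseteq> A" "open W" "p \<in> W"
      obtain k where k: "\<And>n. n \<ge> k \<Longrightarrow> \<exists>J. open J \<and> J \<noteq> {} \<and> (\<forall>\<theta>\<in>J. \<forall>z\<in>cball 0 2. (F ^^ n) (par (\<theta>, z)) \<in> W)"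
        by (rule iterates_enter_neighbourhood[OF p W(2,3)]) blast
      have "k * N \<ge> k" using N by simp
      then obtain \<theta> where \<theta>: "\<And>z. z \<in> cball 0 2 \<Longrightarrow> (F ^^ (k * N)) (par (\<theta>, z)) \<in> W" using k by blast
      then have "(F ^^ (k * N)) (par (\<theta>, 0)) \<in> W" by simp
      with W(1) have "(F ^^ (k * N)) (par (\<theta>, 0)) \<in> A" by (rule subsetD)
      moreover have "par (\<theta>, 0) \<in> V" using \<rho>(1) by (simp add: par_def)
      then have "(F ^^ (k * N)) (par (\<theta>, 0)) \<in> (\<Union>j. (F ^^ (j * N)) ` V)"
        by (intro UN_I[of k] UNIV_I imageI)
      ultimately show "(\<Union>j. (F ^^ (j * N)) ` V) \<inter> A \<noteq> {}" by (metis IntI emptyE)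
    qed
  qed
qed

lemma region_attractor: "region attractor"
  unfolding region_def
proof (intro exI conjI)
  show "attractor = closure (\<Union>j. (F ^^ (j * N)) ` V)" by (rule attractor_eq_closure)
  show "open (\<Union>j. (F ^^ (j * N)) ` V)"
    by (intro open_UN ballI open_funpow_image ball_\<rho>) simp
  have "V \<noteq> {}" using \<rho>(1) by simp
  then show "(\<Union>j. (F ^^ (j * N)) ` V) \<noteq> {}" by blast
  have conn: "connected V"
    using connected_UNIV_circle continuous_on_subset[OF continuous_param ball_\<rho>(2)]
    by (intro connected_Times connected_continuous_image connected_ball)
  show "connected (\<Union>j. (F ^^ (j * N)) ` V)"
  proof (rule connected_Union)
    show "connected S" if "S \<in> range (\<lambda>j. (F ^^ (j * N)) ` V)" for S
      using that conn by (auto intro!: connected_continuous_image continuous_funpow_F)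
    show "\<Inter> (range (\<lambda>j. (F ^^ (j * N)) ` V)) \<noteq> {}"
      using covering_iterates \<open>V \<noteq> {}\<close> by blast
  qed
qed

lemma region_D: "region D"
  unfolding region_def
proof (intro exI conjI)
  let ?B = "UNIV \<times> param ` ball 0 2 :: (circle \<times> 'a) set"
  show "open ?B" by (intro open_Times open_UNIV open_param_ball)
  show "connected ?B"
    using connected_UNIV_circle continuous_on_subset[OF continuous_param, of "ball 0 2"]
    by (intro connected_Times connected_continuous_image connected_ball) auto
  show "?B \<noteq> {}" by simp
  have "param ` cball 0 2 = closure (param ` ball 0 2)"
  proof
    have "param ` closure (ball 0 2) \<subseteq> closure (param ` ball 0 2)"
      using continuous_param by (intro image_closure_subset[OF _ closed_closure closure_subset]) simp
    then show "param ` cball 0 2 \<subseteq> closure (param ` ball 0 2)" by simp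
    have "closed (param ` cball 0 2)"
      by (intro compact_imp_closed compact_continuous_image continuous_param) simp
    then show "closure (param ` ball 0 2) \<subseteq> param ` cball 0 2"
      by (intro closure_minimal image_mono) auto
  qed
  then show "D = closure ?B" by (simp add: closure_Times)
qed

text \<open>
  The basin contains the fibre balls over all base points with equidistributed orbits, so it fills
  the trapping region up to the product of a null set of the circle with the fibre.
\<close>
lemma massive_attractor:
  assumes vol: "sigma_finite_measure vol" "sets vol = sets borel" "emeasure vol (param ` ball 0 2) > 0"
  shows "massive_attractor (circle_lebesgue \<Otimes>\<^sub>M vol) F attractor"
proof -
  interpret vol: sigma_finite_measure vol by (rule vol(1))
  have "AE \<phi> in circle_lebesgue. char_equidistributed m \<phi>" by (rule AE_char_equidistributed[OF m])
  then obtain Z where Z: "{\<phi> \<in> space circle_lebesgue. \<not> char_equidistributed m \<phi>} \<subseteq> Z"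
    "emeasure circle_lebesgue Z = 0" "Z \<in> sets circle_lebesgue" by (rule AE_E)
  have in_basin: "x \<in> basin F srb" if "x \<in> D" "fst x \<notin> Z" for x
  proof -
    have "x \<in> par ` Q" using that(1) by (simp only: par_image)
    then obtain \<phi> y where y: "x = par (\<phi>, y)" "y \<in> cball 0 2" by auto
    then have "char_equidistributed m \<phi>" using that(2) Z(1) by (auto simp: par_def)
    then show ?thesis using y par_in_basin by blast
  qed
  have space_vol: "space vol = UNIV" using sets_eq_imp_space_eq[OF vol(2)] by simp
  let ?L = "circle_lebesgue \<Otimes>\<^sub>M vol"
  have "AE x in ?L. x \<in> D \<longrightarrow> x \<in> basin F srb"
  proof (rule AE_I)
    show "{x \<in> space ?L. \<not> (x \<in> D \<longrightarrow> x \<in> basin F srb)} \<subseteq> Z \<times> UNIV"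
    proof
      fix x assume "x \<in> {x \<in> space ?L. \<not> (x \<in> D \<longrightarrow> x \<in> basin F srb)}"
      then have "fst x \<in> Z" using in_basin[of x] by blast
      then show "x \<in> Z \<times> UNIV" by (simp add: mem_Times_iff)
    qed
    show "Z \<times> UNIV \<in> sets ?L" using Z(3) space_vol by (metis pair_measureI sets.top)
    show "emeasure ?L (Z \<times> UNIV) = 0"
      using Z(2,3) space_vol by (subst vol.emeasure_pair_measure_Times) (auto, metis sets.top)
  qed
  moreover have "SRB_measure ?L F srb"
    unfolding SRB_measure_def
  proof (intro conjI invariant_measure_srb bexI)
    interpret C: prob_space circle_lebesgue by (rule prob_space_circle_lebesgue)
    let ?E = "(- Z) \<times> param ` ball 0 2"
    have mZ: "- Z \<in> sets circle_lebesgue" using sets.compl_sets[OF Z(3)] by (simp add: Compl_eq_Diff_UNIV)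
    have mB: "param ` ball 0 2 \<in> sets vol" using open_param_ball vol(2) by simp
    show "?E \<in> sets ?L" using mZ mB by (rule pair_measureI)
    have "emeasure circle_lebesgue (- Z) = 1"
      using emeasure_compl[OF Z(3)] Z(2) C.emeasure_space_1 by (simp add: Compl_eq_Diff_UNIV)
    then show "emeasure ?L ?E > 0"
      using vol(3) by (simp add: vol.emeasure_pair_measure_Times[OF mZ mB])
    show "?E \<subseteq> basin F srb"
    proof
      fix x assume "x \<in> ?E"
      then have "fst x \<notin> Z" "snd x \<in> param ` ball 0 2" by (simp_all only: mem_Times_iff Compl_iff simp_thms)
      moreover have "param ` ball 0 2 \<subseteq> param ` cball 0 2" by (intro image_mono) auto
      ultimately have "snd x \<in> param ` cball 0 2" by (metis subsetD)
      then have "x \<in> D" by (simp only: mem_Times_iff UNIV_I simp_thms)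
      then show "x \<in> basin F srb" using \<open>fst x \<notin> Z\<close> by (rule in_basin)
    qed
  qed
  ultimately show ?thesis
    unfolding massive_attractor_def
    using attractor_neq_UNIV region_D trapping_D region_attractor ergodic_srb support_srb by blast
qed

end

section \<open>Continuously differentiable maps\<close>

text \<open>
  A local form of being continuously differentiable; unlike \<open>C_on\<close> it carries the derivative as a
  continuous map into the bounded linear operators, which is what the chain rule and the inverse
  function theorem work with.
\<close>

definition C1_near :: "('v::real_normed_vector \<Rightarrow> 'w::real_normed_vector) \<Rightarrow> 'v \<Rightarrow> bool" where
  "C1_near f x \<longleftrightarrow> (\<exists>S f'. open S \<and> x \<in> S \<and>
     (\<forall>y\<in>S. (f has_derivative blinfun_apply (f' y)) (at y)) \<and> continuous_on S f')"

lemma C1_nearE: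
  assumes "C1_near f x"
  obtains S f' where "open S" "x \<in> S" "\<And>y. y \<in> S \<Longrightarrow> (f has_derivative blinfun_apply (f' y)) (at y)"
    "continuous_on S f'"
  using assms unfolding C1_near_def by (elim exE conjE) (rule that, auto)

lemma C1_near_blinfunI:
  assumes "open S" "x \<in> S" "\<And>y. y \<in> S \<Longrightarrow> (f has_derivative blinfun_apply (f' y)) (at y)"
    "continuous_on S f'"
  shows "C1_near f x"
  unfolding C1_near_def by (intro exI[of _ S] exI[of _ f'] conjI ballI assms)

lemma C1_nearI:
  fixes f :: "'v::euclidean_space \<Rightarrow> 'w::real_normed_vector"
  assumes "open S" "x \<in> S" and der: "\<And>y. y \<in> S \<Longrightarrow> (f has_derivative D y) (at y)"
    and cont: "\<And>v. continuous_on S (\<lambda>y. D y v)"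
  shows "C1_near f x"
  unfolding C1_near_def
proof (intro exI conjI ballI)
  have bl: "bounded_linear (D y)" if "y \<in> S" for y using der[OF that] by (rule has_derivative_bounded_linear)
  show "(f has_derivative blinfun_apply (Blinfun (D y))) (at y)" if "y \<in> S" for y
    using der[OF that] bl[OF that] by (simp add: bounded_linear_Blinfun_apply)
  show "continuous_on S (\<lambda>y. Blinfun (D y))"
  proof (rule continuous_on_blinfun_componentwise)
    fix i
    show "continuous_on S (\<lambda>y. blinfun_apply (Blinfun (D y)) i)"
      by (rule continuous_on_eq[OF cont[of i]]) (simp add: bounded_linear_Blinfun_apply bl)
  qed
qed fact+

lemma C_on_1_iff:
  fixes f :: "'v::euclidean_space \<Rightarrow> 'w::real_normed_vector"
  assumes "open S"
  shows "C_on 1 S f \<longleftrightarrow> (\<forall>x\<in>S. C1_near f x)"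
proof
  assume C: "C_on 1 S f"
  have "(f has_derivative frechet_derivative f (at y)) (at y)" if "y \<in> S" for y
    using C that by (simp flip: frechet_derivative_works)
  then show "\<forall>x\<in>S. C1_near f x"
    using C assms by (intro ballI C1_nearI[of S _ f "\<lambda>y. frechet_derivative f (at y)"]) auto
next
  assume N: "\<forall>x\<in>S. C1_near f x"
  have "isCont (\<lambda>y. frechet_derivative f (at y) v) x" "f differentiable (at x)" if x: "x \<in> S" for x v
  proof -
    obtain T f' where T: "open T" "x \<in> T" "\<And>y. y \<in> T \<Longrightarrow> (f has_derivative blinfun_apply (f' y)) (at y)"
      "continuous_on T f'" using N x by (metis C1_nearE)
    have "continuous_on T (\<lambda>y. f' y v)" using T(4) by (intro continuous_intros)
    then have "isCont (\<lambda>y. f' y v) x" using T(1,2) by (simp add: continuous_on_eq_continuous_at)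
    moreover have "\<forall>\<^sub>F y in nhds x. f' y v = frechet_derivative f (at y) v"
      using frechet_derivative_at[OF T(3)] by (intro eventually_nhds[THEN iffD2] exI[of _ T] conjI T(1,2) ballI) metis
    ultimately show "isCont (\<lambda>y. frechet_derivative f (at y) v) x" by (simp add: isCont_cong)
    show "f differentiable (at x)" using T(3)[OF T(2)] unfolding differentiable_def by blast
  qed
  then show "C_on 1 S f" using assms by (simp add: continuous_on_eq_continuous_at)
qed

lemma smooth_on_imp_C1_near:
  fixes f :: "'v::euclidean_space \<Rightarrow> 'w::real_normed_vector"
  assumes "smooth_on S f" "open S" "x \<in> S"
  shows "C1_near f x"
  using assms C_on_1_iff[OF assms(2), of f] unfolding smooth_on_def by blast

lemma C1_near_has_derivative:
  "C1_near f x \<Longrightarrow> (f has_derivative frechet_derivative f (at x)) (at x)"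
  unfolding C1_near_def using frechet_derivative_at by metis

lemma C1_near_isCont: "C1_near f x \<Longrightarrow> isCont f x"
  using C1_near_has_derivative has_derivative_continuous by blast

lemma C1_near_compose:
  fixes f :: "'u::real_normed_vector \<Rightarrow> 'v::real_normed_vector" and g :: "'v \<Rightarrow> 'w::real_normed_vector"
  assumes "C1_near f x" "C1_near g (f x)"
  shows "C1_near (g \<circ> f) x"
proof -
  obtain S f' where S: "open S" "x \<in> S" "\<And>y. y \<in> S \<Longrightarrow> (f has_derivative blinfun_apply (f' y)) (at y)"
    "continuous_on S f'" by (rule C1_nearE[OF assms(1)]) (rule that)
  obtain T g' where T: "open T" "f x \<in> T" "\<And>y. y \<in> T \<Longrightarrow> (g has_derivative blinfun_apply (g' y)) (at y)"
    "continuous_on T g'" by (rule C1_nearE[OF assms(2)]) (rule that)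
  have contf: "continuous_on S f"
    using S(3) has_derivative_continuous S(1) by (metis continuous_on_eq_continuous_at)
  define R where "R = S \<inter> f -` T"
  have R: "open R" unfolding R_def using contf S(1) T(1) by (simp add: continuous_on_open_vimage Int_commute)
  have "((g \<circ> f) has_derivative blinfun_apply (g' (f y) o\<^sub>L f' y)) (at y)" if "y \<in> R" for y
  proof -
    have "((g \<circ> f) has_derivative (blinfun_apply (g' (f y)) \<circ> blinfun_apply (f' y))) (at y)"
      using that unfolding R_def by (intro diff_chain_at S T) auto
    moreover have "blinfun_apply (g' (f y) o\<^sub>L f' y) = blinfun_apply (g' (f y)) \<circ> blinfun_apply (f' y)"
      by (rule ext) simp
    ultimately show ?thesis by (simp only:)
  qed
  moreover have "continuous_on R (\<lambda>y. g' (f y) o\<^sub>L f' y)"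
    unfolding R_def
    by (intro bounded_bilinear.continuous_on[OF bounded_bilinear_blinfun_compose]
        continuous_on_compose2[OF T(4)] continuous_on_subset[OF contf] continuous_on_subset[OF S(4)]) auto
  moreover have "x \<in> R" using S(2) T(2) by (simp add: R_def)
  ultimately show ?thesis using R by (intro C1_near_blinfunI[of R x "g \<circ> f" "\<lambda>y. g' (f y) o\<^sub>L f' y"])
qed

lemma C1_near_transform:
  assumes "C1_near f x" "open S" "x \<in> S" "\<And>y. y \<in> S \<Longrightarrow> f y = g y"
  shows "C1_near g x"
proof -
  obtain T f' where T: "open T" "x \<in> T" "\<And>y. y \<in> T \<Longrightarrow> (f has_derivative blinfun_apply (f' y)) (at y)"
    "continuous_on T f'" by (rule C1_nearE[OF assms(1)]) (rule that)
  have "(g has_derivative blinfun_apply (f' y)) (at y)" if "y \<in> S \<inter> T" for y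
    using that assms by (intro has_derivative_transform_within_open[OF T(3), of y S]) auto
  then show ?thesis
    using T(1,2) assms(2,3) continuous_on_subset[OF T(4), of "S \<inter> T"]
    by (intro C1_near_blinfunI[of "S \<inter> T" x g f']) auto
qed

lemma C1_near_bounded_linear:
  assumes "bounded_linear f" shows "C1_near f x"
  by (rule C1_near_blinfunI[OF open_UNIV UNIV_I, of _ "\<lambda>_. Blinfun f"])
    (use assms in \<open>auto simp: bounded_linear_Blinfun_apply intro: bounded_linear_imp_has_derivative\<close>)

lemma C1_near_affine:
  assumes "bounded_linear f" shows "C1_near (\<lambda>x. f x - c) x"
  by (rule C1_near_blinfunI[OF open_UNIV UNIV_I, of _ "\<lambda>_. Blinfun f"])
    (use assms in \<open>auto simp: bounded_linear_Blinfun_apply intro!: derivative_eq_intros bounded_linear_imp_has_derivative\<close>)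

text \<open>
  Pointwise inverses of a continuous family of invertible operators depend continuously on the
  parameter: if \<open>A y u = v\<close> and \<open>A y0 u0 = v\<close> then \<open>A y0 (u - u0) = (A y0 - A y) u\<close>.
\<close>

lemma continuous_on_inv_blinfun:
  fixes A :: "'p::metric_space \<Rightarrow> 'v::euclidean_space \<Rightarrow>\<^sub>L 'v"
  assumes cont: "continuous_on S A" and bij: "\<And>y. y \<in> S \<Longrightarrow> bij (blinfun_apply (A y))"
  shows "continuous_on S (\<lambda>y. inv (blinfun_apply (A y)) v)"
  unfolding continuous_on_iff
proof (intro ballI allI impI)
  fix y0 and e :: real assume y0: "y0 \<in> S" and e: "0 < e"
  define u where "u y = inv (blinfun_apply (A y)) v" for y
  have Au: "A y (u y) = v" if "y \<in> S" for y
    using bij[OF that] by (simp add: u_def bij_is_surj surj_f_inv_f)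
  have "linear (inv (blinfun_apply (A y0)))"
    using bij[OF y0]
    by (intro inj_linear_imp_inv_linear bounded_linear.linear[OF blinfun.bounded_linear_right] bij_is_inj)
  then obtain K where K: "K > 0" "\<And>w. norm (inv (blinfun_apply (A y0)) w) \<le> K * norm w"
    by (metis linear_bounded_pos)
  have K': "norm w \<le> K * norm (A y0 w)" for w
    using K(2)[of "A y0 w"] bij[OF y0] by (simp add: bij_is_inj)
  define \<epsilon> where "\<epsilon> = min (1 / (2 * K)) (e / (4 * K * (norm (u y0) + 1)))"
  have nu: "norm (u y0) + 1 > 0" by (simp add: add_nonneg_pos)
  then have \<epsilon>: "\<epsilon> > 0" using K(1) e by (simp add: \<epsilon>_def)
  then obtain d where d: "d > 0" "\<And>y. y \<in> S \<Longrightarrow> dist y y0 < d \<Longrightarrow> dist (A y) (A y0) < \<epsilon>"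
    using cont y0 unfolding continuous_on_iff by metis
  have "dist (u y) (u y0) < e" if y: "y \<in> S" "dist y y0 < d" for y
  proof -
    let ?z = "u y - u y0"
    have "A y0 ?z = (A y0 - A y) (u y)"
      using Au[OF y(1)] Au[OF y0] by (simp add: blinfun.diff_right blinfun.diff_left)
    then have "norm ?z \<le> K * norm ((A y0 - A y) (u y))" using K'[of ?z] by simp
    also have "\<dots> \<le> K * (\<epsilon> * norm (u y))"
    proof -
      have "norm (A y0 - A y) \<le> \<epsilon>" using d(2)[OF y] by (simp add: dist_norm norm_minus_commute)
      then have "norm ((A y0 - A y) (u y)) \<le> \<epsilon> * norm (u y)"
        by (meson norm_blinfun mult_right_mono norm_ge_zero order_trans)
      then show ?thesis using K(1) by (intro mult_left_mono) auto
    qed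
    also have "\<dots> \<le> K * \<epsilon> * (norm (u y0) + norm ?z)"
    proof -
      have "norm (u y) \<le> norm (u y0) + norm ?z" by (metis norm_triangle_sub)
      then show ?thesis using K(1) \<epsilon> by (simp add: mult.assoc)
    qed
    finally have 1: "norm ?z \<le> K * \<epsilon> * norm (u y0) + K * \<epsilon> * norm ?z" by (simp add: algebra_simps)
    have "K * \<epsilon> \<le> K * (1 / (2 * K))" unfolding \<epsilon>_def using K(1) by (intro mult_left_mono) auto
    then have "K * \<epsilon> \<le> 1 / 2" using K(1) by simp
    then have "K * \<epsilon> * norm ?z \<le> 1 / 2 * norm ?z" by (intro mult_right_mono) auto
    then have "norm ?z \<le> 2 * (K * \<epsilon> * norm (u y0))" using 1 by simp
    also have "\<dots> \<le> 2 * (K * \<epsilon> * (norm (u y0) + 1))" using K(1) \<epsilon> by (intro mult_left_mono) auto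
    also have "\<dots> \<le> 2 * (K * (e / (4 * K * (norm (u y0) + 1))) * (norm (u y0) + 1))"
      unfolding \<epsilon>_def using K(1) nu by (intro mult_left_mono mult_right_mono) auto
    also have "\<dots> = e / 2"
    proof -
      have "2 * (K * (e / (4 * K * n)) * n) = e / 2" if "n > 0" for n
        using K(1) that by (simp add: field_simps)
      from this[OF nu] show ?thesis .
    qed
    finally show ?thesis using e by (simp add: dist_norm)
  qed
  then show "\<exists>d>0. \<forall>y\<in>S. dist y y0 < d \<longrightarrow>
      dist (inv (blinfun_apply (A y)) v) (inv (blinfun_apply (A y0)) v) < e"
    using d(1) unfolding u_def by blast
qed

text \<open>
  The inverse function theorem, complemented by the continuity of the derivative of the inverse.
\<close>
lemma C1_local_inverse:
  fixes f :: "'v::euclidean_space \<Rightarrow> 'v"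
  assumes f: "C1_near f x0" and inj: "inj (frechet_derivative f (at x0))" and "open R" "x0 \<in> R"
  obtains U V g where "open U" "U \<subseteq> R" "x0 \<in> U" "open V" "f x0 \<in> V" "homeomorphism U V f g"
    "\<And>y. y \<in> V \<Longrightarrow> C1_near g y"
proof -
  obtain S f' where S: "open S" "x0 \<in> S" "\<And>y. y \<in> S \<Longrightarrow> (f has_derivative blinfun_apply (f' y)) (at y)"
    "continuous_on S f'" by (rule C1_nearE[OF f]) (rule that)
  have "frechet_derivative f (at x0) = blinfun_apply (f' x0)"
    using frechet_derivative_at[OF S(3)[OF S(2)]] by simp
  then have "inj (blinfun_apply (f' x0))" using inj by simp
  then obtain h where h: "linear h" "h \<circ> blinfun_apply (f' x0) = id"
    using linear_injective_left_inverse[OF bounded_linear.linear[OF blinfun.bounded_linear_right]] by blast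
  then have "bounded_linear h" by (simp add: linear_conv_bounded_linear)
  then have "Blinfun h o\<^sub>L f' x0 = id_blinfun"
    using h(2) by (intro blinfun_eqI) (simp add: bounded_linear_Blinfun_apply fun_eq_iff)
  moreover have "continuous_on (S \<inter> R) f'" by (rule continuous_on_subset[OF S(4)]) simp
  ultimately obtain U V g g' where UV: "open U" "U \<subseteq> S \<inter> R" "x0 \<in> U" "open V" "f x0 \<in> V" "homeomorphism U V f g"
       "\<And>y. y \<in> V \<Longrightarrow> (g has_derivative (g' y)) (at y)"
       "\<And>y. y \<in> V \<Longrightarrow> g' y = inv (blinfun_apply (f' (g y)))"
       "\<And>y. y \<in> V \<Longrightarrow> bij (blinfun_apply (f' (g y)))"
    using inverse_function_theorem[of "S \<inter> R" f f' x0 "Blinfun h"] S assms(3,4) by (metis IntD1 IntI open_Int)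
  have gV: "continuous_on V g" "g ` V \<subseteq> S" using UV(2,6) by (auto simp: homeomorphism_def)
  have "continuous_on V (\<lambda>y. f' (g y))"
    by (rule continuous_on_compose2[OF S(4) gV])
  then have "continuous_on V (\<lambda>y. inv (blinfun_apply (f' (g y))) v)" for v
    using UV(9) by (rule continuous_on_inv_blinfun)
  then have "C1_near g y" if "y \<in> V" for y
    using UV(7,8) UV(4) that by (intro C1_nearI[of V y g "\<lambda>y. inv (blinfun_apply (f' (g y)))"]) auto
  then show ?thesis using that[of U V g] UV by blast
qed

section \<open>A compactly supported perturbation of the identity\<close>

text \<open>
  The simplest continuously differentiable function that vanishes exactly on a half-line.
\<close>
definition pos_square :: "real \<Rightarrow> real" where
  "pos_square s = (max 0 s)\<^sup>2"

lemma has_derivative_pos_square: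
  "(pos_square has_real_derivative 2 * max 0 s) (at s)"
proof (cases s "0 :: real" rule: linorder_cases)
  case less
  have "((\<lambda>_. 0) has_real_derivative 2 * max 0 s) (at s)" using less by simp
  then show ?thesis
    by (rule DERIV_cong_ev[THEN iffD1, rotated 3])
       (use less in \<open>auto simp: pos_square_def max_def eventually_nhds intro!: exI[of _ "{..<0}"]\<close>)
next
  case greater
  have "((\<lambda>s. s\<^sup>2) has_real_derivative 2 * max 0 s) (at s)"
    using greater by (auto intro!: derivative_eq_intros)
  then show ?thesis
    by (rule DERIV_cong_ev[THEN iffD1, rotated 3])
       (use greater in \<open>auto simp: pos_square_def max_def eventually_nhds intro!: exI[of _ "{0<..}"]\<close>)
next
  case equal
  have "(\<lambda>h. (pos_square (0 + h) - pos_square 0) / h) \<midarrow>0\<rightarrow> 0"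
  proof (rule Lim_null_comparison)
    show "\<forall>\<^sub>F h in at 0. norm ((pos_square (0 + h) - pos_square 0) / h) \<le> \<bar>h\<bar>"
      by (rule always_eventually) (auto simp: pos_square_def max_def power2_eq_square)
    show "(\<lambda>h::real. \<bar>h\<bar>) \<midarrow>0\<rightarrow> 0" by (rule tendsto_rabs_zero) (rule tendsto_ident_at)
  qed
  then show ?thesis using equal by (simp add: DERIV_def)
qed

lemma continuous_pos_square: "continuous_on S pos_square"
  by (intro continuous_at_imp_continuous_on ballI DERIV_isCont[OF has_derivative_pos_square])

text \<open>
  A continuously differentiable cutoff, equal to 1 for \<open>norm y \<le> 2\<close> and to 0 for \<open>norm y \<ge> 3\<close>. For
  \<open>norm y \<le> 2\<close> one has \<open>9 - y \<bullet> y \<ge> 5\<close>, whence the normalisation by \<open>25 = 5\<^sup>2\<close>.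
\<close>
definition cutoff :: "'v::euclidean_space \<Rightarrow> real" where
  "cutoff y = 1 - pos_square (1 - pos_square (9 - y \<bullet> y) / 25)"

definition cutoff_deriv :: "'v::euclidean_space \<Rightarrow> 'v \<Rightarrow> real" where
  "cutoff_deriv y w = - (8 / 25) * max 0 (1 - pos_square (9 - y \<bullet> y) / 25) * max 0 (9 - y \<bullet> y) * (y \<bullet> w)"

lemma inner_self_le: "norm (y :: 'v::euclidean_space) \<le> r \<Longrightarrow> y \<bullet> y \<le> r\<^sup>2"
  by (simp add: power2_norm_eq_inner[symmetric] power_mono)

lemma inner_self_ge: "0 \<le> r \<Longrightarrow> r \<le> norm (y :: 'v::euclidean_space) \<Longrightarrow> r\<^sup>2 \<le> y \<bullet> y"
  by (simp add: power2_norm_eq_inner[symmetric] power_mono)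

lemma cutoff_eq_1: "norm y \<le> 2 \<Longrightarrow> cutoff y = 1"
proof -
  assume "norm y \<le> 2"
  then have "9 - y \<bullet> y \<ge> 5" using inner_self_le[of y 2] by simp
  then have "pos_square (9 - y \<bullet> y) \<ge> 5\<^sup>2" unfolding pos_square_def by (intro power_mono) auto
  then show ?thesis by (simp add: cutoff_def pos_square_def max_def)
qed

lemma cutoff_eq_0: "norm y \<ge> 3 \<Longrightarrow> cutoff y = 0"
  using inner_self_ge[of 3 y] by (simp add: cutoff_def pos_square_def max_def)

lemma cutoff_bounds: "0 \<le> cutoff y" "cutoff y \<le> 1"
proof -
  have "0 \<le> pos_square (9 - y \<bullet> y) / 25" by (simp add: pos_square_def)
  then have "max 0 (1 - pos_square (9 - y \<bullet> y) / 25) \<le> 1" by simp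
  then have "pos_square (1 - pos_square (9 - y \<bullet> y) / 25) \<le> 1\<^sup>2"
    unfolding pos_square_def[of "1 - _"] by (intro power_mono) auto
  then show "0 \<le> cutoff y" by (simp add: cutoff_def)
  show "cutoff y \<le> 1" by (simp add: cutoff_def pos_square_def)
qed

lemma has_derivative_cutoff: "(cutoff has_derivative cutoff_deriv y) (at y)"
proof -
  have 1: "((\<lambda>y. 9 - y \<bullet> y) has_derivative (\<lambda>w. - 2 * (y \<bullet> w))) (at y)"
    by (auto intro!: derivative_eq_intros simp: inner_commute)
  have 2: "((\<lambda>y. 1 - pos_square (9 - y \<bullet> y) / 25) has_derivative
      (\<lambda>w. 4 / 25 * max 0 (9 - y \<bullet> y) * (y \<bullet> w))) (at y)"
    using DERIV_compose_FDERIV[OF has_derivative_pos_square 1]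
    by (auto intro!: derivative_eq_intros simp: field_simps)
  show ?thesis
    unfolding cutoff_def[abs_def] cutoff_deriv_def[abs_def]
    using DERIV_compose_FDERIV[OF has_derivative_pos_square 2]
    by (auto intro!: derivative_eq_intros simp: field_simps)
qed

lemma cutoff_deriv_bound: "\<bar>cutoff_deriv y w\<bar> \<le> 9 * norm w"
proof (cases "norm y < 3")
  case True
  have a: "\<bar>max 0 (1 - pos_square (9 - y \<bullet> y) / 25)\<bar> \<le> 1" by (simp add: pos_square_def)
  have b: "\<bar>max 0 (9 - y \<bullet> y)\<bar> \<le> 9" by simp
  have c: "\<bar>y \<bullet> w\<bar> \<le> 3 * norm w"
    using Cauchy_Schwarz_ineq2[of y w] mult_right_mono[of "norm y" 3 "norm w"] True by simp
  have "\<bar>cutoff_deriv y w\<bar> = 8 / 25 * (\<bar>max 0 (1 - pos_square (9 - y \<bullet> y) / 25)\<bar> * (\<bar>max 0 (9 - y \<bullet> y)\<bar> * \<bar>y \<bullet> w\<bar>))"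
    by (simp only: cutoff_deriv_def abs_mult) simp
  also have "\<dots> \<le> 8 / 25 * (1 * (9 * (3 * norm w)))"
    by (intro mult_mono a b c order_refl) auto
  finally show ?thesis by (simp add: order_trans)
next
  case False
  then have "max 0 (9 - y \<bullet> y) = 0" using inner_self_ge[of 3 y] by simp
  then show ?thesis by (simp add: cutoff_deriv_def)
qed

lemma cutoff_deriv_0: "norm y \<ge> 3 \<Longrightarrow> cutoff_deriv y w = 0"
  using inner_self_ge[of 3 y] by (simp add: cutoff_deriv_def)

lemma continuous_cutoff: "continuous_on S cutoff"
  by (intro continuous_at_imp_continuous_on ballI has_derivative_continuous[OF has_derivative_cutoff])

lemma continuous_cutoff_deriv: "continuous_on S (\<lambda>y. cutoff_deriv y w)"
  unfolding cutoff_deriv_def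
  by (intro continuous_intros continuous_on_compose2[OF continuous_pos_square[of UNIV]]) auto

text \<open>
  Inside the ball of radius 2 this is the affine contraction towards \<open>c\<close>, outside the ball of
  radius 3 the identity.
\<close>
definition push :: "real \<Rightarrow> 'v::euclidean_space \<Rightarrow> 'v \<Rightarrow> 'v" where
  "push \<epsilon> c y = y + \<epsilon> *\<^sub>R (cutoff y *\<^sub>R (c - y))"

definition push_deriv :: "real \<Rightarrow> 'v::euclidean_space \<Rightarrow> 'v \<Rightarrow> 'v \<Rightarrow> 'v" where
  "push_deriv \<epsilon> c y w = w + \<epsilon> *\<^sub>R (cutoff_deriv y w *\<^sub>R (c - y) - cutoff y *\<^sub>R w)"

lemma push_inside: "norm y \<le> 2 \<Longrightarrow> push \<epsilon> c y = (1 - \<epsilon>) *\<^sub>R y + \<epsilon> *\<^sub>R c"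
  by (simp add: push_def cutoff_eq_1 algebra_simps)

lemma push_outside: "norm y \<ge> 3 \<Longrightarrow> push \<epsilon> c y = y"
  by (simp add: push_def cutoff_eq_0)

lemma has_derivative_push: "(push \<epsilon> c has_derivative push_deriv \<epsilon> c y) (at y)"
  unfolding push_def[abs_def] push_deriv_def[abs_def]
  by (auto intro!: derivative_eq_intros has_derivative_cutoff simp: algebra_simps)

lemma continuous_push_deriv: "continuous_on S (\<lambda>y. push_deriv \<epsilon> c y w)"
  unfolding push_deriv_def by (intro continuous_intros continuous_cutoff continuous_cutoff_deriv)

lemma C1_near_push: "C1_near (push \<epsilon> c) y"
  by (rule C1_nearI[OF open_UNIV UNIV_I has_derivative_push continuous_push_deriv])

text \<open>
  On the support of the cutoff \<open>norm (c - y) \<le> 4\<close>, so the perturbation of the identity has a derivative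
  of norm at most \<open>(9 * 4 + 1) \<epsilon> \<le> 37 / 100\<close>.
\<close>
lemma push_deriv_near_id:
  assumes "0 \<le> \<epsilon>" "\<epsilon> \<le> 1 / 100" "norm c \<le> 1"
  shows "norm (push_deriv \<epsilon> c y w - w) \<le> 1 / 2 * norm w"
proof -
  have "norm (cutoff_deriv y w *\<^sub>R (c - y) - cutoff y *\<^sub>R w) \<le> 37 * norm w"
  proof (cases "norm y < 3")
    case True
    have "norm (c - y) \<le> 4" using norm_triangle_ineq4[of c y] True assms(3) by simp
    then have "\<bar>cutoff_deriv y w\<bar> * norm (c - y) \<le> (9 * norm w) * 4"
      by (intro mult_mono cutoff_deriv_bound) auto
    moreover have "cutoff y * norm w \<le> 1 * norm w" by (intro mult_right_mono cutoff_bounds) auto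
    ultimately show ?thesis
      using norm_triangle_ineq4[of "cutoff_deriv y w *\<^sub>R (c - y)" "cutoff y *\<^sub>R w"] cutoff_bounds[of y] by simp
  qed (simp add: cutoff_deriv_0 cutoff_eq_0)
  then have "\<epsilon> * norm (cutoff_deriv y w *\<^sub>R (c - y) - cutoff y *\<^sub>R w) \<le> 1 / 100 * (37 * norm w)"
    using assms by (intro mult_mono) auto
  also have "\<dots> \<le> 1 / 2 * norm w" by simp
  finally show ?thesis using assms(1) by (simp add: push_deriv_def)
qed

context
  fixes \<epsilon> :: real and c :: "'v::euclidean_space"
  assumes \<epsilon>: "0 \<le> \<epsilon>" "\<epsilon> \<le> 1 / 100" and c: "norm c \<le> 1"
begin

lemma push_lipschitz: "norm ((push \<epsilon> c y - y) - (push \<epsilon> c z - z)) \<le> 1 / 2 * norm (y - z)"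
proof (rule differentiable_bound[of UNIV _ "\<lambda>y w. push_deriv \<epsilon> c y w - w"])
  fix x :: 'v
  show "((\<lambda>y. push \<epsilon> c y - y) has_derivative (\<lambda>w. push_deriv \<epsilon> c x w - w)) (at x within UNIV)"
    by (intro derivative_intros has_derivative_push)
  show "onorm (\<lambda>w. push_deriv \<epsilon> c x w - w) \<le> 1 / 2"
    using push_deriv_near_id[OF \<epsilon> c] by (intro onorm_le) auto
qed auto

text \<open>
  Solving \<open>push \<epsilon> c y = z\<close> amounts to finding the fixed point of the contraction \<open>y \<mapsto> z - (push \<epsilon> c y - y)\<close>.
\<close>
lemma bij_push: "bij (push \<epsilon> c)"
proof -
  have "\<exists>!y. push \<epsilon> c y = z" for z
  proof -
    have "\<exists>!y. z - (push \<epsilon> c y - y) = y"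
    proof (rule banach_fix_type[of "1 / 2"])
      show "\<forall>x y. dist (z - (push \<epsilon> c x - x)) (z - (push \<epsilon> c y - y)) \<le> 1 / 2 * dist x y"
        using push_lipschitz by (simp add: dist_norm norm_minus_commute algebra_simps)
    qed auto
    moreover have "z - (push \<epsilon> c y - y) = y \<longleftrightarrow> push \<epsilon> c y = z" for y by (auto simp: algebra_simps)
    ultimately show ?thesis by simp
  qed
  then show ?thesis by (simp add: bij_iff)
qed

lemma inv_push_outside: "norm z \<ge> 3 \<Longrightarrow> inv (push \<epsilon> c) z = z"
  using bij_push by (metis bij_inv_eq_iff push_outside)

lemma inv_push_inside: "norm y \<le> 2 \<Longrightarrow> inv (push \<epsilon> c) ((1 - \<epsilon>) *\<^sub>R y + \<epsilon> *\<^sub>R c) = y"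
  using bij_push by (metis bij_inv_eq_iff push_inside)

text \<open>
  The global inverse coincides near \<open>z\<close> with the inverse provided by the inverse function theorem.
\<close>
lemma C1_near_inv_push: "C1_near (inv (push \<epsilon> c)) z"
proof -
  define y where "y = inv (push \<epsilon> c) z"
  have y: "push \<epsilon> c y = z" using bij_push by (simp add: y_def bij_is_surj surj_f_inv_f)
  have "frechet_derivative (push \<epsilon> c) (at y) = push_deriv \<epsilon> c y"
    by (rule frechet_derivative_at[OF has_derivative_push, symmetric])
  moreover have "inj (push_deriv \<epsilon> c y)"
  proof -
    have "linear (push_deriv \<epsilon> c y)" using has_derivative_push has_derivative_linear by blast
    moreover have "w = 0" if "push_deriv \<epsilon> c y w = 0" for w
      using push_deriv_near_id[OF \<epsilon> c, of y w] that by simp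
    ultimately show ?thesis by (simp add: linear_injective_0)
  qed
  ultimately obtain U V g where UV: "open V" "push \<epsilon> c y \<in> V" "homeomorphism U V (push \<epsilon> c) g"
    "\<And>x. x \<in> V \<Longrightarrow> C1_near g x"
    using C1_local_inverse[OF C1_near_push, of \<epsilon> c y UNIV] by (metis UNIV_I open_UNIV)
  have "g x = inv (push \<epsilon> c) x" if "x \<in> V" for x
    using UV(3) that bij_push by (metis bij_inv_eq_iff homeomorphism_apply2)
  then show ?thesis using C1_near_transform[of g z V "inv (push \<epsilon> c)"] UV y by metis
qed

end

section \<open>Steering the fibres from the base\<close>

text \<open>
  A bump with the plateau \<open>[a, a + 1]\<close> that vanishes outside \<open>(a - 1, a + 2)\<close>.
\<close>
definition tent :: "real \<Rightarrow> real \<Rightarrow> real" where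
  "tent a w = min 1 (max 0 (3 / 2 - \<bar>w - a - 1 / 2\<bar>))"

lemma tent_eq_1: "a \<le> w \<Longrightarrow> w \<le> a + 1 \<Longrightarrow> tent a w = 1"
  unfolding tent_def by (simp add: abs_if min_def max_def)

lemma tent_eq_0: "w \<le> a - 1 \<or> a + 2 \<le> w \<Longrightarrow> tent a w = 0"
  unfolding tent_def by (auto simp: abs_if min_def max_def)

lemma tent_bounds: "0 \<le> tent a w" "tent a w \<le> 1"
  unfolding tent_def by auto

lemma continuous_tent [continuous_intros]: "continuous_on S f \<Longrightarrow> continuous_on S (\<lambda>x. tent a (f x))"
  unfolding tent_def by (intro continuous_intros)

text \<open>
  The function has the same value to the left of 0 and to the right of \<open>1 - \<delta>\<close>. On \<open>(k - \<delta>, k + 1)\<close>, for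
  an integer \<open>k\<close>, the wrapped function therefore agrees with the continuous function \<open>t \<mapsto> T (t - k)\<close>.
\<close>
lemma continuous_on_circle_frac:
  fixes T :: "real \<Rightarrow> 'w::topological_space"
  assumes T: "continuous_on UNIV T" and z: "\<And>s. s \<le> 0 \<or> s \<ge> 1 - \<delta> \<Longrightarrow> T s = z" and \<delta>: "\<delta> > 0" "\<delta> \<le> 1"
  obtains \<tau> where "continuous_on UNIV \<tau>" "\<And>t. \<tau> (abs_circle t) = T (frac t)"
proof -
  define \<tau> where "\<tau> \<phi> = T (frac (rep_circle \<phi>))" for \<phi>
  have \<tau>: "\<tau> (abs_circle t) = T (frac t)" for t
  proof -
    have "abs_circle (rep_circle (abs_circle t)) = abs_circle t"
      using Quotient_abs_rep[OF Quotient_circle] by metis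
    then have "rep_circle (abs_circle t) - t \<in> \<int>" by (simp add: abs_circle_eq_iff)
    then have "frac (rep_circle (abs_circle t)) = frac t"
      by (metis diff_add_cancel frac_add_int_left)
    then show ?thesis by (simp add: \<tau>_def)
  qed
  have "isCont (\<lambda>t. T (frac t)) t0" for t0
  proof -
    define k :: real where "k = of_int \<lfloor>t0\<rfloor>"
    have t0: "t0 \<in> {k - \<delta><..<k + 1}" using \<delta> by (simp add: k_def) linarith
    have eq: "T (t - k) = T (frac t)" if "t \<in> {k - \<delta><..<k + 1}" for t
    proof (cases "t \<ge> k")
      case True
      then have "frac t = t - k" using that by (auto simp: frac_unique_iff k_def)
      then show ?thesis by simp
    next
      case False
      have "frac t = t - k + 1"
        using False that \<delta> by (auto simp: frac_unique_iff k_def)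
      then have "frac t \<ge> 1 - \<delta>" using that by simp
      then show ?thesis using False z[of "t - k"] z[of "frac t"] by simp
    qed
    have "isCont (\<lambda>t. T (t - k)) t0"
      using continuous_on_compose2[OF T, of UNIV "\<lambda>t. t - k"] by (auto intro!: continuous_intros simp: continuous_on_eq_continuous_at)
    moreover have "\<forall>\<^sub>F t in nhds t0. T (t - k) = T (frac t)"
      unfolding eventually_nhds using t0 eq by (intro exI[of _ "{k - \<delta><..<k + 1}"]) auto
    ultimately show ?thesis by (simp add: isCont_cong)
  qed
  then have "continuous_on UNIV (\<lambda>t. \<tau> (abs_circle t))"
    by (simp add: \<tau> continuous_on_eq_continuous_at)
  then show ?thesis using that[of \<tau>] \<tau> continuous_on_circleI by blast
qed

lemma exists_signed_basis_vector:
  fixes x :: "'v::euclidean_space"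
  shows "\<exists>v\<in>Basis \<union> uminus ` Basis. x \<bullet> v \<ge> norm x / DIM('v)"
proof -
  have "\<exists>b\<in>Basis. norm x / DIM('v) \<le> \<bar>x \<bullet> b\<bar>"
  proof (rule ccontr)
    assume "\<not> ?thesis"
    then have "(\<Sum>b\<in>(Basis :: 'v set). \<bar>x \<bullet> b\<bar>) < (\<Sum>b\<in>(Basis :: 'v set). norm x / DIM('v))"
      by (intro sum_strict_mono) (auto simp: not_le)
    then show False using norm_le_l1[of x] by simp
  qed
  then obtain b where b: "b \<in> Basis" "norm x / DIM('v) \<le> \<bar>x \<bullet> b\<bar>" by blast
  show ?thesis
  proof (cases "x \<bullet> b \<ge> 0")
    case True
    then show ?thesis using b by (intro bexI[of _ b]) auto
  next
    case False
    then show ?thesis using b by (intro bexI[of _ "- b"]) auto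
  qed
qed

text \<open>
  A circle function with values in the unit ball that vanishes along all intermediate points of
  suitable backward orbits and whose final value points in any prescribed direction. The final
  points are coded by the base \<open>m\<close> expansions \<open>0.20\<dots>010\<dots>\<close>, where the position of the digit 1 selects the
  direction; the expansions of all intermediate points start with the digit 0 or 1.
\<close>

lemma steering_function:
  assumes m: "m \<ge> 3"
  obtains N :: nat and \<sigma> :: real and \<tau> :: "circle \<Rightarrow> 'v::euclidean_space" where
    "N \<ge> 1" "0 < \<sigma>" "\<sigma> \<le> 1" "continuous_on UNIV \<tau>" "\<And>\<phi>. norm (\<tau> \<phi>) \<le> 1"
    "\<And>\<phi> x. \<exists>\<theta> :: nat \<Rightarrow> circle. \<theta> 0 = \<phi> \<and> (\<forall>k<N. expanding_map m (\<theta> (Suc k)) = \<theta> k) \<and>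
       (\<forall>k. 1 \<le> k \<and> k < N \<longrightarrow> \<tau> (\<theta> k) = 0) \<and> x \<bullet> \<tau> (\<theta> N) \<ge> \<sigma> * norm x"
proof -
  define W :: "'v set" where "W = Basis \<union> uminus ` Basis"
  have finW: "finite W" by (simp add: W_def)
  define d where "d = card W"
  have "W \<noteq> {}" by (simp add: W_def)
  then have d: "d \<ge> 1" using finW by (simp add: d_def Suc_leI card_gt_0_iff)
  have normW: "norm v = 1" if "v \<in> W" for v using that by (auto simp: W_def)
  obtain v where v: "bij_betw v {0..<d} W" using ex_bij_betw_nat_finite[OF finW] d_def by blast
  have vW: "v a \<in> W" if "a < d" for a using v that by (auto simp: bij_betw_def)
  define N where "N = d + 2"
  define M where "M = real m"
  have M: "M \<ge> 3" using m by (simp add: M_def)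
  have M0: "M > 0" "M ^ k > 0" "M \<noteq> 0" for k using M by auto
  \<comment> \<open>In the variable \<open>w = M\<^sup>N (s - 2 / M)\<close> the plateau for direction \<open>a\<close> is \<open>[M\<^sup>a, M\<^sup>a + 1]\<close>. These plateaus lie so
    far apart that each of them avoids the supports of all the other bumps. Division by \<open>d\<close> keeps
    the sum in the unit ball.\<close>
  define T where "T s = (\<Sum>a<d. (tent (M ^ a) (M ^ N * (s - 2 / M)) / real d) *\<^sub>R v a)" for s
  have contT: "continuous_on UNIV T" unfolding T_def by (intro continuous_intros) auto
  have T0: "T s = 0" if "s \<le> 2 / M" for s
  proof -
    have "M ^ N * (s - 2 / M) \<le> 0" using that M0 by (simp add: mult_le_0_iff)
    moreover have "M ^ a \<ge> 1" for a using M by simp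
    ultimately have "tent (M ^ a) (M ^ N * (s - 2 / M)) = 0" for a
      by (intro tent_eq_0) (smt (verit))
    then show ?thesis by (simp add: T_def)
  qed
  have T1: "T s = 0" if s: "s \<ge> 1 - 1 / M ^ N" for s
  proof -
    have "tent (M ^ a) (M ^ N * (s - 2 / M)) = 0" if a: "a < d" for a
    proof (rule tent_eq_0, rule disjI2)
      have "M ^ (d + 1) \<ge> M ^ (a + 2)" using a M by (intro power_increasing) auto
      moreover have "M ^ a * 9 \<le> M ^ a * M\<^sup>2"
        using M power_mono[of 3 M 2] by (intro mult_left_mono) auto
      moreover have "M ^ a \<ge> 1" using M by simp
      moreover have "M ^ (a + 2) = M ^ a * M\<^sup>2" by (rule power_add)
      ultimately have "M ^ (d + 1) \<ge> M ^ a + 3" by linarith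
      have "M ^ N * (1 - 1 / M ^ N - 2 / M) \<le> M ^ N * (s - 2 / M)"
        using s M0 by (intro mult_left_mono) auto
      moreover have "M ^ N * (1 - 1 / M ^ N - 2 / M) = M ^ (d + 1) * (M - 2) - 1"
        using M0 by (simp add: N_def field_simps)
      moreover have "M ^ (d + 1) * (M - 2) \<ge> M ^ (d + 1) * 1" using M by (intro mult_left_mono) auto
      ultimately show "M ^ a + 2 \<le> M ^ N * (s - 2 / M)" using \<open>M ^ (d + 1) \<ge> M ^ a + 3\<close> by linarith
    qed
    then show ?thesis by (simp add: T_def)
  qed
  have Tv: "T s = (1 / real d) *\<^sub>R v a" if a: "a < d" and s: "M ^ a \<le> M ^ N * (s - 2 / M)" "M ^ N * (s - 2 / M) \<le> M ^ a + 1" for a s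
  proof -
    have "tent (M ^ b) (M ^ N * (s - 2 / M)) = 0" if ba: "b \<noteq> a" for b
    proof (rule tent_eq_0)
      consider "b < a" | "a < b" using ba by linarith
      then show "M ^ N * (s - 2 / M) \<le> M ^ b - 1 \<or> M ^ b + 2 \<le> M ^ N * (s - 2 / M)"
      proof cases
        case 1
        then have "M ^ a \<ge> M ^ Suc b" using M by (intro power_increasing) auto
        moreover have "3 * M ^ b \<le> M * M ^ b" using M by (intro mult_right_mono) auto
        moreover have "M ^ b \<ge> 1" using M by simp
        ultimately have "M ^ a \<ge> M ^ b + 2" unfolding power_Suc by linarith
        then show ?thesis using s by linarith
      next
        case 2
        then have "M ^ b \<ge> M ^ Suc a" using M by (intro power_increasing) auto
        moreover have "3 * M ^ a \<le> M * M ^ a" using M by (intro mult_right_mono) auto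
        moreover have "M ^ a \<ge> 1" using M by simp
        ultimately have "M ^ b \<ge> M ^ a + 2" unfolding power_Suc by linarith
        then show ?thesis using s by linarith
      qed
    qed
    moreover have "tent (M ^ a) (M ^ N * (s - 2 / M)) = 1" using s by (intro tent_eq_1)
    ultimately have "T s = (\<Sum>b<d. if b = a then (1 / real d) *\<^sub>R v b else 0)"
      unfolding T_def by (intro sum.cong) auto
    then show ?thesis using a by simp
  qed
  have normT: "norm (T s) \<le> 1" for s
  proof -
    have "norm (T s) \<le> (\<Sum>a<d. norm ((tent (M ^ a) (M ^ N * (s - 2 / M)) / real d) *\<^sub>R v a))"
      unfolding T_def by (rule norm_sum)
    also have "\<dots> \<le> (\<Sum>a<d. 1 / real d)"
      using tent_bounds vW normW by (intro sum_mono) (auto simp: divide_right_mono)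
    also have "\<dots> = 1" using d by simp
    finally show ?thesis .
  qed
  have zero: "s \<le> 0 \<or> s \<ge> 1 - 1 / M ^ N \<Longrightarrow> T s = 0" for s
  proof -
    assume "s \<le> 0 \<or> s \<ge> 1 - 1 / M ^ N"
    moreover have "0 \<le> 2 / M" using M by simp
    ultimately show "T s = 0" using T0[of s] T1[of s] by linarith
  qed
  have M1: "1 / M ^ N > 0" "1 / M ^ N \<le> 1" using M by (auto simp: divide_le_eq)
  obtain \<tau> where \<tau>: "continuous_on UNIV \<tau>" "\<And>t. \<tau> (abs_circle t) = T (frac t)"
    using continuous_on_circle_frac[OF contT zero M1] by blast
  define \<sigma> where "\<sigma> = 1 / (real DIM('v) * real d)"
  show ?thesis
  proof (rule that[of N \<sigma> \<tau>])
    have "real DIM('v) * real d \<ge> 1 * 1" using d by (intro mult_mono) (auto simp: Suc_leI)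
    then show "0 < \<sigma>" "\<sigma> \<le> 1" using d by (auto simp: \<sigma>_def divide_le_eq)
    show "N \<ge> 1" by (simp add: N_def)
    show "norm (\<tau> \<phi>) \<le> 1" for \<phi>
      by (rule circle_cases[of \<phi>]) (simp add: \<tau>(2) normT)
    fix \<phi> and x :: 'v
    obtain t where t: "0 \<le> t" "t < 1" "\<phi> = abs_circle t" by (rule circle_cases)
    obtain u where u: "u \<in> W" "x \<bullet> u \<ge> norm x / DIM('v)"
      using exists_signed_basis_vector[of x] unfolding W_def by blast
    then obtain a where a: "a < d" "u = v a" using v by (auto simp: bij_betw_def image_iff Bex_def)
    \<comment> \<open>The preimage of \<open>\<phi>\<close> under \<open>N\<close> steps whose first \<open>N\<close> digits in base \<open>m\<close> are 0 except for a leading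
      2 and a 1 at the position that encodes the direction \<open>v a\<close>.\<close>
    define tN where "tN = 2 / M + (M ^ a + t) / M ^ N"
    define \<theta> where "\<theta> k = (expanding_map m ^^ (N - k)) (abs_circle tN)" for k
    have \<theta>_eq: "\<theta> k = abs_circle (M ^ (N - k) * tN)" for k
      by (simp add: \<theta>_def funpow_expanding_map_abs_circle M_def)
    have split: "M ^ (N - k) * tN = 2 * M ^ (N - k - 1) + (M ^ a + t) / M ^ k" if "k < N" for k
    proof -
      have "M ^ (N - k) = M * M ^ (N - k - 1)" using that by (metis Suc_diff_1 power_Suc zero_less_diff)
      moreover have "M ^ (N - k) / M ^ N = 1 / M ^ k"
        using that M0 by (simp add: power_diff)
      moreover have "M ^ (N - k) * tN = 2 * (M ^ (N - k) / M) + (M ^ (N - k) / M ^ N) * (M ^ a + t)"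
        by (simp add: tN_def distrib_left add_divide_distrib)
      ultimately show ?thesis using M0 by simp
    qed
    have th0: "\<theta> 0 = \<phi>"
    proof -
      have "M ^ N * tN - t = of_nat (2 * m ^ (N - 1) + m ^ a)"
        using split[of 0] by (simp add: N_def M_def)
      then have "M ^ N * tN - t \<in> \<int>" by (metis Ints_of_nat)
      then show ?thesis by (simp add: \<theta>_eq t(3) abs_circle_eq_iff)
    qed
    have step: "expanding_map m (\<theta> (Suc k)) = \<theta> k" if "k < N" for k
    proof -
      have "N - k = Suc (N - Suc k)" using that by simp
      then show ?thesis by (simp add: \<theta>_def)
    qed
    have mid: "\<tau> (\<theta> k) = 0" if k: "1 \<le> k" "k < N" for k
    proof -
      \<comment> \<open>The representative of \<open>\<theta> k\<close> in the unit interval: once the digit 1 has been shifted out, only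
        the contribution of \<open>t\<close> is left.\<close>
      define r where "r = (if k \<le> a then t / M ^ k else (M ^ a + t) / M ^ k)"
      have "M ^ (N - k) * tN - r \<in> \<int>"
      proof (cases "k \<le> a")
        case True
        have "(M ^ a + t) / M ^ k = M ^ (a - k) + t / M ^ k"
          using True M0 by (simp add: add_divide_distrib power_diff)
        then have "M ^ (N - k) * tN - r = of_nat (2 * m ^ (N - k - 1) + m ^ (a - k))"
          using split[OF k(2)] True by (simp add: r_def M_def)
        then show ?thesis by (metis Ints_of_nat)
      next
        case False
        then have "M ^ (N - k) * tN - r = of_nat (2 * m ^ (N - k - 1))"
          using split[OF k(2)] by (simp add: r_def M_def)
        then show ?thesis by (metis Ints_of_nat)
      qed
      then have "\<theta> k = abs_circle r" by (simp add: \<theta>_eq abs_circle_eq_iff)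
      moreover have "0 \<le> r" using t M0 by (auto simp: r_def)
      moreover have r2: "r \<le> 2 / M"
      proof (cases "k \<le> a")
        case True
        have "t / M ^ k \<le> 1 / M ^ 1" using t M k by (intro frac_le power_increasing) auto
        also have "\<dots> \<le> 2 / M" using M by (simp add: divide_right_mono)
        finally show ?thesis using True by (simp add: r_def)
      next
        case False
        have "M ^ a \<ge> 1" using M by simp
        then have "M ^ a + t \<le> 2 * M ^ a" using t by linarith
        moreover have "M ^ Suc a \<le> M ^ k" using False M by (intro power_increasing) auto
        ultimately have "(M ^ a + t) / M ^ k \<le> (2 * M ^ a) / M ^ Suc a"
          using M0 t by (intro frac_le) auto
        also have "\<dots> = 2 / M" using M0 by simp
        finally show ?thesis using False by (simp add: r_def)
      qed
      moreover have "2 / M < 1" using M by simp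
      ultimately show ?thesis using T0[OF r2] by (simp add: \<tau>(2) frac_eq[THEN iffD2])
    qed
    have fin: "x \<bullet> \<tau> (\<theta> N) \<ge> \<sigma> * norm x"
    proof -
      have w: "M ^ N * (tN - 2 / M) = M ^ a + t" using M0 by (simp add: tN_def)
      have "M ^ a \<ge> 1" using M by simp
      have "tN \<ge> 0" using M0 t by (simp add: tN_def)
      moreover have "tN < 1"
      proof (rule ccontr)
        assume "\<not> tN < 1"
        then have "T tN = 0" using M0 by (intro T1) (smt (verit) divide_nonneg_nonneg)
        moreover have "T tN = (1 / real d) *\<^sub>R v a" using w t a(1) by (intro Tv) auto
        ultimately have "v a = 0" using d by simp
        then show False using normW[OF vW[OF a(1)]] by simp
      qed
      ultimately have "\<tau> (\<theta> N) = T tN" by (simp add: \<theta>_def \<tau>(2) frac_eq[THEN iffD2])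
      also have "\<dots> = (1 / real d) *\<^sub>R v a" using w t a(1) by (intro Tv) auto
      finally have "x \<bullet> \<tau> (\<theta> N) = (x \<bullet> u) / real d" by (simp add: a(2))
      moreover have "(norm x / real DIM('v)) / real d \<le> (x \<bullet> u) / real d" using u(2) by (intro divide_right_mono) auto
      ultimately show ?thesis by (simp add: \<sigma>_def)
    qed
    show "\<exists>\<theta>. \<theta> 0 = \<phi> \<and> (\<forall>k<N. expanding_map m (\<theta> (Suc k)) = \<theta> k) \<and>
       (\<forall>k. 1 \<le> k \<and> k < N \<longrightarrow> \<tau> (\<theta> k) = 0) \<and> x \<bullet> \<tau> (\<theta> N) \<ge> \<sigma> * norm x"
      using th0 step mid fin by blast
  qed (rule \<tau>(1))
qed

text \<open>
  Backward orbits of the fibre maps expand by \<open>1 / (1 - \<epsilon>)\<close> in each of \<open>N\<close> steps, which moves a point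
  of the ball of radius \<open>\<rho>\<close> outwards by at most about \<open>N \<epsilon> \<rho>\<close>, while the single push against the
  position vector moves it inwards by about \<open>\<epsilon> \<sigma>\<close>. If \<open>\<rho>\<close> is small compared with \<open>\<sigma> / N\<close>, the
  push wins, and with some room to spare for errors of size \<open>\<eta>\<close> in each step.
\<close>

lemma backward_orbit_returns:
  fixes N :: nat and \<sigma> :: real
  assumes N: "N \<ge> 1" and \<sigma>: "0 < \<sigma>" "\<sigma> \<le> 1"
  obtains \<rho> \<epsilon> \<eta> :: real where "0 < \<rho>" "\<rho> \<le> 1" "0 < \<epsilon>" "\<epsilon> \<le> 1 / 100" "0 < \<eta>"
    "\<And>(y :: nat \<Rightarrow> 'v::euclidean_space) v. norm (y 0) < \<rho> \<Longrightarrow> norm v \<le> 1 \<Longrightarrow> y 0 \<bullet> v \<ge> \<sigma> * norm (y 0) \<Longrightarrow>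
      (\<And>k. k < N \<Longrightarrow> norm (y k) \<le> 1 \<Longrightarrow>
        norm (y (Suc k) - (1 / (1 - \<epsilon>)) *\<^sub>R (y k - \<epsilon> *\<^sub>R (if Suc k = N then v else 0))) \<le> \<eta>) \<Longrightarrow>
      (\<forall>k\<le>N. norm (y k) \<le> 1) \<and> norm (y N) < \<rho>"
proof -
  define n where "n = real N"
  have n: "n \<ge> 1" using N by (simp add: n_def)
  \<comment> \<open>With this choice the loss \<open>n \<epsilon> \<rho>\<^sup>2\<close> by expansion is a small multiple of \<open>\<epsilon>\<^sup>2\<close> and the quadratic
    term of the push is at most \<open>\<epsilon>\<^sup>2\<close>, while the linear term of the push gains \<open>\<epsilon> \<sigma> \<rho> = 4 \<epsilon>\<^sup>2\<close>.\<close>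
  define \<rho> where "\<rho> = \<sigma> / (25 * n)"
  define \<epsilon> where "\<epsilon> = \<sigma> * \<rho> / 4"
  have \<rho>: "0 < \<rho>" "\<rho> \<le> 1 / 25" using \<sigma> n by (auto simp: \<rho>_def divide_le_eq)
  have "\<sigma> * \<rho> \<le> 1 * (1 / 25)" using \<sigma> \<rho> by (intro mult_mono) auto
  then have "\<epsilon> \<le> 1 / 100" unfolding \<epsilon>_def by linarith
  moreover have "0 < \<epsilon>" using \<sigma> \<rho> by (simp add: \<epsilon>_def)
  ultimately have \<epsilon>: "0 < \<epsilon>" "\<epsilon> \<le> 1 / 100" by blast+
  have n\<rho>: "n * \<rho> = \<sigma> / 25" using n by (simp add: \<rho>_def)
  have n\<epsilon>: "n * \<epsilon> \<le> 1 / 100"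
  proof -
    have "n * \<epsilon> = \<sigma> * (n * \<rho>) / 4" by (simp add: \<epsilon>_def)
    also have "\<dots> = \<sigma> * \<sigma> / 100" by (simp add: n\<rho>)
    also have "\<dots> \<le> 1 * 1 / 100" using \<sigma> by (intro divide_right_mono mult_mono) auto
    finally show ?thesis by simp
  qed
  have \<sigma>\<rho>: "\<epsilon> * \<sigma> * \<rho> = 4 * \<epsilon>\<^sup>2" by (simp add: \<epsilon>_def power2_eq_square)
  define q where "q = 1 / (1 - \<epsilon>)"
  have q: "q \<ge> 1" "q * (1 - \<epsilon>) = 1" using \<epsilon> by (auto simp: q_def)
  define c where "c = (1 - \<epsilon>) ^ N"
  have c: "c \<ge> 1 - n * \<epsilon>" "c \<le> 1" "c > 0"
    using Bernoulli_inequality[of "- \<epsilon>" N] \<epsilon> by (auto simp: c_def n_def power_le_one)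
  have qc: "q ^ N = 1 / c" by (simp add: q_def c_def power_one_over)
  have qN: "q ^ N \<le> 2"
  proof -
    have "1 \<le> 2 * c" using c(1) n\<epsilon> by simp
    then show ?thesis using c(3) by (simp add: qc divide_le_eq)
  qed
  have qk: "q ^ k \<le> q ^ N" if "k \<le> N" for k using that q(1) by (intro power_increasing)
  define s1 where "s1 = sqrt (\<rho>\<^sup>2 - 3 * \<epsilon>\<^sup>2)"
  have \<epsilon>\<rho>: "\<epsilon> \<le> \<rho> / 4" using \<sigma> \<rho> by (simp add: \<epsilon>_def mult_left_le_one_le)
  then have \<epsilon>\<rho>2: "\<epsilon>\<^sup>2 \<le> \<rho>\<^sup>2 / 16" using power_mono[of \<epsilon> "\<rho> / 4" 2] \<epsilon> by (simp add: power_divide)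
  have s1: "s1 < \<rho> * c"
  proof -
    have "(1 - n * \<epsilon>)\<^sup>2 \<le> c\<^sup>2" using c n\<epsilon> by (intro power_mono) auto
    moreover have "1 - 2 * (n * \<epsilon>) \<le> (1 - n * \<epsilon>)\<^sup>2" by (simp add: power2_diff)
    ultimately have "\<rho>\<^sup>2 * (1 - 2 * (n * \<epsilon>)) \<le> \<rho>\<^sup>2 * c\<^sup>2" by (intro mult_left_mono) auto
    moreover have "\<rho>\<^sup>2 * (2 * (n * \<epsilon>)) \<le> 2 * \<epsilon>\<^sup>2"
    proof -
      have "\<rho>\<^sup>2 * (2 * (n * \<epsilon>)) = 2 * (n * \<rho>) * \<epsilon> * \<rho>" by (simp add: power2_eq_square)
      also have "\<dots> = (2 / 25) * (\<epsilon> * \<sigma> * \<rho>)" by (simp add: n\<rho>)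
      also have "\<dots> \<le> 2 * \<epsilon>\<^sup>2" by (simp add: \<sigma>\<rho>)
      finally show ?thesis .
    qed
    ultimately have "\<rho>\<^sup>2 - 2 * \<epsilon>\<^sup>2 \<le> (\<rho> * c)\<^sup>2" by (simp add: power_mult_distrib right_diff_distrib)
    moreover have "\<epsilon>\<^sup>2 > 0" using \<epsilon> by simp
    ultimately have "\<rho>\<^sup>2 - 3 * \<epsilon>\<^sup>2 < (\<rho> * c)\<^sup>2" by linarith
    then have "s1 < sqrt ((\<rho> * c)\<^sup>2)" unfolding s1_def by (rule real_sqrt_less_mono)
    then show ?thesis using \<rho> c by simp
  qed
  then have gap: "q ^ N * s1 < \<rho>" using c(3) by (simp add: qc divide_less_eq)
  define \<eta> where "\<eta> = min (1 / (4 * n)) ((\<rho> - q ^ N * s1) / (4 * n))"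
  have \<eta>: "0 < \<eta>" "2 * (n * \<eta>) \<le> 1 / 2" "2 * (n * \<eta>) < \<rho> - q ^ N * s1"
  proof -
    show "0 < \<eta>" using gap n by (simp add: \<eta>_def)
    have quarter: "n * (x / (4 * n)) = x / 4" for x using n by simp
    have "n * \<eta> \<le> n * (1 / (4 * n))"
      unfolding \<eta>_def using n by (intro mult_left_mono min.cobounded1) auto
    moreover have "n * \<eta> \<le> n * ((\<rho> - q ^ N * s1) / (4 * n))"
      unfolding \<eta>_def using n by (intro mult_left_mono min.cobounded2) auto
    ultimately have b: "n * \<eta> \<le> 1 / 4" "n * \<eta> \<le> (\<rho> - q ^ N * s1) / 4"
      unfolding quarter by blast+
    show "2 * (n * \<eta>) \<le> 1 / 2" using b(1) by linarith
    show "2 * (n * \<eta>) < \<rho> - q ^ N * s1" using b(2) gap by argo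
  qed
  show ?thesis
  proof (rule that[of \<rho> \<epsilon> \<eta>])
    fix y :: "nat \<Rightarrow> 'v" and v
    assume y0: "norm (y 0) < \<rho>" and v: "norm v \<le> 1" "y 0 \<bullet> v \<ge> \<sigma> * norm (y 0)"
    assume "\<And>k. k < N \<Longrightarrow> norm (y k) \<le> 1 \<Longrightarrow>
        norm (y (Suc k) - (1 / (1 - \<epsilon>)) *\<^sub>R (y k - \<epsilon> *\<^sub>R (if Suc k = N then v else 0))) \<le> \<eta>"
    then have st: "\<And>k. k < N \<Longrightarrow> norm (y k) \<le> 1 \<Longrightarrow>
        norm (y (Suc k) - q *\<^sub>R (y k - \<epsilon> *\<^sub>R (if Suc k = N then v else 0))) \<le> \<eta>"
      unfolding q_def .
    have small: "norm z \<le> 1" if "norm (z - q ^ k *\<^sub>R y 0) \<le> real k * q ^ k * \<eta>" "k \<le> N" for z k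
    proof -
      have "norm z \<le> norm (q ^ k *\<^sub>R y 0) + norm (z - q ^ k *\<^sub>R y 0)" by (rule norm_triangle_sub)
      moreover have "norm (q ^ k *\<^sub>R y 0) \<le> 2 * \<rho>"
      proof -
        have "q ^ k * norm (y 0) \<le> 2 * \<rho>" using qk[OF that(2)] qN q(1) y0 by (intro mult_mono) auto
        then show ?thesis using q(1) by simp
      qed
      moreover have "real k * q ^ k * \<eta> \<le> n * 2 * \<eta>"
        using qk[OF that(2)] qN q(1) that(2) \<eta>(1) by (intro mult_mono) (auto simp: n_def)
      ultimately show ?thesis using that(1) \<rho> \<eta>(2) by linarith
    qed
    have free: "norm (y k - q ^ k *\<^sub>R y 0) \<le> real k * q ^ k * \<eta>" if "k < N" for k
      using that
    proof (induction k)
      case (Suc k)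
      then have IH: "norm (y k - q ^ k *\<^sub>R y 0) \<le> real k * q ^ k * \<eta>" by simp
      have "norm (y k) \<le> 1" by (rule small[OF IH]) (use Suc.prems in simp)
      then have "norm (y (Suc k) - q *\<^sub>R y k) \<le> \<eta>" using st[of k] Suc.prems by simp
      moreover have "norm (q *\<^sub>R (y k - q ^ k *\<^sub>R y 0)) \<le> q * (real k * q ^ k * \<eta>)"
        using IH q(1) by (simp add: mult_left_mono)
      moreover have "y (Suc k) - q ^ Suc k *\<^sub>R y 0 = (y (Suc k) - q *\<^sub>R y k) + q *\<^sub>R (y k - q ^ k *\<^sub>R y 0)"
        by (simp add: algebra_simps)
      ultimately have "norm (y (Suc k) - q ^ Suc k *\<^sub>R y 0) \<le> \<eta> + q * (real k * q ^ k * \<eta>)"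
        by (metis norm_triangle_mono)
      also have "\<dots> \<le> q ^ Suc k * \<eta> + real k * q ^ Suc k * \<eta>"
      proof -
        have "1 * \<eta> \<le> q ^ Suc k * \<eta>" using q(1) \<eta>(1) by (intro mult_right_mono one_le_power) auto
        then show ?thesis by (simp add: algebra_simps)
      qed
      finally show ?case by (simp add: algebra_simps)
    qed simp
    obtain K where K: "N = Suc K" using N by (cases N) auto
    define b where "b = \<epsilon> * (1 - \<epsilon>) ^ K"
    have b: "\<epsilon> / 2 \<le> b" "b \<le> \<epsilon>"
    proof -
      have "(1 - \<epsilon>) ^ K \<le> 1" using \<epsilon> by (intro power_le_one) auto
      moreover have "c \<le> (1 - \<epsilon>) ^ K" unfolding c_def K using \<epsilon> by (intro power_decreasing) auto
      then have "1 / 2 \<le> (1 - \<epsilon>) ^ K" using c(1) n\<epsilon> by linarith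
      ultimately show "\<epsilon> / 2 \<le> b" "b \<le> \<epsilon>" using \<epsilon> by (auto simp: b_def)
    qed
    have push: "norm (y 0 - b *\<^sub>R v) \<le> s1"
    proof -
      define r where "r = norm (y 0)"
      have r: "0 \<le> r" "r < \<rho>" using y0 by (auto simp: r_def)
      have "(norm (y 0 - b *\<^sub>R v))\<^sup>2 = r\<^sup>2 - 2 * b * (y 0 \<bullet> v) + b\<^sup>2 * (norm v)\<^sup>2"
        unfolding r_def power2_norm_eq_inner
        by (simp add: inner_diff_left inner_diff_right inner_commute power2_eq_square algebra_simps)
      also have "\<dots> \<le> r\<^sup>2 - \<epsilon> * \<sigma> * r + \<epsilon>\<^sup>2"
      proof -
        have "(\<epsilon> / 2) * (\<sigma> * r) \<le> b * (y 0 \<bullet> v)"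
          using b v \<epsilon> \<sigma> r by (intro mult_mono) (auto simp: r_def)
        moreover have "b\<^sup>2 * (norm v)\<^sup>2 \<le> \<epsilon>\<^sup>2 * 1\<^sup>2" using b v \<epsilon> by (intro mult_mono power_mono) auto
        ultimately show ?thesis by simp
      qed
      also have "\<dots> \<le> \<rho>\<^sup>2 - 3 * \<epsilon>\<^sup>2"
      proof (cases "r \<le> \<epsilon> * \<sigma>")
        case True
        then have "r * r \<le> r * (\<epsilon> * \<sigma>)" using r by (intro mult_left_mono)
        then have "r\<^sup>2 - \<epsilon> * \<sigma> * r \<le> 0" by (simp add: power2_eq_square algebra_simps)
        moreover have "4 * \<epsilon>\<^sup>2 \<le> \<rho>\<^sup>2" using \<epsilon>\<rho>2 zero_le_power2[of \<rho>] by linarith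
        ultimately show ?thesis by linarith
      next
        case False
        then have "r * (r - \<epsilon> * \<sigma>) \<le> \<rho> * (\<rho> - \<epsilon> * \<sigma>)" using r \<rho> by (intro mult_mono) auto
        then have "r\<^sup>2 - \<epsilon> * \<sigma> * r \<le> \<rho>\<^sup>2 - \<epsilon> * \<sigma> * \<rho>" by (simp add: power2_eq_square algebra_simps)
        then show ?thesis using \<sigma>\<rho> by linarith
      qed
      finally show ?thesis unfolding s1_def by (rule real_le_rsqrt)
    qed
    have K1: "norm (y K) \<le> 1" by (rule small[OF free]) (auto simp: K)
    have yN: "norm (y N) < \<rho>"
    proof -
      have e1: "norm (y N - q *\<^sub>R (y K - \<epsilon> *\<^sub>R v)) \<le> \<eta>" using st[of K] K1 K by simp
      have e2: "norm (q *\<^sub>R (y K - q ^ K *\<^sub>R y 0)) \<le> q * (real K * q ^ K * \<eta>)"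
        using free[of K] q(1) K by (simp add: mult_left_mono)
      have qb: "q ^ N * b = q * \<epsilon>"
      proof -
        have "q ^ K * (1 - \<epsilon>) ^ K = 1" using q(2) by (simp flip: power_mult_distrib)
        then show ?thesis by (simp add: b_def K)
      qed
      have "q *\<^sub>R (q ^ K *\<^sub>R y 0 - \<epsilon> *\<^sub>R v) = q ^ N *\<^sub>R y 0 - (q * \<epsilon>) *\<^sub>R v"
        by (simp add: K scaleR_diff_right)
      also have "\<dots> = q ^ N *\<^sub>R (y 0 - b *\<^sub>R v)"
        unfolding qb[symmetric] by (simp add: scaleR_diff_right)
      finally have main: "q *\<^sub>R (q ^ K *\<^sub>R y 0 - \<epsilon> *\<^sub>R v) = q ^ N *\<^sub>R (y 0 - b *\<^sub>R v)" .
      have "y N = (y N - q *\<^sub>R (y K - \<epsilon> *\<^sub>R v)) + q *\<^sub>R (y K - q ^ K *\<^sub>R y 0) + q *\<^sub>R (q ^ K *\<^sub>R y 0 - \<epsilon> *\<^sub>R v)"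
        by (simp add: algebra_simps)
      then have "norm (y N) \<le> \<eta> + q * (real K * q ^ K * \<eta>) + norm (q ^ N *\<^sub>R (y 0 - b *\<^sub>R v))"
        unfolding main using e1 e2 by (metis norm_triangle_mono order_refl)
      also have "norm (q ^ N *\<^sub>R (y 0 - b *\<^sub>R v)) \<le> q ^ N * s1"
        using push q(1) by (simp add: mult_left_mono)
      also have "\<eta> + q * (real K * q ^ K * \<eta>) \<le> 2 * (n * \<eta>)"
      proof -
        have "q * (real K * q ^ K * \<eta>) = real K * q ^ N * \<eta>" by (simp add: K)
        also have "\<dots> \<le> real K * 2 * \<eta>" using qN \<eta>(1) q(1) by (intro mult_mono) auto
        finally have "q * (real K * q ^ K * \<eta>) \<le> real K * 2 * \<eta>" .
        moreover have "2 * (n * \<eta>) = real K * 2 * \<eta> + 2 * \<eta>" by (simp add: n_def K algebra_simps)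
        ultimately show ?thesis using \<eta>(1) by linarith
      qed
      finally show ?thesis using \<eta>(3) by linarith
    qed
    have "norm (y k) \<le> 1" if "k \<le> N" for k
    proof (cases "k < N")
      case True
      then show ?thesis by (intro small[OF free]) auto
    next
      case False
      then show ?thesis using that yN \<rho> by simp
    qed
    then show "(\<forall>k\<le>N. norm (y k) \<le> 1) \<and> norm (y N) < \<rho>" using yN by blast
  qed (use \<rho> \<epsilon> \<eta> in auto)
qed

section \<open>The Riemannian volume\<close>

lemma continuous_on_det:
  fixes f :: "'p::topological_space \<Rightarrow> real ^ 'n ^ 'n"
  assumes "continuous_on S f"
  shows "continuous_on S (\<lambda>x. det (f x))"
  unfolding det_def using assms by (intro continuous_intros)

text \<open>
  All matrices on the segment from the identity to \<open>G\<close> are positive definite, hence invertible, so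
  the determinant does not change its sign along it.
\<close>
lemma det_pos_of_positive_definite:
  fixes G :: "real ^ 'n ^ 'n"
  assumes pd: "\<And>v. v \<noteq> 0 \<Longrightarrow> v \<bullet> (G *v v) > 0"
  shows "det G > 0"
proof (rule ccontr)
  assume neg: "\<not> det G > 0"
  define H where "H t = (1 - t) *\<^sub>R mat 1 + t *\<^sub>R G" for t :: real
  have H: "H t *v v = (1 - t) *\<^sub>R v + t *\<^sub>R (G *v v)" for t v
    by (simp add: H_def matrix_vector_mult_add_rdistrib scaleR_matrix_vector_assoc[symmetric])
  have cont: "continuous_on {0..1} (\<lambda>t. det (H t))"
    unfolding H_def by (intro continuous_on_det continuous_intros)
  have "det (H 0) = 1" "det (H 1) = det G" by (simp_all add: H_def)
  then have "\<exists>t. 0 \<le> t \<and> t \<le> 1 \<and> det (H t) = 0"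
    using neg by (intro IVT2' cont) auto
  then obtain t where t: "0 \<le> t" "t \<le> 1" "det (H t) = 0" by blast
  then have "\<not> invertible (H t)" by (simp add: invertible_det_nz)
  then obtain v where v: "v \<noteq> 0" "H t *v v = 0"
    using matrix_left_invertible_ker[of "H t"] invertible_left_inverse[of "H t"] by auto
  have "v \<bullet> (H t *v v) = (1 - t) * (v \<bullet> v) + t * (v \<bullet> (G *v v))" by (simp add: H inner_add_right)
  then have zero: "(1 - t) * (v \<bullet> v) + t * (v \<bullet> (G *v v)) = 0" using v(2) by simp
  moreover have "(1 - t) * (v \<bullet> v) \<ge> 0" "t * (v \<bullet> (G *v v)) \<ge> 0" using t pd[OF v(1)] by auto
  ultimately have "(1 - t) * (v \<bullet> v) = 0" "t * (v \<bullet> (G *v v)) = 0" by linarith+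
  then show False using pd[OF v(1)] v(1) by auto
qed

lemma is_chartD:
  assumes "is_chart c"
  shows "open (fst c)" "open (snd c ` fst c)" "homeomorphism (fst c) (snd c ` fst c) (snd c) (chart_inv c)"
    "\<And>x. x \<in> fst c \<Longrightarrow> chart_inv c (snd c x) = x"
    "\<And>y. y \<in> snd c ` fst c \<Longrightarrow> snd c (chart_inv c y) = y"
    "\<And>y. y \<in> snd c ` fst c \<Longrightarrow> chart_inv c y \<in> fst c"
    "continuous_on (fst c) (snd c)" "continuous_on (snd c ` fst c) (chart_inv c)"
  using assms unfolding is_chart_def homeomorphism_def by auto

lemma chart_open_image:
  assumes c: "is_chart c" and "open U" "U \<subseteq> fst c"
  shows "open (snd c ` U)"
proof -
  have "snd c ` U = chart_inv c -` U \<inter> snd c ` fst c"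
    using assms(3) is_chartD(4-6)[OF c] by force
  then show ?thesis
    using is_chartD(2,8)[OF c] assms(2) by (simp add: continuous_on_open_vimage)
qed

definition vol_density ::
    "(('a::topological_space, 'n::finite) chart \<Rightarrow> real ^ 'n \<Rightarrow> real ^ 'n ^ 'n) \<Rightarrow> ('a, 'n) chart \<Rightarrow> real ^ 'n \<Rightarrow> real" where
  "vol_density g c y = sqrt (det (g c y))"

lemma vol_density:
  assumes "riemannian_metric A g" "c \<in> A"
  shows "continuous_on (snd c ` fst c) (vol_density g c)"
    and "\<And>y. y \<in> snd c ` fst c \<Longrightarrow> vol_density g c y > 0"
proof -
  have "smooth_on (snd c ` fst c) (g c)" using assms unfolding riemannian_metric_def by blast
  then have "C_on 0 (snd c ` fst c) (g c)" unfolding smooth_on_def by blast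
  then show "continuous_on (snd c ` fst c) (vol_density g c)"
    unfolding vol_density_def by (intro continuous_intros continuous_on_det) simp
  fix y assume "y \<in> snd c ` fst c"
  then have "det (g c y) > 0"
    using assms unfolding riemannian_metric_def by (intro det_pos_of_positive_definite) blast
  then show "vol_density g c y > 0" by (simp add: vol_density_def)
qed

text \<open>
  The contribution of a single chart, as a measure on the manifold. Expressing the Riemannian
  volume through these measures reduces its countable additivity to theirs.
\<close>
definition chart_measure ::
    "(('a::topological_space, 'n::finite) chart \<Rightarrow> real ^ 'n \<Rightarrow> real ^ 'n ^ 'n) \<Rightarrow> ('a, 'n) chart \<Rightarrow> 'a measure" where
  "chart_measure g c = distr (density (restrict_space lborel (snd c ` fst c)) (\<lambda>y. ennreal (vol_density g c y))) borel (chart_inv c)"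

lemma emeasure_chart_measure:
  assumes g: "riemannian_metric A g" "c \<in> A" and c: "is_chart c" and B: "B \<in> sets borel" "B \<subseteq> fst c"
  shows "emeasure (chart_measure g c) B = (\<integral>\<^sup>+ y \<in> snd c ` B. ennreal (sqrt (det (g c y))) \<partial>lborel)"
proof -
  let ?\<Omega> = "snd c ` fst c"
  let ?R = "restrict_space lborel ?\<Omega>"
  have sR: "sets ?R = sets (restrict_space borel ?\<Omega>)" by (simp add: sets_restrict_space)
  have inv: "chart_inv c \<in> measurable ?R borel"
    using borel_measurable_continuous_on_restrict[OF is_chartD(8)[OF c]] by (simp add: measurable_cong_sets[OF sR refl])
  have dens: "(\<lambda>y. ennreal (vol_density g c y)) \<in> borel_measurable ?R"
    using borel_measurable_continuous_on_restrict[OF vol_density(1)[OF g]] by (simp add: measurable_cong_sets[OF sR refl])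
  have im: "chart_inv c -` B \<inter> ?\<Omega> = snd c ` B" using B(2) is_chartD(4-6)[OF c] by force
  have \<Omega>: "?\<Omega> \<in> sets lborel" using is_chartD(2)[OF c] by simp
  have "chart_inv c -` B \<inter> space ?R \<in> sets ?R" by (rule measurable_sets[OF inv B(1)])
  then have mB: "snd c ` B \<in> sets ?R" by (simp add: space_restrict_space im)
  have "emeasure (chart_measure g c) B = emeasure (density ?R (\<lambda>y. ennreal (vol_density g c y))) (snd c ` B)"
    unfolding chart_measure_def using inv B(1)
    by (subst emeasure_distr) (simp_all add: space_restrict_space im)
  also have "\<dots> = (\<integral>\<^sup>+ y. ennreal (vol_density g c y) * indicator (snd c ` B) y \<partial>?R)"
    by (rule emeasure_density[OF dens mB])
  also have "\<dots> = (\<integral>\<^sup>+ y \<in> ?\<Omega>. (ennreal (vol_density g c y) * indicator (snd c ` B) y) \<partial>lborel)"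
    using \<Omega> by (subst nn_integral_restrict_space) auto
  also have "\<dots> = (\<integral>\<^sup>+ y \<in> snd c ` B. ennreal (sqrt (det (g c y))) \<partial>lborel)"
    using B(2) by (intro nn_integral_cong) (auto simp: indicator_def vol_density_def)
  finally show ?thesis .
qed

lemma sets_chart_measure [simp]: "sets (chart_measure g c) = sets borel"
  by (simp add: chart_measure_def)

text \<open>
  Compactness provides a finite list of charts covering the manifold, so the list that the
  definition of the volume selects has this property. The sets \<open>P i\<close> partition the manifold.
\<close>
lemma riemannian_volume_eq:
  fixes A :: "('a::{t2_space, second_countable_topology}, 'n::finite) chart set"
  assumes M: "compact_riemannian_manifold A g"
  obtains cs P where "set cs \<subseteq> A" "(\<Union>c\<in>set cs. fst c) = UNIV"
    "\<And>i. P i = fst (cs ! i) - (\<Union>j<i. fst (cs ! j))"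
    "sets (riemannian_volume A g) = sets borel"
    "\<And>B. B \<in> sets borel \<Longrightarrow> emeasure (riemannian_volume A g) B = (\<Sum>i<length cs. emeasure (chart_measure g (cs ! i)) (B \<inter> P i))"
    "\<And>i. i < length cs \<Longrightarrow> P i \<in> sets borel"
proof -
  have comp: "compact (UNIV :: 'a set)" and at: "smooth_atlas A" and g: "riemannian_metric A g"
    using M by (auto simp: compact_riemannian_manifold_def)
  have ch: "is_chart c" if "c \<in> A" for c using at that by (auto simp: smooth_atlas_def)
  have cover: "(\<Union>c\<in>A. fst c) = UNIV" using at by (simp add: smooth_atlas_def)
  obtain C where C: "C \<subseteq> A" "finite C" "UNIV \<subseteq> (\<Union>c\<in>C. fst c)"
    using compactE_image[OF comp, of A fst] is_chartD(1)[OF ch] cover by blast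
  obtain cs0 where cs0: "set cs0 = C" using finite_list[OF C(2)] by blast
  define cs where "cs = (SOME cs. set cs \<subseteq> A \<and> (\<Union>c\<in>set cs. fst c) = UNIV)"
  have cs: "set cs \<subseteq> A \<and> (\<Union>c\<in>set cs. fst c) = UNIV"
    unfolding cs_def by (rule someI[of _ cs0]) (use C cs0 in auto)
  define P where "P i = fst (cs ! i) - (\<Union>j<i. fst (cs ! j))" for i
  have csA: "cs ! i \<in> A" if "i < length cs" for i using cs that by (meson nth_mem subsetD)
  have P: "P i \<in> sets borel" if "i < length cs" for i
  proof -
    have "open (fst (cs ! j))" if "j \<le> i" for j using is_chartD(1)[OF ch[OF csA]] that \<open>i < length cs\<close> by simp
    then show ?thesis unfolding P_def by (intro sets.Diff sets.finite_UN) auto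
  qed
  define \<nu> where "\<nu> B = (\<Sum>i<length cs. emeasure (chart_measure g (cs ! i)) (B \<inter> P i))" for B
  define \<nu>' where "\<nu>' B = (\<Sum>i<length cs.
                    \<integral>\<^sup>+ y \<in> snd (cs ! i) ` (B \<inter> fst (cs ! i) - (\<Union>j<i. fst (cs ! j))).
                      ennreal (sqrt (det (g (cs ! i) y))) \<partial>lborel)" for B
  have \<nu>: "\<nu>' B = \<nu> B" if "B \<in> sets borel" for B
    unfolding \<nu>_def \<nu>'_def
  proof (intro sum.cong refl)
    fix i assume "i \<in> {..<length cs}"
    then have i: "i < length cs" by simp
    have "B \<inter> P i \<in> sets borel" using that P[OF i] by blast
    moreover have "B \<inter> P i \<subseteq> fst (cs ! i)" by (auto simp: P_def)
    moreover have "B \<inter> P i = B \<inter> fst (cs ! i) - (\<Union>j<i. fst (cs ! j))" by (auto simp: P_def)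
    ultimately show "(\<integral>\<^sup>+ y \<in> snd (cs ! i) ` (B \<inter> fst (cs ! i) - (\<Union>j<i. fst (cs ! j))).
                      ennreal (sqrt (det (g (cs ! i) y))) \<partial>lborel) = emeasure (chart_measure g (cs ! i)) (B \<inter> P i)"
      using emeasure_chart_measure[OF g csA[OF i] ch[OF csA[OF i]], of "B \<inter> P i"] by simp
  qed
  have vol: "riemannian_volume A g = measure_of UNIV (sets borel) \<nu>'"
    unfolding riemannian_volume_def \<nu>'_def cs_def Let_def ..
  have sets: "sets (riemannian_volume A g) = sets borel"
    unfolding vol using sets.sigma_sets_eq[of "borel :: 'a measure"] by (simp add: sets_measure_of)
  have "emeasure (riemannian_volume A g) B = \<nu>' B" if B: "B \<in> sets borel" for B
  proof (rule emeasure_measure_of[OF vol])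
    show "sets borel \<subseteq> Pow UNIV" "B \<in> sets (riemannian_volume A g)" using B sets by auto
    show "positive (sets (riemannian_volume A g)) \<nu>'"
      by (simp add: positive_def \<nu>'_def)
    show "countably_additive (sets (riemannian_volume A g)) \<nu>'"
    proof (rule countably_additiveI)
      fix S :: "nat \<Rightarrow> 'a set"
      assume S: "range S \<subseteq> sets (riemannian_volume A g)" "disjoint_family S" "(\<Union>i. S i) \<in> sets (riemannian_volume A g)"
      have Sb: "S n \<in> sets borel" for n using S(1) sets by auto
      have "(\<Sum>n. emeasure (chart_measure g (cs ! i)) (S n \<inter> P i)) = emeasure (chart_measure g (cs ! i)) ((\<Union>n. S n) \<inter> P i)"
        if "i < length cs" for i
      proof -
        have "(\<Sum>n. emeasure (chart_measure g (cs ! i)) (S n \<inter> P i)) = emeasure (chart_measure g (cs ! i)) (\<Union>n. S n \<inter> P i)"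
          using Sb P[OF that] S(2) by (intro suminf_emeasure) (auto simp: disjoint_family_on_def)
        then show ?thesis by simp
      qed
      then have "(\<Sum>n. \<nu> (S n)) = \<nu> (\<Union>n. S n)"
        unfolding \<nu>_def by (subst suminf_sum) (auto intro!: sum.cong)
      then show "(\<Sum>n. \<nu>' (S n)) = \<nu>' (\<Union>n. S n)" using \<nu>[OF Sb] \<nu>[of "\<Union>n. S n"] S(3) sets by simp
    qed
  qed
  then have "emeasure (riemannian_volume A g) B = (\<Sum>i<length cs. emeasure (chart_measure g (cs ! i)) (B \<inter> P i))"
    if "B \<in> sets borel" for B using that \<nu>[OF that] by (simp add: \<nu>_def)
  then show ?thesis using that[of cs P] cs sets P by (simp add: P_def)
qed

text \<open>
  For the first chart of the list that meets \<open>U\<close>, no predecessor takes away any part of the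
  intersection.
\<close>
lemma riemannian_volume_open_pos:
  fixes A :: "('a::{t2_space, second_countable_topology}, 'n::finite) chart set"
  assumes M: "compact_riemannian_manifold A g" and U: "open U" "U \<noteq> {}"
  shows "emeasure (riemannian_volume A g) U > 0"
proof -
  have at: "smooth_atlas A" and g: "riemannian_metric A g"
    using M by (auto simp: compact_riemannian_manifold_def)
  have ch: "is_chart c" if "c \<in> A" for c using at that by (auto simp: smooth_atlas_def)
  obtain cs P where cs: "set cs \<subseteq> A" "(\<Union>c\<in>set cs. fst c) = UNIV"
    and P: "\<And>i. P i = fst (cs ! i) - (\<Union>j<i. fst (cs ! j))"
    and vol: "\<And>B. B \<in> sets borel \<Longrightarrow> emeasure (riemannian_volume A g) B = (\<Sum>i<length cs. emeasure (chart_measure g (cs ! i)) (B \<inter> P i))"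
    by (rule riemannian_volume_eq[OF M]) (rule that)
  obtain x where x: "x \<in> U" using U(2) by blast
  then obtain c where "c \<in> set cs" "x \<in> fst c" using cs(2) by blast
  then obtain i0 where i0: "i0 < length cs" "U \<inter> fst (cs ! i0) \<noteq> {}" using x by (metis IntI emptyE in_set_conv_nth)
  define i where "i = (LEAST i. U \<inter> fst (cs ! i) \<noteq> {})"
  have i: "U \<inter> fst (cs ! i) \<noteq> {}" "i \<le> i0"
    unfolding i_def using LeastI[where P = "\<lambda>i. U \<inter> fst (cs ! i) \<noteq> {}", OF i0(2)]
      Least_le[where P = "\<lambda>i. U \<inter> fst (cs ! i) \<noteq> {}", OF i0(2)] by auto
  have "U \<inter> fst (cs ! j) = {}" if "j < i" for j using not_less_Least[OF that[unfolded i_def]] by blast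
  then have UP: "U \<inter> P i = U \<inter> fst (cs ! i)" by (auto simp: P)
  have il: "i < length cs" using i(2) i0(1) by simp
  let ?c = "cs ! i"
  have c: "?c \<in> A" "is_chart ?c" using ch cs(1) il by (meson nth_mem subsetD)+
  let ?O = "snd ?c ` (U \<inter> fst ?c)"
  have O: "open ?O" "?O \<noteq> {}"
    using i(1) U(1) is_chartD(1)[OF c(2)] by (auto intro!: chart_open_image[OF c(2)])
  have "(\<integral>\<^sup>+ y \<in> ?O. ennreal (sqrt (det (g ?c y))) \<partial>lborel) \<noteq> 0"
  proof
    assume zero: "(\<integral>\<^sup>+ y \<in> ?O. ennreal (sqrt (det (g ?c y))) \<partial>lborel) = 0"
    have "continuous_on ?O (vol_density g ?c)"
      by (rule continuous_on_subset[OF vol_density(1)[OF g c(1)]]) auto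
    then have "(\<lambda>y. if y \<in> ?O then vol_density g ?c y else 0) \<in> borel_measurable borel"
      using O(1) by (intro borel_measurable_continuous_on_if) auto
    then have "(\<lambda>y. ennreal (if y \<in> ?O then vol_density g ?c y else 0)) \<in> borel_measurable borel" by simp
    also have "(\<lambda>y. ennreal (if y \<in> ?O then vol_density g ?c y else 0)) = (\<lambda>y. ennreal (sqrt (det (g ?c y))) * indicator ?O y)"
      by (auto simp: fun_eq_iff vol_density_def)
    finally have "AE y in lborel. ennreal (sqrt (det (g ?c y))) * indicator ?O y = 0"
      using zero by (subst (asm) nn_integral_0_iff_AE) simp_all
    then have "AE y in lborel. y \<notin> ?O"
    proof eventually_elim
      case (elim y)
      show ?case
      proof
        assume y: "y \<in> ?O"
        then have "vol_density g ?c y > 0" by (intro vol_density(2)[OF g c(1)]) auto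
        then show False using elim y by (simp add: vol_density_def)
      qed
    qed
    then have "?O \<in> null_sets lborel" using O(1) by (simp add: AE_iff_null_sets)
    then have "negligible ?O" by (simp add: negligible_iff_null_sets null_sets_completionI)
    then show False using open_not_negligible O by blast
  qed
  then have "0 < emeasure (chart_measure g ?c) (U \<inter> P i)"
    unfolding UP using U(1) is_chartD(1)[OF c(2)]
    by (subst emeasure_chart_measure[OF g c]) (auto simp: zero_less_iff_neq_zero)
  also have "\<dots> \<le> emeasure (riemannian_volume A g) U"
    using U(1) il by (subst vol) (auto intro!: member_le_sum)
  finally show ?thesis .
qed

text \<open>
  The pieces on which both the density and the coordinates of the respective chart are bounded
  have finite volume.
\<close>
lemma sigma_finite_riemannian_volume:
  fixes A :: "('a::{t2_space, second_countable_topology}, 'n::finite) chart set"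
  assumes M: "compact_riemannian_manifold A g"
  shows "sigma_finite_measure (riemannian_volume A g)"
proof -
  have at: "smooth_atlas A" and g: "riemannian_metric A g"
    using M by (auto simp: compact_riemannian_manifold_def)
  have ch: "is_chart c" if "c \<in> A" for c using at that by (auto simp: smooth_atlas_def)
  obtain cs P where cs: "set cs \<subseteq> A" "(\<Union>c\<in>set cs. fst c) = UNIV"
    and P: "\<And>i. P i = fst (cs ! i) - (\<Union>j<i. fst (cs ! j))"
    and sets: "sets (riemannian_volume A g) = sets borel"
    and vol: "\<And>B. B \<in> sets borel \<Longrightarrow> emeasure (riemannian_volume A g) B = (\<Sum>i<length cs. emeasure (chart_measure g (cs ! i)) (B \<inter> P i))"
    and Pb: "\<And>i. i < length cs \<Longrightarrow> P i \<in> sets borel"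
    by (rule riemannian_volume_eq[OF M]) (rule that)
  have csA: "cs ! i \<in> A" if "i < length cs" for i using cs that by (meson nth_mem subsetD)
  define T where "T i k = {y \<in> snd (cs ! i) ` fst (cs ! i). vol_density g (cs ! i) y \<le> real k \<and> norm y \<le> real k}" for i k
  define S where "S i k = P i \<inter> (snd (cs ! i) -` T i k \<inter> fst (cs ! i))" for i k
  have Sb: "S i k \<in> sets borel" if i: "i < length cs" for i k
  proof -
    let ?c = "cs ! i"
    note c = ch[OF csA[OF i]]
    have "(\<lambda>y. vol_density g ?c y) \<in> borel_measurable (restrict_space borel (snd ?c ` fst ?c))"
      by (rule borel_measurable_continuous_on_restrict[OF vol_density(1)[OF g csA[OF i]]])
    moreover have "(\<lambda>y. norm y) \<in> borel_measurable (restrict_space borel (snd ?c ` fst ?c))"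
      by (intro measurable_restrict_space1) simp
    ultimately have "{y \<in> space (restrict_space borel (snd ?c ` fst ?c)). vol_density g ?c y \<le> real k \<and> norm y \<le> real k}
      \<in> sets (restrict_space borel (snd ?c ` fst ?c))" by measurable
    then have "T i k \<in> sets borel"
      using is_chartD(2)[OF c] by (simp add: space_restrict_space T_def sets_restrict_space_iff)
    then have "snd ?c -` T i k \<inter> space (restrict_space borel (fst ?c)) \<in> sets (restrict_space borel (fst ?c))"
      by (rule measurable_sets[OF borel_measurable_continuous_on_restrict[OF is_chartD(7)[OF c]]])
    then have "snd ?c -` T i k \<inter> fst ?c \<in> sets borel"
      using is_chartD(1)[OF c] by (simp add: space_restrict_space sets_restrict_space_iff)
    then show ?thesis unfolding S_def using Pb[OF i] by blast
  qed
  have fin: "emeasure (riemannian_volume A g) (S i k) \<noteq> \<infinity>" if i: "i < length cs" for i k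
  proof -
    have "emeasure (chart_measure g (cs ! j)) (S i k \<inter> P j) < top" if j: "j < length cs" for j
    proof (cases "j = i")
      case True
      have "S i k \<inter> P i = S i k" by (auto simp: S_def)
      then have "emeasure (chart_measure g (cs ! i)) (S i k \<inter> P i)
        = (\<integral>\<^sup>+ y \<in> snd (cs ! i) ` S i k. ennreal (sqrt (det (g (cs ! i) y))) \<partial>lborel)"
        using emeasure_chart_measure[OF g csA[OF i] ch[OF csA[OF i]] Sb[OF i]] by (auto simp: S_def)
      also have "\<dots> \<le> (\<integral>\<^sup>+ y \<in> cball (0 :: real ^ 'n) (real k). ennreal (real k) \<partial>lborel)"
      proof (rule nn_integral_mono)
        fix y
        have "y \<in> T i k" if "y \<in> snd (cs ! i) ` S i k" using that by (auto simp: S_def)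
        then show "ennreal (sqrt (det (g (cs ! i) y))) * indicator (snd (cs ! i) ` S i k) y
          \<le> ennreal (real k) * indicator (cball 0 (real k)) y"
          by (auto simp: indicator_def T_def vol_density_def ennreal_leI)
      qed
      also have "\<dots> < top"
        by (simp add: nn_integral_cmult_indicator ennreal_mult_less_top emeasure_bounded_finite[unfolded infinity_ennreal_def])
      finally show ?thesis using True by simp
    next
      case False
      have "P i \<inter> P j = {}" using False by (cases "i < j") (auto simp: P)
      then have "S i k \<inter> P j = {}" by (auto simp: S_def)
      then show ?thesis by simp
    qed
    then have "(\<Sum>j<length cs. emeasure (chart_measure g (cs ! j)) (S i k \<inter> P j)) < top"
      by (subst ennreal_sum_less_top) auto
    then show ?thesis unfolding vol[OF Sb[OF i]] infinity_ennreal_def by (rule less_imp_neq)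
  qed
  have un: "\<Union> ((\<lambda>(i, k). S i k) ` ({..<length cs} \<times> UNIV)) = UNIV"
  proof -
    have "x \<in> \<Union> ((\<lambda>(i, k). S i k) ` ({..<length cs} \<times> UNIV))" for x
    proof -
      have "\<exists>i. i < length cs \<and> x \<in> fst (cs ! i)" using cs(2) by (metis UNIV_I UN_iff in_set_conv_nth)
      then obtain i where i: "i < length cs" "x \<in> fst (cs ! i)" "\<And>j. j < i \<Longrightarrow> \<not> (j < length cs \<and> x \<in> fst (cs ! j))"
        unfolding exists_least_iff[of "\<lambda>i. i < length cs \<and> x \<in> fst (cs ! i)"] by blast
      then have "x \<in> P i" by (auto simp: P)
      obtain k :: nat where "max (vol_density g (cs ! i) (snd (cs ! i) x)) (norm (snd (cs ! i) x)) \<le> real k"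
        using real_arch_simple by blast
      then have "x \<in> S i k" using \<open>x \<in> P i\<close> i(2) by (auto simp: S_def T_def)
      then show ?thesis using i(1) by (intro UnionI[of "S i k"]) (auto simp: image_iff)
    qed
    then show ?thesis by blast
  qed
  show ?thesis
  proof
    let ?S = "(\<lambda>(i, k). S i k) ` ({..<length cs} \<times> UNIV)"
    show "\<exists>S. countable S \<and> S \<subseteq> sets (riemannian_volume A g) \<and> \<Union> S = space (riemannian_volume A g) \<and>
        (\<forall>a\<in>S. emeasure (riemannian_volume A g) a \<noteq> \<infinity>)"
    proof (intro exI[of _ ?S] conjI ballI)
      show "countable ?S" by (intro countable_image countable_SIGMA) auto
      show "?S \<subseteq> sets (riemannian_volume A g)" unfolding sets using Sb by (intro image_subsetI) auto
      show "\<Union> ?S = space (riemannian_volume A g)" unfolding un sets_eq_imp_space_eq[OF sets] by simp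
      show "emeasure (riemannian_volume A g) a \<noteq> \<infinity>" if "a \<in> ?S" for a
        using that fin by (elim imageE) (simp add: split_beta' mem_Times_iff)
    qed
  qed
qed

section \<open>A chart in which the embedding is affine\<close>

lemma manifold_chartD:
  assumes M: "compact_riemannian_manifold A g"
  shows "c \<in> A \<Longrightarrow> is_chart c"
    and "c \<in> A \<Longrightarrow> d \<in> A \<Longrightarrow> smooth_on (snd c ` (fst c \<inter> fst d)) (snd d \<circ> chart_inv c)"
    and "\<exists>c\<in>A. x \<in> fst c"
proof -
  have at: "smooth_atlas A" using M by (simp add: compact_riemannian_manifold_def)
  then show "c \<in> A \<Longrightarrow> is_chart c"
    "c \<in> A \<Longrightarrow> d \<in> A \<Longrightarrow> smooth_on (snd c ` (fst c \<inter> fst d)) (snd d \<circ> chart_inv c)"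
    unfolding smooth_atlas_def by blast+
  have "x \<in> (\<Union>c\<in>A. fst c)" using at unfolding smooth_atlas_def by simp
  then show "\<exists>c\<in>A. x \<in> fst c" by blast
qed

lemma C1_near_transition:
  assumes M: "compact_riemannian_manifold A g" and "c \<in> A" "d \<in> A" "x \<in> fst c" "x \<in> fst d"
  shows "C1_near (snd d \<circ> chart_inv c) (snd c x)"
proof (rule smooth_on_imp_C1_near[OF manifold_chartD(2)[OF M assms(2,3)]])
  show "open (snd c ` (fst c \<inter> fst d))"
    using is_chartD(1)[OF manifold_chartD(1)[OF M assms(2)]] is_chartD(1)[OF manifold_chartD(1)[OF M assms(3)]]
    by (intro chart_open_image[OF manifold_chartD(1)[OF M assms(2)]]) auto
qed (use assms in auto)

lemma C1_near_embedding:
  assumes M: "compact_riemannian_manifold A g" and e: "smooth_embedding A e" and "c \<in> A" "x \<in> fst c"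
  shows "C1_near (e \<circ> chart_inv c) (snd c x)"
proof (rule smooth_on_imp_C1_near)
  show "smooth_on (snd c ` fst c) (e \<circ> chart_inv c)" using e assms(3) unfolding smooth_embedding_def by blast
  show "open (snd c ` fst c)" by (rule is_chartD(2)[OF manifold_chartD(1)[OF M assms(3)]])
qed (use assms in auto)

lemma continuous_embedding:
  assumes M: "compact_riemannian_manifold A g" and e: "smooth_embedding A e"
  shows "continuous_on UNIV e"
proof (rule continuous_at_imp_continuous_on, rule ballI)
  fix x
  obtain c where c: "c \<in> A" "x \<in> fst c" using manifold_chartD(3)[OF M] by blast
  note ch = is_chartD[OF manifold_chartD(1)[OF M c(1)]]
  have "isCont (snd c) x" using ch(1,7) c(2) by (simp add: continuous_on_eq_continuous_at)
  then have "isCont ((e \<circ> chart_inv c) \<circ> snd c) x"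
    using C1_near_isCont[OF C1_near_embedding[OF M e c]] by (rule continuous_at_compose)
  moreover have "\<forall>\<^sub>F x' in nhds x. ((e \<circ> chart_inv c) \<circ> snd c) x' = e x'"
    unfolding eventually_nhds using ch(1,4) c(2) by (intro exI[of _ "fst c"]) auto
  ultimately show "isCont e x" by (simp add: isCont_cong)
qed

text \<open>
  Coordinates on an open set \<open>param ` ball 0 4\<close> which are the restriction of the globally defined map
  \<open>x \<mapsto> L (e x) - k0\<close>, an affine function of the embedding. The distance of two maps and of their
  derivatives, measured after composition with \<open>e\<close>, is therefore inherited by the coordinate
  expressions.
\<close>
locale adapted_chart =
  fixes A :: "('a::{t2_space, second_countable_topology}, 'n::finite) chart set"
    and g :: "('a, 'n) chart \<Rightarrow> real ^ 'n \<Rightarrow> real ^ 'n ^ 'n"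
    and e :: "'a \<Rightarrow> 'b::euclidean_space"
    and c0 :: "('a, 'n) chart" and L :: "'b \<Rightarrow> real ^ 'n" and k0 :: "real ^ 'n" and param :: "real ^ 'n \<Rightarrow> 'a"
  assumes manifold: "compact_riemannian_manifold A g" and embedding: "smooth_embedding A e"
    and c0: "c0 \<in> A" and L: "bounded_linear L"
    and continuous_param: "continuous_on (ball 0 4) param"
    and open_W: "open (param ` ball 0 4)" and W_c0: "param ` ball 0 4 \<subseteq> fst c0"
    and affine: "\<And>y. y \<in> ball 0 4 \<Longrightarrow> L (e (param y)) - k0 = y"
    and C1_param: "\<And>y. y \<in> ball 0 4 \<Longrightarrow> C1_near (snd c0 \<circ> param) y"

text \<open>
  Compose the embedding with a linear left inverse of its differential at one point. In any chart
  the derivative of the composition at this point is the identity, so the inverse function theorem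
  applies; a dilation brings the radius to 4.
\<close>
lemma adapted_chart_exists:
  fixes A :: "('a::{t2_space, second_countable_topology}, 'n::finite) chart set"
  assumes M: "compact_riemannian_manifold A g" and e: "smooth_embedding A e"
  shows "\<exists>c0 L k0 param. adapted_chart A g e c0 L k0 param"
proof -
  obtain p :: 'a where True by blast
  obtain c where c: "c \<in> A" "p \<in> fst c" using manifold_chartD(3)[OF M] by blast
  note isc = manifold_chartD(1)[OF M c(1)]
  note ch = is_chartD[OF isc]
  define y0 where "y0 = snd c p"
  have y0: "y0 \<in> snd c ` fst c" using c(2) by (simp add: y0_def)
  define E where "E = e \<circ> chart_inv c"
  have E: "C1_near E y0" unfolding E_def y0_def by (rule C1_near_embedding[OF M e c])
  have "inj (frechet_derivative E (at y0))"
    using e c unfolding smooth_embedding_def chart_deriv_def E_def y0_def by blast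
  moreover have "linear (frechet_derivative E (at y0))"
    using C1_near_has_derivative[OF E] by (rule has_derivative_linear)
  ultimately obtain L0 where L0: "linear L0" "L0 \<circ> frechet_derivative E (at y0) = id"
    using linear_injective_left_inverse by blast
  have bl: "bounded_linear L0" using L0(1) by (simp add: linear_conv_bounded_linear)
  define f where "f = L0 \<circ> E"
  have f: "C1_near f y0" unfolding f_def by (rule C1_near_compose[OF E C1_near_bounded_linear[OF bl]])
  have "(f has_derivative (L0 \<circ> frechet_derivative E (at y0))) (at y0)"
    unfolding f_def by (rule diff_chain_at[OF C1_near_has_derivative[OF E] bounded_linear_imp_has_derivative[OF bl]])
  then have "frechet_derivative f (at y0) = id" unfolding L0(2) by (rule frechet_derivative_at[symmetric])
  then have "inj (frechet_derivative f (at y0))" by simp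
  then obtain U V h where UV: "open U" "U \<subseteq> snd c ` fst c" "y0 \<in> U" "open V" "f y0 \<in> V" "homeomorphism U V f h"
    "\<And>y. y \<in> V \<Longrightarrow> C1_near h y"
    using C1_local_inverse[OF f _ ch(2) y0] by metis
  define k where "k = f y0"
  obtain r where r: "r > 0" "ball k r \<subseteq> V" using openE[OF UV(4,5)] by (metis k_def)
  define s where "s = 4 / r"
  have s: "s > 0" "r = 4 / s" using r by (auto simp: s_def)
  define sh where "sh y = k + (1 / s) *\<^sub>R y" for y
  have sh: "sh y \<in> ball k r" if "y \<in> ball 0 4" for y
    using that s r(1) by (simp add: sh_def dist_norm divide_strict_right_mono)
  have sh_inv: "ball k r = sh ` ball 0 4"
  proof
    show "sh ` ball 0 4 \<subseteq> ball k r" using sh by blast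
    show "ball k r \<subseteq> sh ` ball 0 4"
    proof
      fix z assume z: "z \<in> ball k r"
      have "z = sh (s *\<^sub>R (z - k))" using s by (simp add: sh_def)
      moreover have "s * norm (z - k) < s * r" using z s(1) by (intro mult_strict_left_mono) (auto simp: dist_norm norm_minus_commute)
      then have "s *\<^sub>R (z - k) \<in> ball 0 4" using s by simp
      ultimately show "z \<in> sh ` ball 0 4" by blast
    qed
  qed
  define param where "param y = chart_inv c (h (sh y))" for y
  have hV: "h y \<in> U" "f (h y) = y" if "y \<in> V" for y
    using UV(6) that by (auto simp: homeomorphism_def)
  have hs: "h (sh y) \<in> U" "f (h (sh y)) = sh y" if "y \<in> ball 0 4" for y
    using hV sh[OF that] r(2) by auto
  have cont_sh: "continuous_on S sh" for S unfolding sh_def by (intro continuous_intros)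
  have W: "param ` ball 0 4 = chart_inv c ` h ` ball k r" unfolding param_def sh_inv by (simp add: image_image)
  have "adapted_chart A g e c (\<lambda>z. s *\<^sub>R L0 z) (s *\<^sub>R k) param"
  proof (rule adapted_chart.intro)
    show "compact_riemannian_manifold A g" "smooth_embedding A e" "c \<in> A" by (rule M, rule e, rule c)
    show "bounded_linear (\<lambda>z. s *\<^sub>R L0 z)" by (rule bounded_linear_compose[OF bounded_linear_scaleR_right bl])
    show "continuous_on (ball 0 4) param"
      unfolding param_def
    proof (rule continuous_on_compose2[OF ch(8)])
      have "continuous_on V h" using UV(6) by (simp add: homeomorphism_def)
      then show "continuous_on (ball 0 4) (\<lambda>y. h (sh y))"
        by (rule continuous_on_compose2[OF _ cont_sh]) (use sh r(2) in blast)
      show "(\<lambda>y. h (sh y)) ` ball 0 4 \<subseteq> snd c ` fst c" using hs(1) UV(2) by blast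
    qed
    show "open (param ` ball 0 4)"
    proof -
      have "h ` ball k r = U \<inter> f -` ball k r"
        using UV(6) r(2) by (force simp: homeomorphism_def)
      moreover have "continuous_on U f" using UV(6) by (simp add: homeomorphism_def)
      ultimately have o: "open (h ` ball k r)" using UV(1) by (simp add: continuous_on_open_vimage Int_commute)
      have sub: "h ` ball k r \<subseteq> snd c ` fst c" using hV(1) r(2) UV(2) by blast
      have "chart_inv c ` h ` ball k r = snd c -` (h ` ball k r) \<inter> fst c"
      proof (intro set_eqI iffI)
        fix x assume "x \<in> chart_inv c ` h ` ball k r"
        then obtain z where z: "z \<in> h ` ball k r" "x = chart_inv c z" by blast
        then have "z \<in> snd c ` fst c" using sub by blast
        then show "x \<in> snd c -` (h ` ball k r) \<inter> fst c" using z ch(5,6)[of z] by simp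
      next
        fix x assume x: "x \<in> snd c -` (h ` ball k r) \<inter> fst c"
        then have "x = chart_inv c (snd c x)" using ch(4)[of x] by simp
        then show "x \<in> chart_inv c ` h ` ball k r" using x by blast
      qed
      then show ?thesis unfolding W using ch(1,7) o by (simp add: continuous_on_open_vimage)
    qed
    show "param ` ball 0 4 \<subseteq> fst c"
      unfolding param_def using hs(1) UV(2) ch(6) by blast
    show "s *\<^sub>R L0 (e (param y)) - s *\<^sub>R k = y" if y: "y \<in> ball 0 4" for y
    proof -
      have "L0 (e (param y)) = sh y" using hs(2)[OF y] by (simp add: param_def f_def E_def)
      then show ?thesis using s by (simp add: sh_def scaleR_add_right)
    qed
    show "C1_near (snd c \<circ> param) y" if y: "y \<in> ball 0 4" for y
    proof (rule C1_near_transform[OF _ open_ball y])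
      have "C1_near (\<lambda>y. (1 / s) *\<^sub>R y - (- k)) y"
        by (rule C1_near_affine) (rule bounded_linear_scaleR_right)
      then have "C1_near sh y" unfolding sh_def by (simp add: add.commute)
      then show "C1_near (h \<circ> sh) y" by (rule C1_near_compose) (use UV(7) sh[OF y] r(2) in blast)
      fix y' :: "real ^ 'n" assume "y' \<in> ball 0 4"
      then have "h (sh y') \<in> snd c ` fst c" using hs(1) UV(2) by blast
      then show "(h \<circ> sh) y' = (snd c \<circ> param) y'" using ch(5) by (simp add: param_def)
    qed
  qed
  then show ?thesis by blast
qed

context adapted_chart
begin

definition coord :: "'a \<Rightarrow> real ^ 'n" where "coord x = L (e x) - k0"

abbreviation W :: "'a set" where "W \<equiv> param ` ball 0 4"

abbreviation K :: "'a set" where "K \<equiv> param ` cball 0 3"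

lemma coord_param: "norm y < 4 \<Longrightarrow> coord (param y) = y"
  using affine[of y] by (simp add: coord_def)

lemma param_coord: "x \<in> W \<Longrightarrow> param (coord x) = x" "x \<in> W \<Longrightarrow> norm (coord x) < 4"
  using coord_param by auto

lemma compact_M: "compact (UNIV :: 'a set)"
  using manifold by (simp add: compact_riemannian_manifold_def)

lemma continuous_e: "continuous_on S e"
  by (rule continuous_on_subset[OF continuous_embedding[OF manifold embedding]]) simp

lemma inj_e: "inj e" using embedding by (simp add: smooth_embedding_def)

lemma continuous_coord: "continuous_on S coord"
  unfolding coord_def
  by (intro continuous_intros bounded_linear.continuous_on[OF L] continuous_e)

lemma K_W: "K \<subseteq> W" by (intro image_mono) auto

lemma compact_K: "compact K"
  by (intro compact_continuous_image continuous_on_subset[OF continuous_param]) auto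

lemma closed_K: "closed K" by (rule compact_imp_closed[OF compact_K])

lemma open_param_image:
  assumes "open S" "S \<subseteq> ball 0 4"
  shows "open (param ` S)"
proof -
  have "param ` S = W \<inter> coord -` S"
  proof (intro set_eqI iffI)
    fix x assume "x \<in> param ` S"
    then obtain y where y: "x = param y" "y \<in> S" by blast
    then have "y \<in> ball 0 4" using assms(2) by blast
    then show "x \<in> W \<inter> coord -` S" using y coord_param[of y] by simp
  next
    fix x assume x: "x \<in> W \<inter> coord -` S"
    then have "x = param (coord x)" using param_coord(1)[of x] by simp
    then show "x \<in> param ` S" using x by blast
  qed
  moreover have "open (coord -` S)" using continuous_coord[of UNIV] assms(1) by (simp add: continuous_on_open_vimage)
  ultimately show ?thesis using open_W by auto
qed

lemma chart: "c \<in> A \<Longrightarrow> is_chart c" by (rule manifold_chartD(1)[OF manifold])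

lemma C1_chart_param:
  assumes d: "d \<in> A" and y: "norm y < 4" "param y \<in> fst d"
  shows "C1_near (snd d \<circ> param) y"
proof (rule C1_near_transform[of _ _ "ball 0 4"])
  have yW: "param y \<in> fst c0" using W_c0 y by auto
  have "C1_near (snd d \<circ> chart_inv c0) ((snd c0 \<circ> param) y)"
    using C1_near_transition[OF manifold c0 d yW y(2)] by simp
  then show "C1_near ((snd d \<circ> chart_inv c0) \<circ> (snd c0 \<circ> param)) y"
    using C1_param y(1) by (intro C1_near_compose) auto
  fix y' :: "real ^ 'n" assume "y' \<in> ball 0 4"
  then have "param y' \<in> fst c0" using W_c0 by auto
  then show "((snd d \<circ> chart_inv c0) \<circ> (snd c0 \<circ> param)) y' = (snd d \<circ> param) y'"
    using is_chartD(4)[OF chart[OF c0]] by simp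
qed (use y in auto)

lemma C1_coord_chart:
  assumes c: "c \<in> A" "x \<in> fst c"
  shows "C1_near (coord \<circ> chart_inv c) (snd c x)"
proof -
  have "C1_near ((\<lambda>z. L z - k0) \<circ> (e \<circ> chart_inv c)) (snd c x)"
    by (rule C1_near_compose[OF C1_near_embedding[OF manifold embedding c] C1_near_affine[OF L]])
  then show ?thesis by (simp add: o_def coord_def)
qed

section \<open>Transplanting diffeomorphisms to the manifold\<close>

text \<open>
  A diffeomorphism of Euclidean space that is the identity outside the ball of radius 3 acts on the
  manifold through the adapted coordinates; the gap between the radii 3 and 4 leaves room to glue
  it with the identity.
\<close>
definition transplant :: "(real ^ 'n \<Rightarrow> real ^ 'n) \<Rightarrow> 'a \<Rightarrow> 'a" where
  "transplant \<Theta> x = (if x \<in> W then param (\<Theta> (coord x)) else x)"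

definition supported :: "(real ^ 'n \<Rightarrow> real ^ 'n) \<Rightarrow> bool" where
  "supported \<Theta> \<longleftrightarrow> (\<forall>y. C1_near \<Theta> y) \<and> (\<forall>y. norm y \<ge> 3 \<longrightarrow> \<Theta> y = y) \<and> (\<forall>y. norm y < 3 \<longrightarrow> norm (\<Theta> y) < 3)"

lemma supported_ball: "supported \<Theta> \<Longrightarrow> norm y < 4 \<Longrightarrow> norm (\<Theta> y) < 4"
proof (cases "norm y < 3")
  case True
  assume "supported \<Theta>"
  then have "norm (\<Theta> y) < 3" using True unfolding supported_def by blast
  then show ?thesis by simp
qed (simp add: supported_def)

lemma transplant_param: "norm y < 4 \<Longrightarrow> transplant \<Theta> (param y) = param (\<Theta> y)"
  by (simp add: transplant_def coord_param)

lemma transplant_outside: "supported \<Theta> \<Longrightarrow> x \<notin> K \<Longrightarrow> transplant \<Theta> x = x"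
proof (cases "x \<in> W")
  case True
  assume \<Theta>: "supported \<Theta>" "x \<notin> K"
  have "norm (coord x) > 3"
  proof (rule ccontr)
    assume "\<not> norm (coord x) > 3"
    then have "param (coord x) \<in> K" by (intro imageI) simp
    then show False using \<Theta>(2) param_coord(1)[OF True] by simp
  qed
  then have "\<Theta> (coord x) = coord x" using \<Theta>(1) by (simp add: supported_def)
  then show "transplant \<Theta> x = x" using True param_coord(1)[OF True] by (simp add: transplant_def)
qed (simp add: transplant_def)

lemma supported_continuous: "supported \<Theta> \<Longrightarrow> continuous_on S \<Theta>"
  unfolding supported_def by (intro continuous_at_imp_continuous_on ballI C1_near_isCont) blast

lemma open_cover: "open (- K)" "W \<union> - K = UNIV"
  using closed_K K_W by auto

lemma continuous_transplant:
  assumes \<Theta>: "supported \<Theta>"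
  shows "continuous_on UNIV (transplant \<Theta>)"
proof -
  have "continuous_on W (\<lambda>x. param (\<Theta> (coord x)))"
  proof (rule continuous_on_compose2[OF continuous_param])
    show "continuous_on W (\<lambda>x. \<Theta> (coord x))"
      by (rule continuous_on_compose2[OF supported_continuous[OF \<Theta>, of UNIV] continuous_coord]) simp
    show "(\<lambda>x. \<Theta> (coord x)) ` W \<subseteq> ball 0 4"
      using supported_ball[OF \<Theta>] param_coord(2) by auto
  qed
  then have "continuous_on W (transplant \<Theta>)"
    by (rule continuous_on_eq) (simp add: transplant_def)
  moreover have "continuous_on (- K) (transplant \<Theta>)"
    by (rule continuous_on_eq[OF continuous_on_id]) (simp add: transplant_outside[OF \<Theta>])
  ultimately show ?thesis using continuous_on_open_Un[OF open_W open_cover(1)] open_cover(2) by metis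
qed

text \<open>
  Near a point of \<open>W\<close> the map is a composition of continuously differentiable coordinate expressions;
  the other points lie outside the closed set \<open>K\<close>, where the map is locally the identity.
\<close>
lemma C1_map_on_transplant:
  assumes \<Theta>: "supported \<Theta>"
  shows "C1_map_on A UNIV (transplant \<Theta>)"
  unfolding C1_map_on_def
proof (intro conjI continuous_transplant[OF \<Theta>] ballI)
  fix c d assume c: "c \<in> A" and d: "d \<in> A"
  note cc = is_chartD[OF chart[OF c]] and dd = is_chartD[OF chart[OF d]]
  let ?S = "fst c \<inter> UNIV \<inter> transplant \<Theta> -` fst d"
  have "open (transplant \<Theta> -` fst d)"
    using continuous_transplant[OF \<Theta>] dd(1) by (simp add: continuous_on_open_vimage)
  then have "open (snd c ` ?S)" using cc(1) by (intro chart_open_image[OF chart[OF c]]) auto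
  moreover have "C1_near (snd d \<circ> transplant \<Theta> \<circ> chart_inv c) (snd c x)" if x: "x \<in> ?S" for x
  proof (cases "x \<in> W")
    case True
    have xc: "x \<in> fst c" using x by simp
    have th: "norm (\<Theta> (coord x)) < 4" using supported_ball[OF \<Theta> param_coord(2)[OF True]] .
    have "param (\<Theta> (coord x)) \<in> fst d" using x True by (simp add: transplant_def)
    then have "C1_near (snd d \<circ> param) ((\<Theta> \<circ> (coord \<circ> chart_inv c)) (snd c x))"
      using C1_chart_param[OF d th] cc(4)[OF xc] by simp
    moreover have "C1_near \<Theta> ((coord \<circ> chart_inv c) (snd c x))" using \<Theta> by (simp add: supported_def)
    ultimately have C: "C1_near ((snd d \<circ> param) \<circ> (\<Theta> \<circ> (coord \<circ> chart_inv c))) (snd c x)"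
      by (intro C1_near_compose C1_coord_chart c xc)
    show ?thesis
    proof (rule C1_near_transform[OF C, of "snd c ` (fst c \<inter> W)"])
      show "open (snd c ` (fst c \<inter> W))" using cc(1) open_W by (intro chart_open_image[OF chart[OF c]]) auto
      show "snd c x \<in> snd c ` (fst c \<inter> W)" using xc True by blast
      fix z assume "z \<in> snd c ` (fst c \<inter> W)"
      then obtain x' where "z = snd c x'" "x' \<in> fst c" "x' \<in> W" by blast
      then show "((snd d \<circ> param) \<circ> (\<Theta> \<circ> (coord \<circ> chart_inv c))) z = (snd d \<circ> transplant \<Theta> \<circ> chart_inv c) z"
        using cc(4)[of x'] by (simp add: transplant_def)
    qed
  next
    case False
    have xc: "x \<in> fst c" using x by simp
    have xK: "x \<in> - K" using False K_W by blast
    then have "x \<in> fst d" using x transplant_outside[OF \<Theta>, of x] by simp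
    then have C: "C1_near (snd d \<circ> chart_inv c) (snd c x)" by (rule C1_near_transition[OF manifold c d xc])
    show ?thesis
    proof (rule C1_near_transform[OF C, of "snd c ` (fst c \<inter> - K)"])
      show "open (snd c ` (fst c \<inter> - K))" using cc(1) open_cover(1) by (intro chart_open_image[OF chart[OF c]]) auto
      show "snd c x \<in> snd c ` (fst c \<inter> - K)" using xc xK by blast
      fix z assume "z \<in> snd c ` (fst c \<inter> - K)"
      then obtain x' where "z = snd c x'" "x' \<in> fst c" "x' \<notin> K" by blast
      then show "(snd d \<circ> chart_inv c) z = (snd d \<circ> transplant \<Theta> \<circ> chart_inv c) z"
        using cc(4)[of x'] transplant_outside[OF \<Theta>, of x'] by simp
    qed
  qed
  ultimately show "C_on 1 (snd c ` ?S) (snd d \<circ> transplant \<Theta> \<circ> chart_inv c)"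
    by (subst C_on_1_iff) auto
qed

lemma transplant_inverse:
  assumes "supported \<Theta>" "supported \<Theta>'" "\<And>y. \<Theta>' (\<Theta> y) = y"
  shows "transplant \<Theta>' (transplant \<Theta> x) = x"
proof (cases "x \<in> W")
  case True
  then have "norm (\<Theta> (coord x)) < 4" using supported_ball[OF assms(1)] param_coord(2) by blast
  then show ?thesis using True assms(3) param_coord(1)[OF True] transplant_param
    by (simp add: transplant_def[of \<Theta>])
qed (simp add: transplant_def)

lemma C1_diffeo_transplant:
  assumes "supported \<Theta>" "supported \<Theta>'" "\<And>y. \<Theta>' (\<Theta> y) = y" "\<And>y. \<Theta> (\<Theta>' y) = y"
  shows "C1_diffeo_onto_image A (transplant \<Theta>)" and "inv (transplant \<Theta>) = transplant \<Theta>'"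
proof -
  note i1 = transplant_inverse[OF assms(1,2,3)] and i2 = transplant_inverse[OF assms(2,1,4)]
  have bij: "bij (transplant \<Theta>)" by (rule bijI') (metis i1, metis i2)
  show inv: "inv (transplant \<Theta>) = transplant \<Theta>'" by (rule inv_equality[OF i1 i2])
  show "C1_diffeo_onto_image A (transplant \<Theta>)"
    unfolding C1_diffeo_onto_image_def inv
    using bij assms C1_map_on_transplant by (simp add: bij_is_inj bij_is_surj)
qed

lemma supported_push:
  fixes c :: "real ^ 'n"
  assumes "0 \<le> \<epsilon>" "\<epsilon> \<le> 1 / 100" "norm c \<le> 1"
  shows "supported (push \<epsilon> c)" "supported (inv (push \<epsilon> c))"
proof -
  note bij = bij_push[OF assms]
  have out: "push \<epsilon> c y = y" if "norm y \<ge> 3" for y using push_outside[OF that] .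
  have "norm (push \<epsilon> c y) < 3" if "norm y < 3" for y
  proof (rule ccontr)
    assume "\<not> norm (push \<epsilon> c y) < 3"
    then have "push \<epsilon> c (push \<epsilon> c y) = push \<epsilon> c y" by (intro out) simp
    then have "push \<epsilon> c y = y" using bij by (metis bij_is_inj injD)
    then show False using that \<open>\<not> norm (push \<epsilon> c y) < 3\<close> by simp
  qed
  then show "supported (push \<epsilon> c)" unfolding supported_def using out C1_near_push by blast
  have "norm (inv (push \<epsilon> c) z) < 3" if "norm z < 3" for z
  proof (rule ccontr)
    assume n: "\<not> norm (inv (push \<epsilon> c) z) < 3"
    then have "push \<epsilon> c (inv (push \<epsilon> c) z) = inv (push \<epsilon> c) z" by (intro out) simp
    then have "z = inv (push \<epsilon> c) z" using bij by (simp add: bij_is_surj surj_f_inv_f)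
    then show False using that n by simp
  qed
  then show "supported (inv (push \<epsilon> c))"
    unfolding supported_def using inv_push_outside[OF assms] C1_near_inv_push[OF assms] by blast
qed

text \<open>
  For suitable \<open>\<epsilon>\<close> and \<open>\<tau>\<close> all small perturbations of this skew product have a massive attractor.
\<close>
definition model :: "nat \<Rightarrow> real \<Rightarrow> (circle \<Rightarrow> real ^ 'n) \<Rightarrow> circle \<times> 'a \<Rightarrow> circle \<times> 'a" where
  "model m \<epsilon> \<tau> = (\<lambda>(\<phi>, x). (expanding_map m \<phi>, transplant (push \<epsilon> (\<tau> \<phi>)) x))"

lemma fiber_map_model: "fiber_map (model m \<epsilon> \<tau>) \<phi> = transplant (push \<epsilon> (\<tau> \<phi>))"
  by (simp add: fiber_map_def model_def fun_eq_iff)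

lemma inv_push:
  assumes "0 \<le> \<epsilon>" "\<epsilon> \<le> 1 / 100" "norm c \<le> 1"
  shows "inv (push \<epsilon> c) (push \<epsilon> c y) = y" "push \<epsilon> c (inv (push \<epsilon> c) y) = y"
  using bij_push[OF assms] by (auto simp: bij_is_inj bij_is_surj surj_f_inv_f)

lemma model_in_skew_products:
  assumes \<epsilon>: "0 \<le> \<epsilon>" "\<epsilon> \<le> 1 / 100" and \<tau>: "continuous_on UNIV \<tau>" "\<And>\<phi>. norm (\<tau> \<phi>) \<le> 1"
  shows "model m \<epsilon> \<tau> \<in> skew_products A m"
  unfolding skew_products_def
proof (intro CollectI exI conjI allI)
  let ?f = "\<lambda>\<phi>. transplant (push \<epsilon> (\<tau> \<phi>))"
  show "model m \<epsilon> \<tau> = (\<lambda>(\<phi>, x). (expanding_map m \<phi>, ?f \<phi> x))" by (simp add: model_def)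
  show "C1_diffeo_onto_image A (?f \<phi>)" for \<phi>
    by (rule C1_diffeo_transplant(1)[OF supported_push[OF \<epsilon> \<tau>(2)] inv_push[OF \<epsilon> \<tau>(2)]])
  let ?F = "\<lambda>p. ?f (fst p) (snd p)"
  have "continuous_on (UNIV \<times> W) (\<lambda>p. param (push \<epsilon> (\<tau> (fst p)) (coord (snd p))))"
  proof (rule continuous_on_compose2[OF continuous_param])
    show "continuous_on (UNIV \<times> W) (\<lambda>p. push \<epsilon> (\<tau> (fst p)) (coord (snd p)))"
      unfolding push_def
      by (intro continuous_intros continuous_on_compose2[OF \<tau>(1)] continuous_on_compose2[OF continuous_coord[of UNIV]]
        continuous_on_compose2[OF continuous_cutoff[of UNIV]] subset_UNIV)
    show "(\<lambda>p. push \<epsilon> (\<tau> (fst p)) (coord (snd p))) ` (UNIV \<times> W) \<subseteq> ball 0 4"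
      using supported_ball[OF supported_push(1)[OF \<epsilon> \<tau>(2)]] param_coord(2) by auto
  qed
  then have cW: "continuous_on (UNIV \<times> W) ?F"
    by (rule continuous_on_eq) (auto simp: transplant_def)
  have cK: "continuous_on (UNIV \<times> - K) ?F"
    by (rule continuous_on_eq[OF continuous_on_snd[OF continuous_on_id]])
      (auto simp: transplant_outside[OF supported_push(1)[OF \<epsilon> \<tau>(2)]])
  have "open (UNIV \<times> W :: (circle \<times> 'a) set)" "open (UNIV \<times> - K :: (circle \<times> 'a) set)"
    using open_W open_cover(1) by (auto intro: open_Times)
  then have "continuous_on (UNIV \<times> W \<union> UNIV \<times> - K) ?F"
    using cW cK by (rule continuous_on_open_Un)
  moreover have "UNIV \<times> W \<union> UNIV \<times> - K = (UNIV :: (circle \<times> 'a) set)" using open_cover(2) by auto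
  ultimately have "continuous_on UNIV ?F" by simp
  then show "continuous_on UNIV (\<lambda>(\<phi>, x). ?f \<phi> x)" by (simp add: split_beta')
qed

end

section \<open>The distance between skew products\<close>

lemma C1_dist_norm_le: "ennreal (norm (e (f x) - e (k x))) \<le> C1_dist A g e f k"
  unfolding C1_dist_def by (rule order_trans[OF SUP_upper[OF UNIV_I]]) simp

lemma C1_dist_deriv_le:
  assumes "c \<in> A" "x \<in> fst c" "v \<bullet> (g c (snd c x) *v v) = 1"
  shows "ennreal (norm (chart_deriv c (e \<circ> f) x v - chart_deriv c (e \<circ> k) x v)) \<le> C1_dist A g e f k"
proof -
  let ?T = "{(c, x, v). c \<in> A \<and> x \<in> fst c \<and> v \<bullet> (g c (snd c x) *v v) = 1}"
  let ?d = "\<lambda>(c, x, v). ennreal (norm (chart_deriv c (e \<circ> f) x v - chart_deriv c (e \<circ> k) x v))"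
  have "?d (c, x, v) \<le> (SUP t\<in>?T. ?d t)" by (rule SUP_upper) (use assms in auto)
  also have "\<dots> \<le> C1_dist A g e f k" unfolding C1_dist_def by simp
  finally show ?thesis by simp
qed

lemma ennreal_norm_triangle:
  fixes a b c :: "'v::real_normed_vector"
  shows "ennreal (norm (a - c)) \<le> ennreal (norm (a - b)) + ennreal (norm (b - c))"
proof -
  have "norm (a - c) \<le> norm (a - b) + norm (b - c)" using norm_triangle_ineq[of "a - b" "b - c"] by simp
  then show ?thesis by (simp add: ennreal_leI flip: ennreal_plus)
qed

lemma C1_dist_triangle:
  fixes f k l :: "'a::topological_space \<Rightarrow> 'a"
  shows "C1_dist A g e f l \<le> C1_dist A g e f k + C1_dist A g e k l"
proof -
  let ?T = "{(c, x, v). c \<in> A \<and> x \<in> fst c \<and> v \<bullet> (g c (snd c x) *v v) = 1}"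
  define p :: "('a \<Rightarrow> 'a) \<Rightarrow> ('a \<Rightarrow> 'a) \<Rightarrow> ennreal" where "p f k = (SUP x. ennreal (norm (e (f x) - e (k x))))" for f k
  define q :: "('a \<Rightarrow> 'a) \<Rightarrow> ('a \<Rightarrow> 'a) \<Rightarrow> ennreal" where "q f k = (SUP (c, x, v)\<in>?T. ennreal (norm (chart_deriv c (e \<circ> f) x v - chart_deriv c (e \<circ> k) x v)))" for f k
  have d: "C1_dist A g e f k = p f k + q f k" for f k by (simp add: C1_dist_def p_def q_def)
  have "p f l \<le> p f k + p k l"
    unfolding p_def
  proof (rule SUP_least)
    fix x
    show "ennreal (norm (e (f x) - e (l x)))
      \<le> (SUP x. ennreal (norm (e (f x) - e (k x)))) + (SUP x. ennreal (norm (e (k x) - e (l x))))"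
      by (rule order_trans[OF ennreal_norm_triangle[where b = "e (k x)"]]) (intro add_mono SUP_upper UNIV_I)
  qed
  moreover have "q f l \<le> q f k + q k l"
    unfolding q_def
  proof (rule SUP_least)
    fix t assume "t \<in> ?T"
    then obtain c x v where t: "t = (c, x, v)" "(c, x, v) \<in> ?T" by (cases t) auto
    let ?D = "\<lambda>f k. (\<lambda>(c, x, v). ennreal (norm (chart_deriv c (e \<circ> f) x v - chart_deriv c (e \<circ> k) x v)))"
    have "?D f l (c, x, v) \<le> ?D f k (c, x, v) + ?D k l (c, x, v)" by (simp add: ennreal_norm_triangle)
    also have "\<dots> \<le> (SUP t\<in>?T. ?D f k t) + (SUP t\<in>?T. ?D k l t)"
      by (intro add_mono SUP_upper t(2))
    finally show "?D f l t \<le> (SUP t\<in>?T. ?D f k t) + (SUP t\<in>?T. ?D k l t)" by (simp only: t(1))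
  qed
  ultimately have "p f l + q f l \<le> (p f k + p k l) + (q f k + q k l)" by (rule add_mono)
  then show ?thesis unfolding d by (simp add: add_ac)
qed

lemma C1_dist_self: "C1_dist A g e f f = 0"
proof -
  have "C1_dist A g e f f \<le> 0 + 0" unfolding C1_dist_def by (intro add_mono SUP_least) auto
  then show ?thesis by simp
qed

lemma skew_dist_self: "skew_dist A g e F F = 0"
proof -
  have "skew_dist A g e F F \<le> 0" unfolding skew_dist_def by (intro SUP_least) (simp add: C1_dist_self)
  then show ?thesis by simp
qed

lemma fiber_dist_le_skew_dist:
  "C1_dist A g e (fiber_map F \<phi>) (fiber_map G \<phi>) \<le> skew_dist A g e F G"
  "C1_dist A g e (inv (fiber_map F \<phi>)) (inv (fiber_map G \<phi>)) \<le> skew_dist A g e F G"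
proof -
  let ?d = "\<lambda>\<phi>. max (C1_dist A g e (fiber_map F \<phi>) (fiber_map G \<phi>))
    (C1_dist A g e (inv (fiber_map F \<phi>)) (inv (fiber_map G \<phi>)))"
  have "?d \<phi> \<le> skew_dist A g e F G" unfolding skew_dist_def by (rule SUP_upper[OF UNIV_I])
  then show "C1_dist A g e (fiber_map F \<phi>) (fiber_map G \<phi>) \<le> skew_dist A g e F G"
    "C1_dist A g e (inv (fiber_map F \<phi>)) (inv (fiber_map G \<phi>)) \<le> skew_dist A g e F G" by simp_all
qed

lemma skew_dist_triangle: "skew_dist A g e F H \<le> skew_dist A g e F G + skew_dist A g e G H"
  unfolding skew_dist_def[of A g e F H]
proof (rule SUP_least, rule max.boundedI)
  fix \<phi>
  show "C1_dist A g e (fiber_map F \<phi>) (fiber_map H \<phi>) \<le> skew_dist A g e F G + skew_dist A g e G H"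
    by (rule order_trans[OF C1_dist_triangle[where k = "fiber_map G \<phi>"]]) (intro add_mono fiber_dist_le_skew_dist)
  show "C1_dist A g e (inv (fiber_map F \<phi>)) (inv (fiber_map H \<phi>)) \<le> skew_dist A g e F G + skew_dist A g e G H"
    by (rule order_trans[OF C1_dist_triangle[where k = "inv (fiber_map G \<phi>)"]]) (intro add_mono fiber_dist_le_skew_dist)
qed

lemma open_skew_dist_ball:
  "open_in_skew_products A g e m {G \<in> skew_products A m. skew_dist A g e F G < ennreal \<delta>}"
  unfolding open_in_skew_products_def
proof (intro conjI ballI)
  fix G assume "G \<in> {G \<in> skew_products A m. skew_dist A g e F G < ennreal \<delta>}"
  then have G: "skew_dist A g e F G < ennreal \<delta>" by simp
  then obtain r where r: "skew_dist A g e F G = ennreal r" "0 \<le> r" by (cases "skew_dist A g e F G") auto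
  then have r\<delta>: "r < \<delta>" using G by (simp add: ennreal_less_iff)
  show "\<exists>\<epsilon>>0. \<forall>H\<in>skew_products A m. skew_dist A g e G H < ennreal \<epsilon> \<longrightarrow>
      H \<in> {G \<in> skew_products A m. skew_dist A g e F G < ennreal \<delta>}"
  proof (intro exI[of _ "\<delta> - r"] conjI ballI impI)
    fix H assume H: "H \<in> skew_products A m" "skew_dist A g e G H < ennreal (\<delta> - r)"
    have "skew_dist A g e F H \<le> skew_dist A g e F G + skew_dist A g e G H" by (rule skew_dist_triangle)
    also have "\<dots> < ennreal r + ennreal (\<delta> - r)" unfolding r(1) using H(2) by (simp add: ennreal_add_left_cancel_less)
    also have "\<dots> = ennreal \<delta>" using r r\<delta> by (simp flip: ennreal_plus)
    finally show "H \<in> {G \<in> skew_products A m. skew_dist A g e F G < ennreal \<delta>}" using H(1) by simp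
  qed (use r\<delta> in simp)
qed blast

lemma connected_subset_clopen:
  assumes "connected S" "open T" "closed T" "S \<inter> T \<noteq> {}"
  shows "S \<subseteq> T"
  using connectedD[OF assms(1,2), of "- T"] assms(3,4) by (auto simp: open_Compl)

context adapted_chart
begin

lemma C1_embedding_map:
  assumes f: "C1_diffeo_onto_image A f" and c: "c \<in> A" "x \<in> fst c"
  shows "C1_near (e \<circ> f \<circ> chart_inv c) (snd c x)"
proof -
  obtain d where d: "d \<in> A" "f x \<in> fst d" using manifold_chartD(3)[OF manifold] by blast
  have f1: "C1_map_on A UNIV f" using f by (simp add: C1_diffeo_onto_image_def)
  then have cont: "continuous_on UNIV f" by (simp add: C1_map_on_def)
  note cc = is_chartD[OF chart[OF c(1)]] and dd = is_chartD[OF chart[OF d(1)]]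
  let ?S = "fst c \<inter> UNIV \<inter> f -` fst d"
  have "open (f -` fst d)" using cont dd(1) by (simp add: continuous_on_open_vimage)
  then have o: "open (snd c ` ?S)" using cc(1) by (intro chart_open_image[OF chart[OF c(1)]]) auto
  have "C_on 1 (snd c ` ?S) (snd d \<circ> f \<circ> chart_inv c)" using f1 c(1) d(1) unfolding C1_map_on_def by blast
  then have "C1_near (snd d \<circ> f \<circ> chart_inv c) (snd c x)" using C_on_1_iff[OF o] c(2) d(2) by blast
  moreover have "C1_near (e \<circ> chart_inv d) ((snd d \<circ> f \<circ> chart_inv c) (snd c x))"
    using C1_near_embedding[OF manifold embedding d] cc(4)[OF c(2)] by simp
  ultimately have C: "C1_near ((e \<circ> chart_inv d) \<circ> (snd d \<circ> f \<circ> chart_inv c)) (snd c x)"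
    by (rule C1_near_compose)
  show ?thesis
  proof (rule C1_near_transform[OF C o])
    show "snd c x \<in> snd c ` ?S" using c(2) d(2) by blast
    fix z assume "z \<in> snd c ` ?S"
    then obtain x' where "z = snd c x'" "x' \<in> fst c" "f x' \<in> fst d" by blast
    then show "((e \<circ> chart_inv d) \<circ> (snd d \<circ> f \<circ> chart_inv c)) z = (e \<circ> f \<circ> chart_inv c) z"
      using cc(4)[of x'] dd(4)[of "f x'"] by simp
  qed
qed

definition param_deriv :: "real ^ 'n \<Rightarrow> real ^ 'n \<Rightarrow> real ^ 'n" where
  "param_deriv y = frechet_derivative (snd c0 \<circ> param) (at y)"

text \<open>
  The squared Riemannian length of the tangent vector with the adapted coordinates \<open>w\<close>.
\<close>
definition speed_sq :: "real ^ 'n \<Rightarrow> real ^ 'n \<Rightarrow> real" where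
  "speed_sq y w = param_deriv y w \<bullet> (g c0 (snd c0 (param y)) *v param_deriv y w)"

lemma param_deriv: "norm y < 4 \<Longrightarrow> ((snd c0 \<circ> param) has_derivative param_deriv y) (at y)"
  unfolding param_deriv_def by (rule C1_near_has_derivative) (simp add: C1_param)

text \<open>
  A continuous function on the product of a compact ball with the unit sphere is bounded; the
  estimate extends to all vectors by homogeneity.
\<close>
lemma speed_sq_bound: "\<exists>C\<ge>0. \<forall>y w. norm y \<le> 3 \<longrightarrow> speed_sq y w \<le> C * (norm w)\<^sup>2"
proof -
  let ?\<gamma> = "\<lambda>y. snd c0 (param y)"
  have "C_on 1 (ball 0 4) (snd c0 \<circ> param)"
    unfolding C_on_1_iff[OF open_ball] using C1_param by blast
  then have contv: "continuous_on (ball 0 4) (\<lambda>y. param_deriv y w)" for w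
    by (simp add: param_deriv_def)
  have bl: "bounded_linear (param_deriv y)" if "norm y < 4" for y
    using param_deriv[OF that] by (rule has_derivative_bounded_linear)
  define B where "B y = Blinfun (param_deriv y)" for y
  have B: "blinfun_apply (B y) = param_deriv y" if "norm y < 4" for y
    unfolding B_def using bounded_linear_Blinfun_apply[OF bl[OF that]] .
  have contB: "continuous_on (ball 0 4) B"
  proof (rule continuous_on_blinfun_componentwise)
    fix i
    show "continuous_on (ball 0 4) (\<lambda>y. blinfun_apply (B y) i)"
      by (rule continuous_on_eq[OF contv[of i]]) (simp add: B)
  qed
  let ?P = "cball 0 3 \<times> sphere 0 1 :: ((real ^ 'n) \<times> (real ^ 'n)) set"
  have cont_u: "continuous_on ?P (\<lambda>p. blinfun_apply (B (fst p)) (snd p))"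
    by (intro continuous_intros continuous_on_compose2[OF contB]) auto
  have cont\<gamma>: "continuous_on (ball 0 4) ?\<gamma>"
    using is_chartD(7)[OF chart[OF c0]] W_c0 by (intro continuous_on_compose2[OF _ continuous_param]) auto
  have "continuous_on (snd c0 ` fst c0) (g c0)"
  proof -
    have "smooth_on (snd c0 ` fst c0) (g c0)"
      using manifold c0 unfolding compact_riemannian_manifold_def riemannian_metric_def by blast
    then have "C_on 0 (snd c0 ` fst c0) (g c0)" unfolding smooth_on_def by blast
    then show ?thesis by simp
  qed
  then have "continuous_on (ball 0 4) (\<lambda>y. g c0 (?\<gamma> y))"
    using cont\<gamma> by (rule continuous_on_compose2) (use W_c0 in auto)
  then have cont_g: "continuous_on ?P (\<lambda>p. g c0 (?\<gamma> (fst p)))"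
    by (rule continuous_on_compose2) (auto intro!: continuous_intros)
  let ?q = "\<lambda>p. blinfun_apply (B (fst p)) (snd p) \<bullet> (g c0 (?\<gamma> (fst p)) *v blinfun_apply (B (fst p)) (snd p))"
  have "continuous_on ?P ?q"
    unfolding matrix_vector_mult_def
    by (intro continuous_intros cont_u cont_g continuous_on_vec_lambda)
  then have "compact (?q ` ?P)" by (intro compact_continuous_image compact_Times compact_cball compact_sphere)
  then obtain C where C: "\<And>p. p \<in> ?P \<Longrightarrow> norm (?q p) \<le> C" by (meson compact_imp_bounded bounded_iff imageI)
  show ?thesis
  proof (intro exI[of _ "max 0 C"] conjI allI impI)
    fix y w :: "real ^ 'n" assume y: "norm y \<le> 3"
    then have y4: "norm y < 4" by simp
    show "speed_sq y w \<le> max 0 C * (norm w)\<^sup>2"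
    proof (cases "w = 0")
      case True
      then show ?thesis using linear_0[OF bounded_linear.linear[OF bl[OF y4]]] by (simp add: speed_sq_def)
    next
      case False
      define w1 where "w1 = w /\<^sub>R norm w"
      have w: "w = norm w *\<^sub>R w1" "norm w1 = 1" using False by (simp_all add: w1_def)
      have "speed_sq y w1 \<le> C" using C[of "(y, w1)"] y w(2) B[OF y4] by (simp add: speed_sq_def)
      moreover have "param_deriv y w = norm w *\<^sub>R param_deriv y w1"
        using linear_cmul[OF bounded_linear.linear[OF bl[OF y4]]] w(1) by metis
      then have "speed_sq y w = speed_sq y w1 * (norm w)\<^sup>2"
        by (simp add: speed_sq_def matrix_vector_mult_scaleR power2_eq_square)
      ultimately show ?thesis by (simp add: mult_right_mono max.coboundedI2)
    qed
  qed simp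
qed

text \<open>
  In the coordinates \<open>coord\<close>, which are an affine function of the embedding, \<open>C1_dist\<close> directly
  controls the difference of two maps and of their derivatives.
\<close>

lemma C1_dist_controls_coord:
  obtains C where "C > 0"
    "\<And>\<delta> f k x. C1_dist A g e f k < ennreal \<delta> \<Longrightarrow> norm (e (f x) - e (k x)) < \<delta>"
    "\<And>\<delta> f k x. C1_dist A g e f k < ennreal \<delta> \<Longrightarrow> norm (coord (k x) - coord (f x)) \<le> C * \<delta>"
    "\<And>\<delta> f k y z. C1_dist A g e f k < ennreal \<delta> \<Longrightarrow> C1_diffeo_onto_image A f \<Longrightarrow> C1_diffeo_onto_image A k \<Longrightarrow>
      norm y \<le> 3 \<Longrightarrow> norm z \<le> 3 \<Longrightarrow>
      norm ((coord (k (param y)) - coord (f (param y))) - (coord (k (param z)) - coord (f (param z)))) \<le> C * \<delta> * norm (y - z)"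
proof -
  obtain B where B: "B > 0" "\<And>z. norm (L z) \<le> norm z * B" using bounded_linear.pos_bounded[OF L] by blast
  obtain Q where Q: "Q \<ge> 0" "\<And>y w. norm y \<le> 3 \<Longrightarrow> speed_sq y w \<le> Q * (norm w)\<^sup>2" using speed_sq_bound by blast
  define C where "C = B * (1 + sqrt Q)"
  have C: "C > 0" "B \<le> C" "B * sqrt Q \<le> C" using B(1) Q(1) by (auto simp: C_def algebra_simps add_pos_nonneg)
  have diffL: "coord x - coord x' = L (e x - e x')" for x x'
    by (simp add: coord_def linear_diff[OF bounded_linear.linear[OF L]])
  have e0: "norm (e (f x) - e (k x)) < \<delta>" if "C1_dist A g e f k < ennreal \<delta>" for \<delta> f k x
  proof -
    have "ennreal (norm (e (f x) - e (k x))) < ennreal \<delta>" using C1_dist_norm_le that by (rule order_le_less_trans)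
    then show ?thesis by (simp add: ennreal_less_iff)
  qed
  show ?thesis
  proof (rule that[of C])
    show "C > 0" by (rule C(1))
    show "norm (e (f x) - e (k x)) < \<delta>" if "C1_dist A g e f k < ennreal \<delta>" for \<delta> f k x using that by (rule e0)
  next
    fix \<delta> f k x assume d: "C1_dist A g e f k < ennreal \<delta>"
    have \<delta>: "\<delta> \<ge> 0" using e0[OF d, of x] norm_ge_zero[of "e (f x) - e (k x)"] by linarith
    have "norm (coord (k x) - coord (f x)) \<le> norm (e (k x) - e (f x)) * B" unfolding diffL by (rule B(2))
    also have "\<dots> \<le> \<delta> * C" using e0[OF d, of x] C(2) B(1) \<delta>
      by (intro mult_mono) (auto simp: norm_minus_commute)
    finally show "norm (coord (k x) - coord (f x)) \<le> C * \<delta>" by (simp add: mult.commute)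
  next
    fix \<delta> f k and y z :: "real ^ 'n"
    assume d: "C1_dist A g e f k < ennreal \<delta>" and f: "C1_diffeo_onto_image A f" and k: "C1_diffeo_onto_image A k"
      and yz: "norm y \<le> 3" "norm z \<le> 3"
    have \<delta>: "\<delta> > 0" using e0[OF d, of undefined] by (meson norm_ge_zero order_le_less_trans)
    define \<Delta> where "\<Delta> y = coord (k (param y)) - coord (f (param y))" for y
    define \<Delta>' where "\<Delta>' y w = L (chart_deriv c0 (e \<circ> k) (param y) (param_deriv y w) - chart_deriv c0 (e \<circ> f) (param y) (param_deriv y w))" for y w
    have der: "((\<lambda>y. e (l (param y))) has_derivative (\<lambda>w. chart_deriv c0 (e \<circ> l) (param y) (param_deriv y w))) (at y)"
      if y: "norm y < 4" and l: "C1_diffeo_onto_image A l" for y l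
    proof -
      have pc: "param y \<in> fst c0" using W_c0 y by auto
      have "((e \<circ> l \<circ> chart_inv c0) has_derivative chart_deriv c0 (e \<circ> l) (param y)) (at (snd c0 (param y)))"
        unfolding chart_deriv_def by (rule C1_near_has_derivative[OF C1_embedding_map[OF l c0 pc]])
      then have "((e \<circ> l \<circ> chart_inv c0) \<circ> (snd c0 \<circ> param) has_derivative chart_deriv c0 (e \<circ> l) (param y) \<circ> param_deriv y) (at y)"
        by (intro diff_chain_at[OF param_deriv[OF y]]) simp
      then have "((e \<circ> l \<circ> chart_inv c0) \<circ> (snd c0 \<circ> param) has_derivative (\<lambda>w. chart_deriv c0 (e \<circ> l) (param y) (param_deriv y w))) (at y)"
        by (simp only: o_def)
      then show ?thesis
      proof (rule has_derivative_transform_within_open[of _ _ _ _ "ball 0 4"])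
        fix y' :: "real ^ 'n" assume "y' \<in> ball 0 4"
        then have "param y' \<in> fst c0" using W_c0 by auto
        then show "((e \<circ> l \<circ> chart_inv c0) \<circ> (snd c0 \<circ> param)) y' = e (l (param y'))"
          using is_chartD(4)[OF chart[OF c0]] by simp
      qed (use y in auto)
    qed
    have der\<Delta>: "(\<Delta> has_derivative \<Delta>' y) (at y)" if y: "norm y < 4" for y
      unfolding \<Delta>_def[abs_def] diffL \<Delta>'_def[abs_def]
      by (intro bounded_linear.has_derivative[OF L] has_derivative_diff der y f k)
    have bound\<Delta>: "norm (\<Delta>' y w) \<le> C * \<delta> * norm w" if y: "norm y \<le> 3" for y w
    proof (cases "param_deriv y w = 0")
      case True
      have "linear (chart_deriv c0 (e \<circ> l) (param y))" if l: "C1_diffeo_onto_image A l" for l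
      proof -
        have pc: "param y \<in> fst c0" using W_c0 y by auto
        show ?thesis unfolding chart_deriv_def
          by (rule has_derivative_linear[OF C1_near_has_derivative[OF C1_embedding_map[OF l c0 pc]]])
      qed
      then have "\<Delta>' y w = 0" using f k True linear_0[OF bounded_linear.linear[OF L]] by (simp add: \<Delta>'_def linear_0)
      then show ?thesis using C \<delta> by simp
    next
      case False
      define u where "u = param_deriv y w"
      have pc: "param y \<in> fst c0" using W_c0 y by auto
      have lin: "linear (chart_deriv c0 (e \<circ> l) (param y))" if l: "C1_diffeo_onto_image A l" for l
        unfolding chart_deriv_def
        by (rule has_derivative_linear[OF C1_near_has_derivative[OF C1_embedding_map[OF l c0 pc]]])
      have "u \<bullet> (g c0 (snd c0 (param y)) *v u) > 0"
        using False manifold c0 pc unfolding u_def compact_riemannian_manifold_def riemannian_metric_def by blast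
      then have sp: "speed_sq y w > 0" by (simp add: speed_sq_def u_def)
      define t where "t = sqrt (speed_sq y w)"
      have t: "t > 0" "t * t = speed_sq y w" using sp by (auto simp: t_def)
      define v where "v = u /\<^sub>R t"
      have u: "u = t *\<^sub>R v" using t(1) by (simp add: v_def)
      have "v \<bullet> (g c0 (snd c0 (param y)) *v v) = speed_sq y w / (t * t)"
        by (simp add: v_def matrix_vector_mult_scaleR speed_sq_def u_def divide_inverse)
      then have v1: "v \<bullet> (g c0 (snd c0 (param y)) *v v) = 1" using t sp by simp
      let ?D = "\<lambda>v. chart_deriv c0 (e \<circ> k) (param y) v - chart_deriv c0 (e \<circ> f) (param y) v"
      have "ennreal (norm (?D v)) < ennreal \<delta>"
        using order_le_less_trans[OF C1_dist_deriv_le[of c0 A "param y" v g e f k, OF c0 pc v1] d]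
        by (simp add: norm_minus_commute)
      then have Dv: "norm (?D v) < \<delta>" by (simp add: ennreal_less_iff)
      have "?D u = t *\<^sub>R ?D v"
        unfolding u using linear_cmul[OF lin[OF f]] linear_cmul[OF lin[OF k]] by (simp add: scaleR_diff_right)
      then have "norm (?D u) \<le> t * \<delta>" using Dv t(1) by simp
      moreover have "t \<le> sqrt Q * norm w"
      proof -
        have "t \<le> sqrt (Q * (norm w)\<^sup>2)" unfolding t_def using Q(2)[OF y] by (rule real_sqrt_le_mono)
        then show ?thesis by (simp add: real_sqrt_mult)
      qed
      then have "t * \<delta> \<le> sqrt Q * norm w * \<delta>" using \<delta> by (intro mult_right_mono) auto
      ultimately have "norm (?D u) \<le> sqrt Q * norm w * \<delta>" by linarith
      then have "norm (?D u) * B \<le> (sqrt Q * norm w * \<delta>) * B" using B(1) by (intro mult_right_mono) auto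
      then have "norm (\<Delta>' y w) \<le> (sqrt Q * norm w * \<delta>) * B"
        unfolding \<Delta>'_def u_def[symmetric] using B(2)[of "?D u"] by linarith
      also have "\<dots> = (B * sqrt Q) * (\<delta> * norm w)" by simp
      also have "\<dots> \<le> C * (\<delta> * norm w)" using C(3) \<delta> by (intro mult_right_mono) auto
      finally show ?thesis by (simp add: mult.assoc)
    qed
    have "norm (\<Delta> y - \<Delta> z) \<le> C * \<delta> * norm (y - z)"
    proof (rule differentiable_bound[of "cball 0 3" \<Delta> \<Delta>'])
      fix x :: "real ^ 'n" assume "x \<in> cball 0 3"
      then have x: "norm x \<le> 3" by simp
      show "(\<Delta> has_derivative \<Delta>' x) (at x within cball 0 3)"
        by (rule has_derivative_at_withinI[OF der\<Delta>]) (use x in simp)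
      show "onorm (\<Delta>' x) \<le> C * \<delta>" by (rule onorm_le) (rule bound\<Delta>[OF x])
    qed (use yz in auto)
    then show "norm ((coord (k (param y)) - coord (f (param y))) - (coord (k (param z)) - coord (f (param z)))) \<le> C * \<delta> * norm (y - z)"
      by (simp add: \<Delta>_def)
  qed
qed

text \<open>
  The map \<open>coord\<close> is defined on the whole manifold and is injective only on \<open>W\<close>. That a perturbed map
  does not leave \<open>W\<close> has to be read off from the embedding itself.
\<close>
lemma close_to_K_in_W:
  obtains \<delta> where "\<delta> > 0" "\<And>x x'. x \<in> K \<Longrightarrow> norm (e x - e x') < \<delta> \<Longrightarrow> x' \<in> W"
proof -
  have "compact (- W)" using open_W compact_M by (metis closed_Compl compact_Int_closed inf_top.left_neutral)
  then have "closed (e ` (- W))" by (intro compact_imp_closed compact_continuous_image continuous_e)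
  moreover have "compact (e ` K)" by (intro compact_continuous_image continuous_e compact_K)
  moreover have "e ` K \<inter> e ` (- W) = {}" using K_W inj_e by (auto dest: injD)
  ultimately obtain d where d: "d > 0" "\<forall>x\<in>e ` K. \<forall>y\<in>e ` (- W). d \<le> dist x y"
    using separate_compact_closed by metis
  show ?thesis
  proof (rule that[OF d(1)])
    fix x x' assume "x \<in> K" "norm (e x - e x') < d"
    then show "x' \<in> W" using d(2) by (metis ComplI dist_norm imageI not_le)
  qed
qed

section \<open>A robust massive attractor\<close>

text \<open>
  The model contracts the ball of radius 2 by \<open>1 - \<epsilon>\<close> towards the point \<open>\<tau> \<phi>\<close> of the unit ball, and both
  the trapping property and the contraction persist under perturbations smaller than \<open>\<epsilon> / 2\<close>. The
  covering property is verified backwards in time: the metric controls the inverse fibre maps, so a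
  backward orbit of the perturbed map along the steered base orbit stays close enough to that of
  the model to end up in the ball of radius \<open>\<rho>\<close>.
\<close>
lemma robust_massive_attractor:
  assumes m: "m \<ge> 3"
  shows "\<exists>F\<in>skew_products A m. \<exists>\<delta>>0. \<forall>G\<in>skew_products A m. skew_dist A g e F G < ennreal \<delta> \<longrightarrow>
    (\<exists>\<Lambda>. massive_attractor (lebesgue_on_product A g) G \<Lambda>)"
proof -
  obtain N \<sigma> and \<tau> :: "circle \<Rightarrow> real ^ 'n" where N: "N \<ge> 1" and \<sigma>: "0 < \<sigma>" "\<sigma> \<le> 1"
    and \<tau>: "continuous_on UNIV \<tau>" "\<And>\<phi>. norm (\<tau> \<phi>) \<le> 1"
    and steer: "\<And>\<phi> x. \<exists>\<theta> :: nat \<Rightarrow> circle. \<theta> 0 = \<phi> \<and> (\<forall>k<N. expanding_map m (\<theta> (Suc k)) = \<theta> k) \<and>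
       (\<forall>k. 1 \<le> k \<and> k < N \<longrightarrow> \<tau> (\<theta> k) = 0) \<and> x \<bullet> \<tau> (\<theta> N) \<ge> \<sigma> * norm x"
    by (rule steering_function[OF m]) (rule that)
  obtain \<rho> \<epsilon> \<eta> :: real where \<rho>: "0 < \<rho>" "\<rho> \<le> 1" and \<epsilon>: "0 < \<epsilon>" "\<epsilon> \<le> 1 / 100" and \<eta>: "0 < \<eta>"
    and returns: "\<And>(y :: nat \<Rightarrow> real ^ 'n) v. norm (y 0) < \<rho> \<Longrightarrow> norm v \<le> 1 \<Longrightarrow> y 0 \<bullet> v \<ge> \<sigma> * norm (y 0) \<Longrightarrow>
      (\<And>k. k < N \<Longrightarrow> norm (y k) \<le> 1 \<Longrightarrow>
        norm (y (Suc k) - (1 / (1 - \<epsilon>)) *\<^sub>R (y k - \<epsilon> *\<^sub>R (if Suc k = N then v else 0))) \<le> \<eta>) \<Longrightarrow>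
      (\<forall>k\<le>N. norm (y k) \<le> 1) \<and> norm (y N) < \<rho>"
  proof (rule backward_orbit_returns[OF N \<sigma>, where ?'v = "real ^ 'n"])
    fix \<rho> \<epsilon> \<eta> :: real
    assume "0 < \<rho>" "\<rho> \<le> 1" "0 < \<epsilon>" "\<epsilon> \<le> 1 / 100" "0 < \<eta>"
      "\<And>(y :: nat \<Rightarrow> real ^ 'n) v. norm (y 0) < \<rho> \<Longrightarrow> norm v \<le> 1 \<Longrightarrow> y 0 \<bullet> v \<ge> \<sigma> * norm (y 0) \<Longrightarrow>
      (\<And>k. k < N \<Longrightarrow> norm (y k) \<le> 1 \<Longrightarrow>
        norm (y (Suc k) - (1 / (1 - \<epsilon>)) *\<^sub>R (y k - \<epsilon> *\<^sub>R (if Suc k = N then v else 0))) \<le> \<eta>) \<Longrightarrow>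
      (\<forall>k\<le>N. norm (y k) \<le> 1) \<and> norm (y N) < \<rho>"
    then show thesis by (rule that)
  qed
  obtain C where C: "C > 0"
    and close_e: "\<And>\<delta> f k x. C1_dist A g e f k < ennreal \<delta> \<Longrightarrow> norm (e (f x) - e (k x)) < \<delta>"
    and close: "\<And>\<delta> f k x. C1_dist A g e f k < ennreal \<delta> \<Longrightarrow> norm (coord (k x) - coord (f x)) \<le> C * \<delta>"
    and close1: "\<And>\<delta> f k y z. C1_dist A g e f k < ennreal \<delta> \<Longrightarrow> C1_diffeo_onto_image A f \<Longrightarrow> C1_diffeo_onto_image A k \<Longrightarrow>
      norm y \<le> 3 \<Longrightarrow> norm z \<le> 3 \<Longrightarrow>
      norm ((coord (k (param y)) - coord (f (param y))) - (coord (k (param z)) - coord (f (param z)))) \<le> C * \<delta> * norm (y - z)"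
    by (rule C1_dist_controls_coord) (rule that)
  obtain \<delta>1 where \<delta>1: "\<delta>1 > 0" "\<And>x x'. x \<in> K \<Longrightarrow> norm (e x - e x') < \<delta>1 \<Longrightarrow> x' \<in> W"
    by (rule close_to_K_in_W) (rule that)
  define \<delta> where "\<delta> = min \<delta>1 (min (\<eta> / C) (\<epsilon> / (2 * C)))"
  have \<delta>: "\<delta> > 0" "\<delta> \<le> \<delta>1" "C * \<delta> \<le> \<eta>" "C * \<delta> \<le> \<epsilon> / 2"
  proof -
    show "\<delta> > 0" "\<delta> \<le> \<delta>1" using \<delta>1(1) \<eta> \<epsilon>(1) C by (auto simp: \<delta>_def)
    have "\<delta> \<le> \<eta> / C" "\<delta> \<le> \<epsilon> / (2 * C)" by (auto simp: \<delta>_def)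
    then show "C * \<delta> \<le> \<eta>" "C * \<delta> \<le> \<epsilon> / 2" using C by (auto simp: field_simps)
  qed
  let ?F = "model m \<epsilon> \<tau>"
  have \<epsilon>0: "0 \<le> \<epsilon>" using \<epsilon> by simp
  note sp = supported_push[OF \<epsilon>0 \<epsilon>(2) \<tau>(2)]
  define f where "f \<phi> = transplant (push \<epsilon> (\<tau> \<phi>))" for \<phi>
  have f_diffeo: "C1_diffeo_onto_image A (f \<phi>)" and f_inv: "inv (f \<phi>) = transplant (inv (push \<epsilon> (\<tau> \<phi>)))" for \<phi>
    unfolding f_def by (rule C1_diffeo_transplant[OF sp inv_push[OF \<epsilon>0 \<epsilon>(2) \<tau>(2)]])+
  have f_param: "f \<phi> (param y) = param ((1 - \<epsilon>) *\<^sub>R y + \<epsilon> *\<^sub>R \<tau> \<phi>)" if "norm y \<le> 2" for \<phi> y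
    using that by (simp add: f_def transplant_param push_inside)
  have norm_push: "norm ((1 - \<epsilon>) *\<^sub>R y + \<epsilon> *\<^sub>R \<tau> \<phi>) \<le> 2 - \<epsilon>" if "norm y \<le> 2" for \<phi> y
  proof -
    have "norm ((1 - \<epsilon>) *\<^sub>R y + \<epsilon> *\<^sub>R \<tau> \<phi>) \<le> (1 - \<epsilon>) * norm y + \<epsilon> * norm (\<tau> \<phi>)"
      using \<epsilon> by (intro order_trans[OF norm_triangle_ineq]) simp
    also have "\<dots> \<le> (1 - \<epsilon>) * 2 + \<epsilon> * 1" using \<epsilon> that \<tau>(2) by (intro add_mono mult_left_mono) auto
    finally show ?thesis by simp
  qed
  have finv_param: "inv (f \<phi>) (param y) = param ((1 / (1 - \<epsilon>)) *\<^sub>R (y - \<epsilon> *\<^sub>R \<tau> \<phi>))"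
    and finv_norm: "norm ((1 / (1 - \<epsilon>)) *\<^sub>R (y - \<epsilon> *\<^sub>R \<tau> \<phi>)) \<le> 2" if y: "norm y \<le> 1" for \<phi> y
  proof -
    let ?z = "(1 / (1 - \<epsilon>)) *\<^sub>R (y - \<epsilon> *\<^sub>R \<tau> \<phi>)"
    have "norm (y - \<epsilon> *\<^sub>R \<tau> \<phi>) \<le> 1 + \<epsilon> * 1"
      using y \<tau>(2)[of \<phi>] \<epsilon>0 by (intro order_trans[OF norm_triangle_ineq4] add_mono) (auto intro: mult_left_le)
    also have "\<dots> \<le> 2 * (1 - \<epsilon>)" using \<epsilon> by simp
    finally show z: "norm ?z \<le> 2" using \<epsilon> by (simp add: divide_le_eq mult.commute)
    have "(1 - \<epsilon>) *\<^sub>R ?z + \<epsilon> *\<^sub>R \<tau> \<phi> = y" using \<epsilon> by simp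
    then have "inv (push \<epsilon> (\<tau> \<phi>)) y = ?z" using inv_push_inside[OF \<epsilon>0 \<epsilon>(2) \<tau>(2)[of \<phi>] z] by simp
    then show "inv (f \<phi>) (param y) = param ?z" using y by (simp add: f_inv transplant_param)
  qed
  have "\<exists>\<Lambda>. massive_attractor (lebesgue_on_product A g) G \<Lambda>"
    if G: "G \<in> skew_products A m" and dist: "skew_dist A g e ?F G < ennreal \<delta>" for G
  proof -
    obtain k where k: "G = (\<lambda>(\<phi>, x). (expanding_map m \<phi>, k \<phi> x))" "\<And>\<phi>. C1_diffeo_onto_image A (k \<phi>)"
      "continuous_on UNIV (\<lambda>(\<phi>, x). k \<phi> x)" using G unfolding skew_products_def by blast
    have Gk: "G (\<phi>, x) = (expanding_map m \<phi>, k \<phi> x)" for \<phi> x by (simp add: k(1))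
    have fk: "fiber_map G \<phi> = k \<phi>" for \<phi> by (simp add: fiber_map_def Gk fun_eq_iff)
    have d1: "C1_dist A g e (f \<phi>) (k \<phi>) < ennreal \<delta>" for \<phi>
      using fiber_dist_le_skew_dist(1)[of A g e ?F \<phi> G] dist unfolding fk fiber_map_model f_def by (rule order_le_less_trans)
    have d2: "C1_dist A g e (inv (f \<phi>)) (inv (k \<phi>)) < ennreal \<delta>" for \<phi>
      using fiber_dist_le_skew_dist(2)[of A g e ?F \<phi> G] dist unfolding fk fiber_map_model f_def by (rule order_le_less_trans)
    have k_into: "k \<phi> (param y) \<in> W \<and> norm (coord (k \<phi> (param y))) < 2" if y: "norm y \<le> 2" for \<phi> y
    proof -
      let ?z = "(1 - \<epsilon>) *\<^sub>R y + \<epsilon> *\<^sub>R \<tau> \<phi>"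
      have z: "norm ?z \<le> 2 - \<epsilon>" by (rule norm_push[OF y])
      have "param ?z \<in> K" using z \<epsilon> by (intro imageI) simp
      moreover have "norm (e (param ?z) - e (k \<phi> (param y))) < \<delta>1"
        using close_e[OF d1, of \<phi> "param y"] \<delta>(2) by (simp add: f_param[OF y])
      ultimately have "k \<phi> (param y) \<in> W" by (rule \<delta>1(2))
      moreover have "norm (coord (k \<phi> (param y)) - ?z) \<le> \<epsilon> / 2"
      proof -
        have "norm ?z < 4" using z \<epsilon> by simp
        then have "coord (f \<phi> (param y)) = ?z" by (simp add: f_param[OF y] coord_param)
        then show ?thesis using close[OF d1, of \<phi> "param y"] \<delta>(4) by simp
      qed
      then have "norm (coord (k \<phi> (param y))) \<le> (2 - \<epsilon>) + \<epsilon> / 2"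
        using z norm_triangle_sub[of "coord (k \<phi> (param y))" ?z] by linarith
      then have "norm (coord (k \<phi> (param y))) < 2" using \<epsilon> by linarith
      ultimately show ?thesis by blast
    qed
    have k_ball: "k \<phi> (param y) \<in> param ` ball 0 2" if y: "norm y \<le> 2" for \<phi> y
    proof -
      have "k \<phi> (param y) = param (coord (k \<phi> (param y)))" using k_into[OF y] param_coord(1) by metis
      then show ?thesis using k_into[OF y] by (metis imageI mem_ball_0)
    qed
    have contk: "continuous_on UNIV (k \<phi>)" for \<phi>
      using k(2)[of \<phi>] by (simp add: C1_diffeo_onto_image_def C1_map_on_def)
    have inj_k: "inj (k \<phi>)" for \<phi> using k(2)[of \<phi>] by (simp add: C1_diffeo_onto_image_def)
    have conn: "connected (param ` ball 0 2)"
      by (intro connected_continuous_image continuous_on_subset[OF continuous_param] connected_ball) auto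
    \<comment> \<open>To follow orbits backwards, the ball must lie in the range of the fibre map. The range is open
      and compact, and it meets the connected ball.\<close>
    have range_k: "param ` ball 0 2 \<subseteq> range (k \<phi>)" for \<phi>
    proof (rule connected_subset_clopen[OF conn])
      show "open (range (k \<phi>))" using k(2)[of \<phi>] by (simp add: C1_diffeo_onto_image_def)
      show "closed (range (k \<phi>))"
        by (intro compact_imp_closed compact_continuous_image contk compact_M)
      show "param ` ball 0 2 \<inter> range (k \<phi>) \<noteq> {}" using k_ball[of 0 \<phi>] by auto
    qed
    have covering: "UNIV \<times> param ` ball 0 \<rho> \<subseteq> (G ^^ N) ` (UNIV \<times> param ` ball 0 \<rho>)"
    proof
      fix p :: "circle \<times> 'a" assume "p \<in> UNIV \<times> param ` ball 0 \<rho>"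
      then obtain \<phi> y0 where p: "p = (\<phi>, param y0)" "norm y0 < \<rho>" by auto
      obtain \<theta> :: "nat \<Rightarrow> circle" where \<theta>: "\<theta> 0 = \<phi>" "\<And>k. k < N \<Longrightarrow> expanding_map m (\<theta> (Suc k)) = \<theta> k"
        "\<And>k. 1 \<le> k \<Longrightarrow> k < N \<Longrightarrow> \<tau> (\<theta> k) = 0" "y0 \<bullet> \<tau> (\<theta> N) \<ge> \<sigma> * norm y0"
        using steer[of \<phi> y0] by blast
      \<comment> \<open>The sequence is defined in coordinates, so that the estimate for each step only needs
        \<open>norm (y i) \<le> 1\<close>; that it comes from an orbit of \<open>G\<close> is checked afterwards.\<close>
      define y where "y = rec_nat y0 (\<lambda>i z. coord (inv (k (\<theta> (Suc i))) (param z)))"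
      have y: "y 0 = y0" "\<And>i. y (Suc i) = coord (inv (k (\<theta> (Suc i))) (param (y i)))" by (simp_all add: y_def)
      have step: "norm (y (Suc i) - (1 / (1 - \<epsilon>)) *\<^sub>R (y i - \<epsilon> *\<^sub>R \<tau> (\<theta> (Suc i)))) \<le> \<eta>
          \<and> inv (k (\<theta> (Suc i))) (param (y i)) \<in> W" if "norm (y i) \<le> 1" for i
      proof -
        let ?z = "(1 / (1 - \<epsilon>)) *\<^sub>R (y i - \<epsilon> *\<^sub>R \<tau> (\<theta> (Suc i)))"
        have z: "inv (f (\<theta> (Suc i))) (param (y i)) = param ?z" "norm ?z \<le> 2"
          using finv_param[OF that] finv_norm[OF that] by blast+
        have "param ?z \<in> K" using z(2) by (intro imageI) (simp only: mem_cball_0)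
        moreover have "norm (e (param ?z) - e (inv (k (\<theta> (Suc i))) (param (y i)))) < \<delta>1"
          using close_e[OF d2, of "\<theta> (Suc i)" "param (y i)"] \<delta>(2) unfolding z(1) by (rule order_less_le_trans)
        ultimately have "inv (k (\<theta> (Suc i))) (param (y i)) \<in> W" by (rule \<delta>1(2))
        moreover have "norm (y (Suc i) - ?z) \<le> \<eta>"
        proof -
          have "norm ?z < 4" using z(2) by linarith
          then have "coord (param ?z) = ?z" by (rule coord_param)
          then show ?thesis using close[OF d2, of "\<theta> (Suc i)" "param (y i)"] \<delta>(3) unfolding z(1) y(2) by simp
        qed
        ultimately show ?thesis by blast
      qed
      have bk: "(\<forall>i\<le>N. norm (y i) \<le> 1) \<and> norm (y N) < \<rho>"
      proof (rule returns[of y "\<tau> (\<theta> N)"])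
        show "norm (y 0) < \<rho>" "norm (\<tau> (\<theta> N)) \<le> 1" "y 0 \<bullet> \<tau> (\<theta> N) \<ge> \<sigma> * norm (y 0)"
          using p(2) \<tau>(2) \<theta>(4) by (simp_all add: y(1))
        fix i assume i: "i < N" "norm (y i) \<le> 1"
        have "(if Suc i = N then \<tau> (\<theta> N) else 0) = \<tau> (\<theta> (Suc i))" using \<theta>(3)[of "Suc i"] i(1) by auto
        then show "norm (y (Suc i) - (1 / (1 - \<epsilon>)) *\<^sub>R (y i - \<epsilon> *\<^sub>R (if Suc i = N then \<tau> (\<theta> N) else 0))) \<le> \<eta>"
          using step[OF i(2)] by (simp only:)
      qed
      have G_step: "G (\<theta> (Suc i), param (y (Suc i))) = (\<theta> i, param (y i))" if i: "i < N" for i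
      proof -
        have y1: "norm (y i) \<le> 1" using bk i by simp
        then have "param (y (Suc i)) = inv (k (\<theta> (Suc i))) (param (y i))"
          using step[OF y1] param_coord(1) y(2) by metis
        moreover have "param (y i) \<in> range (k (\<theta> (Suc i)))"
          using y1 by (intro subsetD[OF range_k] imageI) simp
        ultimately have "k (\<theta> (Suc i)) (param (y (Suc i))) = param (y i)" by (simp add: f_inv_into_f)
        then show ?thesis by (simp add: Gk \<theta>(2)[OF i])
      qed
      have "(G ^^ i) (\<theta> i, param (y i)) = (\<phi>, param y0)" if "i \<le> N" for i
        using that
      proof (induction i)
        case (Suc i)
        then show ?case using G_step[of i] by (simp add: funpow_Suc_right del: funpow.simps)
      qed (simp add: \<theta>(1) y(1))
      then have "p = (G ^^ N) (\<theta> N, param (y N))" using p(1) by simp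
      moreover have "(\<theta> N, param (y N)) \<in> UNIV \<times> param ` ball 0 \<rho>" using bk by simp
      ultimately show "p \<in> (G ^^ N) ` (UNIV \<times> param ` ball 0 \<rho>)" by blast
    qed
    have cont_G: "continuous_on UNIV G"
    proof -
      have "continuous_on UNIV (\<lambda>p. (expanding_map m (fst p), (\<lambda>(\<phi>, x). k \<phi> x) p))"
        by (intro continuous_on_Pair k(3) continuous_intros)
      moreover have "G = (\<lambda>p. (expanding_map m (fst p), (\<lambda>(\<phi>, x). k \<phi> x) p))" by (auto simp: k(1) fun_eq_iff)
      ultimately show ?thesis by simp
    qed
    interpret S: covering_fibre_contraction m G e coord param "1 - \<epsilon> / 2" N \<rho>
    proof
      show "m \<ge> 2" using m by simp
      show "compact (UNIV :: 'a set)" by (rule compact_M)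
      show "continuous_on UNIV e" "inj e" by (rule continuous_e, rule inj_e)
      show "fst (G p) = expanding_map m (fst p)" for p by (cases p) (simp add: Gk)
      show "continuous_on UNIV G" by (rule cont_G)
      show "x = y" if "G (\<phi>, x) = G (\<phi>, y)" for \<phi> x y using that inj_k by (auto simp: Gk dest: injD)
      show "continuous_on UNIV coord" by (rule continuous_coord)
      show "continuous_on (cball 0 2) param" by (rule continuous_on_subset[OF continuous_param]) auto
      show "coord (param y) = y" if "y \<in> cball 0 2" for y using that by (intro coord_param) simp
      show "open (param ` ball 0 2)" by (rule open_param_image) auto
      show "snd (G (\<phi>, param y)) \<in> param ` ball 0 2" if "y \<in> cball 0 2" for \<phi> y
        using k_ball[of y \<phi>] that by (simp add: Gk)
      show "0 \<le> 1 - \<epsilon> / 2" "1 - \<epsilon> / 2 < 1" using \<epsilon> by auto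
      show "N \<ge> 1" "0 < \<rho>" "\<rho> \<le> 2" using N \<rho> by auto
      show "UNIV \<times> param ` ball 0 \<rho> \<subseteq> (G ^^ N) ` (UNIV \<times> param ` ball 0 \<rho>)" by (rule covering)
      fix \<phi> and y z :: "real ^ 'n" assume "y \<in> cball 0 2" "z \<in> cball 0 2"
      then have yz: "norm y \<le> 2" "norm z \<le> 2" by auto
      have cf: "coord (f \<phi> (param y)) = (1 - \<epsilon>) *\<^sub>R y + \<epsilon> *\<^sub>R \<tau> \<phi>" if "norm y \<le> 2" for y
        using norm_push[OF that, of \<phi>] \<epsilon> by (simp add: f_param[OF that] coord_param)
      let ?\<Delta> = "\<lambda>y. coord (k \<phi> (param y)) - coord (f \<phi> (param y))"
      have "norm (?\<Delta> y - ?\<Delta> z) \<le> C * \<delta> * norm (y - z)"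
        using yz by (intro close1[OF d1 f_diffeo k(2)]) auto
      also have "\<dots> \<le> \<epsilon> / 2 * norm (y - z)" using \<delta>(4) by (intro mult_right_mono) auto
      finally have small: "norm (?\<Delta> y - ?\<Delta> z) \<le> \<epsilon> / 2 * norm (y - z)" .
      have split: "coord (k \<phi> (param y)) - coord (k \<phi> (param z)) = (1 - \<epsilon>) *\<^sub>R (y - z) + (?\<Delta> y - ?\<Delta> z)"
        using yz by (simp add: cf algebra_simps)
      have "norm ((1 - \<epsilon>) *\<^sub>R (y - z)) = (1 - \<epsilon>) * norm (y - z)" using \<epsilon> by simp
      then have "norm (coord (k \<phi> (param y)) - coord (k \<phi> (param z))) \<le> (1 - \<epsilon>) * norm (y - z) + \<epsilon> / 2 * norm (y - z)"
        unfolding split using small norm_triangle_ineq[of "(1 - \<epsilon>) *\<^sub>R (y - z)" "?\<Delta> y - ?\<Delta> z"] by linarith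
      also have "\<dots> = (1 - \<epsilon> / 2) * norm (y - z)" by (simp add: algebra_simps)
      finally show "dist (coord (snd (G (\<phi>, param y)))) (coord (snd (G (\<phi>, param z)))) \<le> (1 - \<epsilon> / 2) * dist y z"
        by (simp add: Gk dist_norm)
    qed
    have "massive_attractor (lebesgue_on_product A g) G S.attractor"
      unfolding lebesgue_on_product_def
    proof (rule S.massive_attractor)
      show "sigma_finite_measure (riemannian_volume A g)" by (rule sigma_finite_riemannian_volume[OF manifold])
      show "sets (riemannian_volume A g) = sets borel" by (rule riemannian_volume_eq[OF manifold])
      show "emeasure (riemannian_volume A g) (param ` ball 0 2) > 0"
        by (rule riemannian_volume_open_pos[OF manifold S.open_param_ball]) simp
    qed
    then show ?thesis by blast
  qed
  then show ?thesis
    using model_in_skew_products[OF \<epsilon>0 \<epsilon>(2) \<tau>, of m] \<delta>(1) by blast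
qed

end

theorem theorem2:
  fixes A :: "('a::{t2_space, second_countable_topology}, 'n::finite) chart set"
    and g :: "('a, 'n) chart \<Rightarrow> real ^ 'n \<Rightarrow> real ^ 'n ^ 'n"
    and e :: "'a \<Rightarrow> 'b::euclidean_space"
    and m :: nat
  assumes "compact_riemannian_manifold A g"
    and "smooth_embedding A e"
    and "m \<ge> 3"
  shows "\<exists>U. U \<noteq> {} \<and> open_in_skew_products A g e m U \<and>
           (\<forall>F\<in>U. \<exists>\<Lambda>. massive_attractor (lebesgue_on_product A g) F \<Lambda>)"
proof -
  obtain c0 L k0 param where "adapted_chart A g e c0 L k0 param"
    using adapted_chart_exists[OF assms(1,2)] by blast
  then obtain F \<delta> where F: "F \<in> skew_products A m" "\<delta> > 0"
    "\<And>G. G \<in> skew_products A m \<Longrightarrow> skew_dist A g e F G < ennreal \<delta> \<Longrightarrow>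
      \<exists>\<Lambda>. massive_attractor (lebesgue_on_product A g) G \<Lambda>"
    using adapted_chart.robust_massive_attractor[OF _ assms(3)] by metis
  let ?U = "{G \<in> skew_products A m. skew_dist A g e F G < ennreal \<delta>}"
  have "F \<in> ?U" using F(1,2) by (simp add: skew_dist_self)
  then show ?thesis using open_skew_dist_ball F(3) by (intro exI[of _ ?U]) blast
qed

end
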